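(* Let $\rho_0$ be a Borel probability measure on $\mathbb{R}$ with $\int_{\mathbb{R}}x^2\,d\rho_0(x)<\infty$ and let $v_0:\mathbb{R}\to\mathbb{R}$ be absolutely continuous. Then there is a weak solution pair $\rho$ and $v$ of the sticky particle system with initial conditions $\rho|_{t=0}=\rho_0$, $v|_{t=0}=v_0$, which has the following properties. (i) For Lebesgue almost every $t,s\ge0$ with $s\le t$, $$\int_{\mathbb{R}}\frac12 v(x,t)^2\,d\rho_t(x)\le\int_{\mathbb{R}}\frac12 v(x,s)^2\,d\rho_s(x)\le\int_{\mathbb{R}}\frac12 v_0(x)^2\,d\rho_0(x).$$ (ii) For Lebesgue almost every $t\in(0,\infty)$, $$(v(x,t)-v(y,t))(x-y)\le\frac1t(x-y)^2$$ for $\rho_t$ almost every $x,y\in\mathbb{R}$.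
   Context: Absolute continuity of $v_0$ on $\mathbb{R}$ is in the usual $\varepsilon$–$\delta$ sense on all of $\mathbb{R}$. $\mathcal{P}(\mathbb{R})$ is the space of Borel probability measures on $\mathbb{R}$; $\mu^k\to\mu$ narrowly means $\int g\,d\mu^k\to\int g\,d\mu$ for all bounded continuous $g:\mathbb{R}\to\mathbb{R}$. The sticky particle system is $\partial_t\rho+\partial_x(\rho v)=0$, $\partial_t(\rho v)+\partial_x(\rho v^2)=0$ in $\mathbb{R}\times(0,\infty)$. Let $\rho_0\in\mathcal{P}(\mathbb{R})$ and $v_0:\mathbb{R}\to\mathbb{R}$ be continuous with $\int|v_0|\,d\rho_0<\infty$. A narrowly continuous $\rho:[0,\infty)\to\mathcal{P}(\mathbb{R})$, $t\mapsto\rho_t$, and a Borel measurable $v:\mathbb{R}\times[0,\infty)\to\mathbb{R}$ form a weak solution pair of the sticky particle system with initial conditions $\rho|_{t=0}=\rho_0$, $v|_{t=0}=v_0$ if: (1) for each $T>0$, $\int_0^T\int_{\mathbb{R}}v^2\,d\rho_t\,dt<\infty$; (2) for each $\phi\in C_c^\infty(\mathbb{R}\times[0,\infty))$, $\int_0^\infty\int_{\mathbb{R}}(\partial_t\phi+v\,\partial_x\phi)\,d\rho_t\,dt+\int_{\mathbb{R}}\phi(\cdot,0)\,d\rho_0=0$; (3) for each $\phi\in C_c^\infty(\mathbb{R}\times[0,\infty))$, $\int_0^\infty\int_{\mathbb{R}}(v\,\partial_t\phi+v^2\,\partial_x\phi)\,d\rho_t\,dt+\int_{\mathbb{R}}\phi(\cdot,0)\,v_0\,d\rho_0=0$.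 In (ii), "for $\rho_t$ almost every $x,y$" means for all $x,y$ in some Borel set of full $\rho_t$ measure. *)

theory Defs
  imports "HOL-Probability.Probability"
begin

text \<open>
  The epsilon-delta notion for functions on the whole real line; the finite families of open
  intervals are indexed by \<open>{..<n}\<close>. The library's \<^const>\<open>absolutely_continuous\<close> is about measures.
\<close>

definition absolutely_continuous_fun :: "(real \<Rightarrow> real) \<Rightarrow> bool" where
  "absolutely_continuous_fun f \<longleftrightarrow>
     (\<forall>\<epsilon>>0. \<exists>\<delta>>0. \<forall>(n::nat) a b.
        (\<forall>i<n. a i < b i) \<longrightarrow>
        disjoint_family_on (\<lambda>i. {a i<..<b i}) {..<n} \<longrightarrow>
        (\<Sum>i<n. b i - a i) < \<delta> \<longrightarrow>
        (\<Sum>i<n. \<bar>f (b i) - f (a i)\<bar>) < \<epsilon>)"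

definition narrow_tendsto :: "('i \<Rightarrow> real measure) \<Rightarrow> real measure \<Rightarrow> 'i filter \<Rightarrow> bool" where
  "narrow_tendsto \<mu> \<nu> F \<longleftrightarrow>
     (\<forall>g :: real \<Rightarrow> real. continuous_on UNIV g \<longrightarrow> bounded (range g) \<longrightarrow>
        ((\<lambda>i. LINT x|\<mu> i. g x) \<longlongrightarrow> (LINT x|\<nu>. g x)) F)"

definition narrowly_continuous_on :: "real set \<Rightarrow> (real \<Rightarrow> real measure) \<Rightarrow> bool" where
  "narrowly_continuous_on S \<rho> \<longleftrightarrow> (\<forall>t\<in>S. narrow_tendsto \<rho> (\<rho> t) (at t within S))"

text \<open>
  Space-time is \<open>\<real> \<times> [0,\<infinity>)\<close>, with points \<open>(x, t)\<close>. All derivatives are taken within this closed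
  half plane, so at \<open>t = 0\<close> they are one-sided in time. The values of a function at
  \<open>t < 0\<close> play no role.
\<close>

definition half_plane :: "(real \<times> real) set" where
  "half_plane = UNIV \<times> {0..}"

text \<open>
  \<^const>\<open>frechet_derivative\<close> picks some derivative within \<open>S\<close>, so this is the usual class \<open>C\<^sup>n\<close> only for
  sets on which derivatives are unique. The half plane is such a set, see
  \<open>frechet_derivative_half_plane\<close> below.
\<close>

fun Ck_on :: "nat \<Rightarrow> (real \<times> real) set \<Rightarrow> (real \<times> real \<Rightarrow> real) \<Rightarrow> bool" where
  "Ck_on 0 S f \<longleftrightarrow> continuous_on S f"
| "Ck_on (Suc n) S f \<longleftrightarrow>
     f differentiable_on S \<and> (\<forall>w. Ck_on n S (\<lambda>p. frechet_derivative f (at p within S) w))"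

definition test_function :: "(real \<times> real \<Rightarrow> real) \<Rightarrow> bool" where
  "test_function \<phi> \<longleftrightarrow>
     (\<forall>n. Ck_on n half_plane \<phi>) \<and> compact (closure {p \<in> half_plane. \<phi> p \<noteq> 0})"

definition partial_x :: "(real \<times> real \<Rightarrow> real) \<Rightarrow> real \<Rightarrow> real \<Rightarrow> real" where
  "partial_x \<phi> x t = frechet_derivative \<phi> (at (x, t) within half_plane) (1, 0)"

definition partial_t :: "(real \<times> real \<Rightarrow> real) \<Rightarrow> real \<Rightarrow> real \<Rightarrow> real" where
  "partial_t \<phi> x t = frechet_derivative \<phi> (at (x, t) within half_plane) (0, 1)"

lemma frechet_derivative_half_plane:
  assumes "p \<in> half_plane" "(\<phi> has_derivative D) (at p within half_plane)"
  shows "frechet_derivative \<phi> (at p within half_plane) = D"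
proof (rule frechet_derivative_unique_within)
  show "(\<phi> has_derivative frechet_derivative \<phi> (at p within half_plane)) (at p within half_plane)"
    using differentiableI[OF assms(2)] by (simp only: frechet_derivative_works)
  show "(\<phi> has_derivative D) (at p within half_plane)" by fact
  fix i :: "real \<times> real" and e :: real
  assume i: "i \<in> Basis" and e: "e > 0"
  have "p + (e / 2) *\<^sub>R i \<in> half_plane"
    using assms(1) i e by (cases p) (auto simp: half_plane_def Basis_prod_def)
  with e show "\<exists>d. 0 < \<bar>d\<bar> \<and> \<bar>d\<bar> < e \<and> p + d *\<^sub>R i \<in> half_plane"
    by (intro exI[of _ "e / 2"]) auto
qed

lemma partial_x_eq:
  assumes "\<phi> differentiable_on half_plane" "0 \<le> t"
  shows "((\<lambda>y. \<phi> (y, t)) has_real_derivative partial_x \<phi> x t) (at x)"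
proof -
  have "(x, t) \<in> half_plane" using assms(2) by (simp add: half_plane_def)
  then have D: "(\<phi> has_derivative frechet_derivative \<phi> (at (x, t) within half_plane))
      (at (x, t) within half_plane)" (is "(_ has_derivative ?D) _")
    using assms(1) by (simp add: differentiable_on_def frechet_derivative_works)
  have "((\<lambda>y. (y, t)) has_derivative (\<lambda>h. (h, 0))) (at x)"
    by (intro has_derivative_Pair has_derivative_ident has_derivative_const)
  moreover have "(\<phi> has_derivative ?D) (at (x, t) within range (\<lambda>y. (y, t)))"
    by (rule has_derivative_subset[OF D]) (use assms(2) in \<open>auto simp: half_plane_def\<close>)
  ultimately have "((\<lambda>y. \<phi> (y, t)) has_derivative (\<lambda>h. ?D (h, 0))) (at x)"
    by (rule has_derivative_in_compose)
  moreover have "(\<lambda>h. ?D (h, 0)) = (*) (?D (1, 0))"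
  proof
    fix h
    show "?D (h, 0) = ?D (1, 0) * h"
      using linear_scale[OF has_derivative_linear[OF D], of h "(1, 0)"]
      by (simp add: mult.commute)
  qed
  ultimately show ?thesis
    unfolding has_field_derivative_def partial_x_def by simp
qed

lemma partial_t_eq:
  assumes "\<phi> differentiable_on half_plane" "0 \<le> t"
  shows "((\<lambda>s. \<phi> (x, s)) has_real_derivative partial_t \<phi> x t) (at t within {0..})"
proof -
  have "(x, t) \<in> half_plane" using assms(2) by (simp add: half_plane_def)
  then have D: "(\<phi> has_derivative frechet_derivative \<phi> (at (x, t) within half_plane))
      (at (x, t) within half_plane)" (is "(_ has_derivative ?D) _")
    using assms(1) by (simp add: differentiable_on_def frechet_derivative_works)
  have "((\<lambda>s. (x, s)) has_derivative (\<lambda>h. (0, h))) (at t within {0..})"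
    by (intro has_derivative_Pair has_derivative_ident has_derivative_const)
  moreover have "(\<phi> has_derivative ?D) (at (x, t) within (\<lambda>s. (x, s)) ` {0..})"
    by (rule has_derivative_subset[OF D]) (auto simp: half_plane_def)
  ultimately have "((\<lambda>s. \<phi> (x, s)) has_derivative (\<lambda>h. ?D (0, h))) (at t within {0..})"
    by (rule has_derivative_in_compose)
  moreover have "(\<lambda>h. ?D (0, h)) = (*) (?D (0, 1))"
  proof
    fix h
    show "?D (0, h) = ?D (0, 1) * h"
      using linear_scale[OF has_derivative_linear[OF D], of h "(0, 1)"]
      by (simp add: mult.commute)
  qed
  ultimately show ?thesis
    unfolding has_field_derivative_def partial_t_def by simp
qed

text \<open>
  The first three conjuncts are the standing conditions on the initial data. By the energy bound,
  which is stated with the nonnegative integral, \<open>v\<close> and \<open>v\<^sup>2\<close> are integrable on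
  \<open>[0,T]\<close> for all \<open>T\<close>; hence the Bochner integrals in the two weak equations are never the
  default value \<open>0\<close> of a non-integrable function, up to a null set of times. The initial
  conditions enter through the weak equations only.
\<close>

definition weak_solution_pair ::
  "real measure \<Rightarrow> (real \<Rightarrow> real) \<Rightarrow> (real \<Rightarrow> real measure) \<Rightarrow> (real \<Rightarrow> real \<Rightarrow> real) \<Rightarrow> bool" where
  "weak_solution_pair \<rho>\<^sub>0 v\<^sub>0 \<rho> v \<longleftrightarrow>
     real_distribution \<rho>\<^sub>0 \<and> continuous_on UNIV v\<^sub>0 \<and> integrable \<rho>\<^sub>0 v\<^sub>0 \<and>
     (\<forall>t\<ge>0. real_distribution (\<rho> t)) \<and>
     narrowly_continuous_on {0..} \<rho> \<and>
     (\<lambda>(x, t). v x t) \<in> borel_measurable (restrict_space borel half_plane) \<and>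
     (\<forall>T>0. (\<integral>\<^sup>+t\<in>{0..T}. (\<integral>\<^sup>+x. ennreal ((v x t)\<^sup>2) \<partial>\<rho> t) \<partial>lborel) < \<infinity>) \<and>
     (\<forall>\<phi>. test_function \<phi> \<longrightarrow>
        (LINT t:{0..}|lborel. (LINT x|\<rho> t. partial_t \<phi> x t + v x t * partial_x \<phi> x t))
          + (LINT x|\<rho>\<^sub>0. \<phi> (x, 0)) = 0) \<and>
     (\<forall>\<phi>. test_function \<phi> \<longrightarrow>
        (LINT t:{0..}|lborel.
            (LINT x|\<rho> t. v x t * partial_t \<phi> x t + (v x t)\<^sup>2 * partial_x \<phi> x t))
          + (LINT x|\<rho>\<^sub>0. \<phi> (x, 0) * v\<^sub>0 x) = 0)"

end

theory Submission
  imports Defs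
begin

text \<open>
  The solution is constructed in mass coordinates. Let \<open>X0\<close> be the quantile function of the initial
  distribution on the unit interval with Lebesgue measure, \<open>W\<close> the initial velocity composed with
  \<open>X0\<close>, and \<open>K\<close> the closed convex cone of nondecreasing square integrable functions. Free particles
  would be at \<open>X0 + t W\<close>; the sticky particles are at \<open>X t\<close>, the projection of \<open>X0 + t W\<close> onto \<open>K\<close>.
  Projections do not expand distances, so \<open>X\<close> is Lipschitz in time with values in \<open>L\<^sup>2\<close>, and the law
  of \<open>X t\<close> is narrowly continuous.

  Three facts carry the proof. First, \<open>X0 + t W - X t\<close> is orthogonal to all functions of \<open>X t\<close>
  (\<open>R_orthogonal\<close>): the centre of mass of each cluster moves freely. Second, \<open>X t\<close> is a function of
  \<open>X s\<close> for \<open>0 < s \<le> t\<close> (\<open>sticky\<close>). Third, the mean of \<open>X0\<close> over the cluster of a particle is a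
  nondecreasing function (\<open>favg_K\<close>), because clusters are ordered intervals.

  Define \<open>V t\<close> by \<open>X t = mean of X0 over the cluster + t V t\<close>. By the first fact it is the
  conditional expectation of \<open>W\<close> given \<open>X t\<close>, so it has the form \<open>v (X t) t\<close>. The second fact makes
  these conditional expectations decrease along a family of shrinking \<open>\<sigma>\<close>-algebras, so the energy
  decreases. The third fact says that \<open>X t / t - V t\<close> is nondecreasing in \<open>X t\<close>, which is the one-sided
  Lipschitz estimate.

  For the weak equations, \<open>X t - X s - (t - s) V t\<close> turns out to be orthogonal to functions of \<open>X t\<close>,
  and to be a function of \<open>X s\<close>. This gives the left derivative of \<open>\<integral> \<phi> (X t, t)\<close> at every time, and that
  of \<open>\<integral> W \<phi> (X t, t)\<close> at every time at which the energy is continuous, which excludes only countably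
  many. Both integrals are Lipschitz in time, so these derivatives integrate to the weak equations
  (\<open>integral_left_derivative\<close>).
\<close>

section \<open>Square integrable functions\<close>

text \<open>
  The elements are functions and not classes modulo null sets, because the cone below requires
  monotonicity at every point.
\<close>

definition L2 :: "'a measure \<Rightarrow> ('a \<Rightarrow> real) set" where
  "L2 M = {f \<in> borel_measurable M. integrable M (\<lambda>x. (f x)\<^sup>2)}"

definition ip :: "'a measure \<Rightarrow> ('a \<Rightarrow> real) \<Rightarrow> ('a \<Rightarrow> real) \<Rightarrow> real" where
  "ip M f g = (LINT x|M. f x * g x)"

definition nrm :: "'a measure \<Rightarrow> ('a \<Rightarrow> real) \<Rightarrow> real" where
  "nrm M f = sqrt (ip M f f)"

lemma L2_measurable: "f \<in> L2 M \<Longrightarrow> f \<in> borel_measurable M"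
  by (simp add: L2_def)

lemma L2_mult_integrable:
  assumes "f \<in> L2 M" "g \<in> L2 M"
  shows "integrable M (\<lambda>x. f x * g x)"
proof (rule Bochner_Integration.integrable_bound)
  show "integrable M (\<lambda>x. (f x)\<^sup>2 + (g x)\<^sup>2)"
    using assms by (auto simp: L2_def)
  show "(\<lambda>x. f x * g x) \<in> borel_measurable M"
    using assms by (auto simp: L2_def)
  have "\<bar>f x * g x\<bar> \<le> (f x)\<^sup>2 + (g x)\<^sup>2" for x
  proof -
    have "0 \<le> (\<bar>f x\<bar> - \<bar>g x\<bar>)\<^sup>2" by simp
    then have "2 * (\<bar>f x\<bar> * \<bar>g x\<bar>) \<le> (f x)\<^sup>2 + (g x)\<^sup>2"
      by (simp add: power2_eq_square algebra_simps)
    moreover have "0 \<le> \<bar>f x\<bar> * \<bar>g x\<bar>" by simp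
    ultimately show ?thesis unfolding abs_mult by linarith
  qed
  then show "AE x in M. norm (f x * g x) \<le> norm ((f x)\<^sup>2 + (g x)\<^sup>2)"
    by auto
qed

lemma L2_add: "f \<in> L2 M \<Longrightarrow> g \<in> L2 M \<Longrightarrow> (\<lambda>x. f x + g x) \<in> L2 M"
  using integrable_mult_left[OF L2_mult_integrable[of f M g], of 2]
  by (auto simp: L2_def power2_sum algebra_simps)

lemma L2_mult_bounded:
  assumes f: "f \<in> L2 M" and h: "h \<in> borel_measurable M" "\<And>x. x \<in> space M \<Longrightarrow> \<bar>h x\<bar> \<le> C"
  shows "(\<lambda>x. h x * f x) \<in> L2 M"
proof -
  have m[measurable]: "f \<in> borel_measurable M" "h \<in> borel_measurable M"
    using f h by (auto simp: L2_def)
  have "integrable M (\<lambda>x. (h x * f x)\<^sup>2)"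
  proof (rule Bochner_Integration.integrable_bound)
    show "integrable M (\<lambda>x. C\<^sup>2 * (f x)\<^sup>2)" using f by (auto simp: L2_def)
    show "AE x in M. norm ((h x * f x)\<^sup>2) \<le> norm (C\<^sup>2 * (f x)\<^sup>2)"
    proof (rule AE_I2)
      fix x assume "x \<in> space M"
      then have "(h x)\<^sup>2 \<le> C\<^sup>2" using h(2)[of x] by (metis abs_ge_zero power_mono power2_abs)
      then show "norm ((h x * f x)\<^sup>2) \<le> norm (C\<^sup>2 * (f x)\<^sup>2)"
        by (auto simp: power_mult_distrib intro!: mult_right_mono)
    qed
  qed simp
  then show ?thesis by (simp add: L2_def)
qed

lemma L2_cmult: "f \<in> L2 M \<Longrightarrow> (\<lambda>x. c * f x) \<in> L2 M"
  by (rule L2_mult_bounded[where C = "\<bar>c\<bar>"]) auto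

lemma L2_diff: "f \<in> L2 M \<Longrightarrow> g \<in> L2 M \<Longrightarrow> (\<lambda>x. f x - g x) \<in> L2 M"
  using L2_add[of f M "\<lambda>x. -1 * g x"] L2_cmult[of g M "-1"] by simp

lemma L2_divide: "f \<in> L2 M \<Longrightarrow> (\<lambda>x. f x / c) \<in> L2 M"
  using L2_cmult[of f M "1 / c"] by simp

lemma (in prob_space) L2_const: "(\<lambda>x. c) \<in> L2 M"
  by (auto simp: L2_def)

lemma (in prob_space) L2_bounded:
  "h \<in> borel_measurable M \<Longrightarrow> (\<And>x. x \<in> space M \<Longrightarrow> \<bar>h x\<bar> \<le> C) \<Longrightarrow> h \<in> L2 M"
  using L2_mult_bounded[OF L2_const[of 1], of h C] by simp

lemma (in prob_space) L2_integrable: "f \<in> L2 M \<Longrightarrow> integrable M f"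
  using L2_mult_integrable[OF _ L2_const[of 1], of f] by simp

lemma L2_abs: "f \<in> L2 M \<Longrightarrow> (\<lambda>x. \<bar>f x\<bar>) \<in> L2 M"
  by (auto simp: L2_def)

lemmas L2_intros = L2_add L2_diff L2_cmult L2_divide L2_abs

lemma ip_commute: "ip M f g = ip M g f"
  by (simp add: ip_def mult.commute)

lemma ip_add_left:
  "f \<in> L2 M \<Longrightarrow> g \<in> L2 M \<Longrightarrow> h \<in> L2 M \<Longrightarrow> ip M (\<lambda>x. f x + g x) h = ip M f h + ip M g h"
  by (simp add: ip_def distrib_right L2_mult_integrable)

lemma ip_diff_left:
  "f \<in> L2 M \<Longrightarrow> g \<in> L2 M \<Longrightarrow> h \<in> L2 M \<Longrightarrow> ip M (\<lambda>x. f x - g x) h = ip M f h - ip M g h"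
  by (simp add: ip_def left_diff_distrib L2_mult_integrable)

lemma ip_cmult_left: "ip M (\<lambda>x. c * f x) h = c * ip M f h"
  by (simp add: ip_def mult.assoc)

lemma ip_add_right:
  "f \<in> L2 M \<Longrightarrow> g \<in> L2 M \<Longrightarrow> h \<in> L2 M \<Longrightarrow> ip M h (\<lambda>x. f x + g x) = ip M h f + ip M h g"
  by (simp add: ip_add_left ip_commute[of M h])

lemma ip_diff_right:
  "f \<in> L2 M \<Longrightarrow> g \<in> L2 M \<Longrightarrow> h \<in> L2 M \<Longrightarrow> ip M h (\<lambda>x. f x - g x) = ip M h f - ip M h g"
  by (simp add: ip_diff_left ip_commute[of M h])

lemma ip_cmult_right: "ip M h (\<lambda>x. c * f x) = c * ip M h f"
  by (simp add: ip_cmult_left ip_commute[of M h])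

lemmas ip_linear = ip_add_left ip_diff_left ip_cmult_left ip_add_right ip_diff_right ip_cmult_right

lemma ip_self_nonneg: "0 \<le> ip M f f"
  by (simp add: ip_def)

lemma nrm_nonneg: "0 \<le> nrm M f"
  by (simp add: nrm_def ip_self_nonneg)

lemma nrm_sq: "(nrm M f)\<^sup>2 = ip M f f"
  by (simp add: nrm_def ip_self_nonneg)

lemma nrm_cmult: "nrm M (\<lambda>x. c * f x) = \<bar>c\<bar> * nrm M f"
  by (simp add: nrm_def ip_linear real_sqrt_mult flip: mult.assoc)

lemma nrm_minus_commute: "nrm M (\<lambda>x. f x - g x) = nrm M (\<lambda>x. g x - f x)"
  using nrm_cmult[of M "-1" "\<lambda>x. f x - g x"] by simp

lemma ip_cong_AE:
  assumes "AE x in M. f x * g x = f' x * g' x"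
    "f \<in> borel_measurable M" "g \<in> borel_measurable M" "f' \<in> borel_measurable M" "g' \<in> borel_measurable M"
  shows "ip M f g = ip M f' g'"
  unfolding ip_def using assms by (intro integral_cong_AE) auto

lemma nrm_add_sq:
  assumes "f \<in> L2 M" "g \<in> L2 M"
  shows "(nrm M (\<lambda>x. f x + g x))\<^sup>2 = (nrm M f)\<^sup>2 + 2 * ip M f g + (nrm M g)\<^sup>2"
  using assms by (simp add: nrm_sq ip_linear L2_intros ip_commute[of M g f])

lemma nrm_diff_sq:
  assumes "f \<in> L2 M" "g \<in> L2 M"
  shows "(nrm M (\<lambda>x. f x - g x))\<^sup>2 = (nrm M f)\<^sup>2 - 2 * ip M f g + (nrm M g)\<^sup>2"
  using assms by (simp add: nrm_sq ip_linear L2_intros ip_commute[of M g f])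

lemma ip_Cauchy_Schwarz:
  assumes f: "f \<in> L2 M" and g: "g \<in> L2 M"
  shows "\<bar>ip M f g\<bar> \<le> nrm M f * nrm M g"
proof -
  have q: "0 \<le> ip M f f * a\<^sup>2 - 2 * ip M f g * a + ip M g g" for a
    using ip_self_nonneg[of M "\<lambda>x. a * f x - g x"] f g
    by (simp add: ip_linear L2_intros ip_commute[of M g f] power2_eq_square algebra_simps)
  have "(ip M f g)\<^sup>2 \<le> ip M f f * ip M g g"
  proof (cases "ip M f f = 0")
    case True
    have "ip M f g = 0"
    proof (rule ccontr)
      assume "ip M f g \<noteq> 0"
      then show False using q[of "(ip M g g + 1) / (2 * ip M f g)"] True
        by (simp add: field_simps)
    qed
    then show ?thesis by (simp add: True)
  next
    case False
    then have p: "ip M f f > 0" using ip_self_nonneg[of M f] by linarith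
    have "0 \<le> ip M f f * (ip M f f * (ip M f g / ip M f f)\<^sup>2 - 2 * ip M f g * (ip M f g / ip M f f) + ip M g g)"
      using q[of "ip M f g / ip M f f"] p by (intro mult_nonneg_nonneg) auto
    also have "\<dots> = ip M f f * ip M g g - (ip M f g)\<^sup>2"
      using p by (simp add: field_simps power2_eq_square)
    finally show ?thesis by simp
  qed
  then have "sqrt ((ip M f g)\<^sup>2) \<le> sqrt (ip M f f * ip M g g)"
    by (rule real_sqrt_le_mono)
  then show ?thesis by (simp add: nrm_def real_sqrt_mult)
qed

lemma nrm_triangle:
  assumes f: "f \<in> L2 M" and g: "g \<in> L2 M"
  shows "nrm M (\<lambda>x. f x + g x) \<le> nrm M f + nrm M g"
proof (rule power2_le_imp_le)
  show "(nrm M (\<lambda>x. f x + g x))\<^sup>2 \<le> (nrm M f + nrm M g)\<^sup>2"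
    using ip_Cauchy_Schwarz[OF f g] by (simp add: nrm_add_sq f g power2_sum algebra_simps)
qed (simp add: nrm_nonneg)

lemma nrm_triangle_diff:
  assumes f: "f \<in> L2 M" and g: "g \<in> L2 M"
  shows "nrm M (\<lambda>x. f x - g x) \<le> nrm M f + nrm M g"
  using nrm_triangle[OF f L2_cmult[OF g, of "-1"]] nrm_cmult[of M "-1" g] by simp

lemma nrm_mono:
  assumes "g \<in> L2 M" "f \<in> borel_measurable M" "\<And>x. x \<in> space M \<Longrightarrow> \<bar>f x\<bar> \<le> \<bar>g x\<bar>"
  shows "f \<in> L2 M" "nrm M f \<le> nrm M g"
proof -
  have le: "(f x)\<^sup>2 \<le> (g x)\<^sup>2" if "x \<in> space M" for x
    using assms(3)[OF that] by (metis abs_ge_zero power_mono power2_abs)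
  have gi: "integrable M (\<lambda>x. (g x)\<^sup>2)" using assms by (simp add: L2_def)
  have fi: "integrable M (\<lambda>x. (f x)\<^sup>2)"
    by (rule Bochner_Integration.integrable_bound[OF gi]) (use le assms in \<open>auto intro!: AE_I2\<close>)
  then show "f \<in> L2 M" using assms by (simp add: L2_def)
  have "ip M f f \<le> ip M g g"
    unfolding ip_def using fi gi le by (intro integral_mono) (auto simp: power2_eq_square)
  then show "nrm M f \<le> nrm M g" by (simp add: nrm_def)
qed

lemma nrm_zero_AE:
  assumes "f \<in> L2 M" "nrm M f = 0"
  shows "AE x in M. f x = 0"
proof -
  have "(LINT x|M. (f x)\<^sup>2) = 0" using assms by (simp add: nrm_def ip_def power2_eq_square)
  then have "AE x in M. (f x)\<^sup>2 = 0"
    using assms by (subst integral_nonneg_eq_0_iff_AE[symmetric]) (auto simp: L2_def)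
  then show ?thesis by simp
qed

lemma (in prob_space) integral_le_nrm:
  assumes "f \<in> L2 M"
  shows "(LINT x|M. \<bar>f x\<bar>) \<le> nrm M f"
proof -
  have "nrm M (\<lambda>x. 1 :: real) = 1" by (simp add: nrm_def ip_def prob_space)
  moreover have "nrm M (\<lambda>x. \<bar>f x\<bar>) = nrm M f" by (simp add: nrm_def ip_def flip: abs_mult)
  ultimately show ?thesis
    using ip_Cauchy_Schwarz[OF L2_abs[OF assms] L2_const[of 1]] by (simp add: ip_def)
qed

lemma nn_integral_eq_nrm:
  assumes "f \<in> L2 M" "c \<ge> 0"
  shows "(\<integral>\<^sup>+x. ennreal (c * (f x)\<^sup>2) \<partial>M) = ennreal (c * (nrm M f)\<^sup>2)"
proof -
  have "(\<integral>\<^sup>+x. ennreal (c * (f x)\<^sup>2) \<partial>M) = ennreal (LINT x|M. c * (f x)\<^sup>2)"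
    using assms by (intro nn_integral_eq_integral) (auto simp: L2_def)
  then show ?thesis unfolding nrm_sq ip_def by (simp add: power2_eq_square)
qed

text \<open>
  Absolute continuity of the integral in the form of a modulus: an integrable weight turns smallness
  in \<open>L\<^sup>1\<close> of a bounded factor into smallness of the weighted integral.
\<close>

lemma integrable_weight_small:
  fixes Y :: "'a \<Rightarrow> real"
  assumes Y: "integrable M Y" and e: "e > 0" and C: "C \<ge> 0"
  shows "\<exists>d>0. \<forall>\<psi>. integrable M \<psi> \<longrightarrow> (\<forall>x\<in>space M. \<bar>\<psi> x\<bar> \<le> C) \<longrightarrow> (LINT x|M. \<bar>\<psi> x\<bar>) < d
           \<longrightarrow> (LINT x|M. \<bar>Y x\<bar> * \<bar>\<psi> x\<bar>) < e"
proof -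
  have [measurable]: "Y \<in> borel_measurable M" using Y by auto
  let ?T = "\<lambda>k::nat. \<lambda>x. \<bar>Y x\<bar> - min \<bar>Y x\<bar> (real k)"
  have "(\<lambda>k. LINT x|M. ?T k x) \<longlonglongrightarrow> (LINT x|M. 0)"
  proof (rule integral_dominated_convergence[where w = "\<lambda>x. \<bar>Y x\<bar>"])
    show "AE x in M. (\<lambda>k. ?T k x) \<longlonglongrightarrow> 0"
    proof (rule AE_I2, rule tendsto_eventually)
      fix x
      obtain n where n: "\<bar>Y x\<bar> \<le> real n" using real_arch_simple by blast
      show "\<forall>\<^sub>F k in sequentially. ?T k x = 0"
        using eventually_ge_at_top[of n] by eventually_elim (use n in auto)
    qed
  qed (use Y in auto)
  then have "\<forall>\<^sub>F k in sequentially. (LINT x|M. ?T k x) < e / (2 * (C + 1))"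
    using e C by (intro order_tendstoD(2)) auto
  then obtain k where k: "(LINT x|M. ?T k x) < e / (2 * (C + 1))"
    by (auto simp: eventually_sequentially)
  have Ti: "integrable M (?T k)"
    by (rule Bochner_Integration.integrable_bound[OF integrable_abs[OF Y]]) (auto intro!: AE_I2)
  show ?thesis
  proof (intro exI[of _ "e / (2 * (real k + 1))"] conjI allI impI)
    show "0 < e / (2 * (real k + 1))" using e by simp
    fix \<psi> :: "'a \<Rightarrow> real"
    assume \<psi>: "integrable M \<psi>" "\<forall>x\<in>space M. \<bar>\<psi> x\<bar> \<le> C" "(LINT x|M. \<bar>\<psi> x\<bar>) < e / (2 * (real k + 1))"
    have [measurable]: "\<psi> \<in> borel_measurable M" using \<psi> by auto
    have le: "\<bar>Y x\<bar> * \<bar>\<psi> x\<bar> \<le> C * ?T k x + real k * \<bar>\<psi> x\<bar>" if "x \<in> space M" for x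
    proof -
      have "\<bar>Y x\<bar> * \<bar>\<psi> x\<bar> = ?T k x * \<bar>\<psi> x\<bar> + min \<bar>Y x\<bar> (real k) * \<bar>\<psi> x\<bar>"
        by (simp add: algebra_simps)
      also have "?T k x * \<bar>\<psi> x\<bar> \<le> ?T k x * C" using \<psi>(2) that by (intro mult_left_mono) auto
      also have "min \<bar>Y x\<bar> (real k) * \<bar>\<psi> x\<bar> \<le> real k * \<bar>\<psi> x\<bar>" by (intro mult_right_mono) auto
      finally show ?thesis by (simp add: mult.commute)
    qed
    have ri: "integrable M (\<lambda>x. C * ?T k x + real k * \<bar>\<psi> x\<bar>)" using Ti \<psi> by auto
    have "(LINT x|M. \<bar>Y x\<bar> * \<bar>\<psi> x\<bar>) \<le> (LINT x|M. C * ?T k x + real k * \<bar>\<psi> x\<bar>)"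
      by (rule integral_mono[OF Bochner_Integration.integrable_bound[OF ri] ri])
        (use le in \<open>auto intro!: AE_I2 simp: abs_mult intro: order_trans[OF _ abs_ge_self]\<close>)
    also have "\<dots> = C * (LINT x|M. ?T k x) + real k * (LINT x|M. \<bar>\<psi> x\<bar>)"
      using Ti \<psi> by (subst Bochner_Integration.integral_add) auto
    also have "C * (LINT x|M. ?T k x) \<le> C * (e / (2 * (C + 1)))" using k C by (intro mult_left_mono) auto
    also have "C * (e / (2 * (C + 1))) < e / 2" using C e by (simp add: field_simps)
    also have "real k * (LINT x|M. \<bar>\<psi> x\<bar>) \<le> real k * (e / (2 * (real k + 1)))"
      using \<psi> by (intro mult_left_mono) auto
    also have "real k * (e / (2 * (real k + 1))) \<le> e / 2" using e by (simp add: field_simps)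
    finally show "(LINT x|M. \<bar>Y x\<bar> * \<bar>\<psi> x\<bar>) < e" by simp
  qed
qed

text \<open>
  The two halves of the Riesz--Fischer argument: the increments of a geometrically Cauchy sequence
  have an a.e. finite absolute sum, and Fatou's lemma identifies the pointwise limit as the
  limit in norm.
\<close>

lemma (in prob_space) L2_geometric_Cauchy_AE_convergent:
  assumes g: "\<And>n. g n \<in> L2 M" and c: "\<And>n. nrm M (\<lambda>x. g (Suc n) x - g n x) \<le> (1 / 2) ^ n"
  shows "AE x in M. convergent (\<lambda>n. g n x)"
proof -
  have [measurable]: "\<And>n. g n \<in> borel_measurable M" using g by (auto simp: L2_def)
  have d: "(\<lambda>x. g (Suc n) x - g n x) \<in> L2 M" for n by (intro L2_diff g)
  have "(\<integral>\<^sup>+x. (\<Sum>n. ennreal \<bar>g (Suc n) x - g n x\<bar>) \<partial>M) = (\<Sum>n. \<integral>\<^sup>+x. ennreal \<bar>g (Suc n) x - g n x\<bar> \<partial>M)"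
    by (intro nn_integral_suminf) auto
  also have "\<dots> \<le> (\<Sum>n. ennreal ((1 / 2) ^ n))"
  proof (intro suminf_le summableI allI)
    fix n
    have "(\<integral>\<^sup>+x. ennreal \<bar>g (Suc n) x - g n x\<bar> \<partial>M) = ennreal (LINT x|M. \<bar>g (Suc n) x - g n x\<bar>)"
      using L2_integrable[OF d[of n]] by (intro nn_integral_eq_integral) auto
    also have "\<dots> \<le> ennreal ((1 / 2) ^ n)"
      using integral_le_nrm[OF d[of n]] c[of n] by (intro ennreal_leI) linarith
    finally show "(\<integral>\<^sup>+x. ennreal \<bar>g (Suc n) x - g n x\<bar> \<partial>M) \<le> ennreal ((1 / 2) ^ n)" .
  qed
  also have "\<dots> = ennreal (\<Sum>n. (1 / 2) ^ n)"
    by (rule suminf_ennreal2) (auto intro!: summable_geometric)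
  also have "\<dots> < \<infinity>" by simp
  finally have "AE x in M. (\<Sum>n. ennreal \<bar>g (Suc n) x - g n x\<bar>) \<noteq> \<infinity>"
    by (intro nn_integral_PInf_AE) auto
  then show ?thesis
  proof eventually_elim
    case (elim x)
    have "summable (\<lambda>n. \<bar>g (Suc n) x - g n x\<bar>)"
      using elim by (intro summable_suminf_not_top) auto
    then have "summable (\<lambda>n. g (Suc n) x - g n x)"
      by (rule summable_rabs_cancel)
    then have "convergent (\<lambda>n. \<Sum>i<n. g (Suc i) x - g i x)"
      by (simp add: summable_iff_convergent)
    then have "convergent (\<lambda>n. g n x - g 0 x)"
      unfolding sum_lessThan_telescope[of "\<lambda>i. g i x"] .
    then show ?case
      using convergent_add[OF _ convergent_const[of "g 0 x"]] by fastforce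
  qed
qed

lemma L2_limit:
  assumes g: "\<And>n. g n \<in> L2 M" and f: "f \<in> borel_measurable M"
    and lim: "AE x in M. (\<lambda>n. g n x) \<longlonglongrightarrow> f x"
    and c: "\<And>n m. n \<le> m \<Longrightarrow> nrm M (\<lambda>x. g n x - g m x) \<le> c n"
  shows "f \<in> L2 M" "\<And>n. nrm M (\<lambda>x. g n x - f x) \<le> c n"
proof -
  have [measurable]: "\<And>n. g n \<in> borel_measurable M" "f \<in> borel_measurable M"
    using g f by (auto simp: L2_def)
  have cn: "0 \<le> c n" for n using c[of n n] nrm_nonneg[of M] order_trans by blast
  have fat: "(\<integral>\<^sup>+x. ennreal ((g n x - f x)\<^sup>2) \<partial>M) \<le> ennreal ((c n)\<^sup>2)" for n
  proof -
    have "(\<integral>\<^sup>+x. ennreal ((g n x - f x)\<^sup>2) \<partial>M)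
        = (\<integral>\<^sup>+x. liminf (\<lambda>m. ennreal ((g n x - g m x)\<^sup>2)) \<partial>M)"
    proof (rule nn_integral_cong_AE, use lim in eventually_elim)
      case (elim x)
      have "(\<lambda>m. ennreal ((g n x - g m x)\<^sup>2)) \<longlonglongrightarrow> ennreal ((g n x - f x)\<^sup>2)"
        by (intro tendsto_intros elim)
      then show ?case by (metis lim_imp_Liminf sequentially_bot)
    qed
    also have "\<dots> \<le> liminf (\<lambda>m. \<integral>\<^sup>+x. ennreal ((g n x - g m x)\<^sup>2) \<partial>M)"
      by (intro nn_integral_liminf) auto
    also have "\<dots> \<le> ennreal ((c n)\<^sup>2)"
    proof (rule Liminf_le)
      show "\<forall>\<^sub>F m in sequentially. (\<integral>\<^sup>+x. ennreal ((g n x - g m x)\<^sup>2) \<partial>M) \<le> ennreal ((c n)\<^sup>2)"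
        using eventually_ge_at_top[of n]
      proof eventually_elim
        case (elim m)
        have "(\<integral>\<^sup>+x. ennreal ((g n x - g m x)\<^sup>2) \<partial>M) = ennreal ((nrm M (\<lambda>x. g n x - g m x))\<^sup>2)"
          using nn_integral_eq_nrm[of "\<lambda>x. g n x - g m x" M 1] g by (simp add: L2_diff)
        also have "\<dots> \<le> ennreal ((c n)\<^sup>2)"
          using c[OF elim] by (intro ennreal_leI power_mono nrm_nonneg)
        finally show ?case .
      qed
    qed simp
    finally show ?thesis .
  qed
  have dL: "(\<lambda>x. g n x - f x) \<in> L2 M" for n
  proof -
    have "integrable M (\<lambda>x. (g n x - f x)\<^sup>2)"
      using fat[of n] by (intro integrableI_bounded) (auto simp: top_unique less_top intro: le_less_trans)
    then show ?thesis by (simp add: L2_def)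
  qed
  from L2_diff[OF g[of 0] dL[of 0]] show "f \<in> L2 M" by simp
  fix n
  have "ennreal ((nrm M (\<lambda>x. g n x - f x))\<^sup>2) \<le> ennreal ((c n)\<^sup>2)"
    using fat[of n] nn_integral_eq_nrm[OF dL[of n], of 1] by simp
  then have "(nrm M (\<lambda>x. g n x - f x))\<^sup>2 \<le> (c n)\<^sup>2" by simp
  then show "nrm M (\<lambda>x. g n x - f x) \<le> c n" using cn power2_le_imp_le by blast
qed

section \<open>Projection onto a closed convex cone\<close>

text \<open>
  The existence half of the projection theorem: by the parallelogram law, a sequence whose distances
  to \<open>f\<close> approach the infimum at a geometric rate is geometrically Cauchy. The two conclusions
  are the first order conditions for the minimiser in the directions \<open>g\<close>, \<open>p\<close> and \<open>- p\<close>.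
\<close>

lemma cone_projection_exists:
  assumes KL: "K \<subseteq> L2 M" and ne: "K \<noteq> {}"
    and add: "\<And>f g. f \<in> K \<Longrightarrow> g \<in> K \<Longrightarrow> (\<lambda>x. f x + g x) \<in> K"
    and scale: "\<And>c f. 0 \<le> c \<Longrightarrow> f \<in> K \<Longrightarrow> (\<lambda>x. c * f x) \<in> K"
    and closed: "\<And>g. (\<And>n. g n \<in> K) \<Longrightarrow> (\<And>n m. n \<le> m \<Longrightarrow> nrm M (\<lambda>x. g n x - g m x) \<le> (1 / 2) ^ n)
        \<Longrightarrow> \<exists>p\<in>K. \<forall>n. nrm M (\<lambda>x. g n x - p x) \<le> (1 / 2) ^ n"
    and f: "f \<in> L2 M"
  shows "\<exists>p\<in>K. (\<forall>g\<in>K. ip M (\<lambda>x. f x - p x) g \<le> 0) \<and> ip M (\<lambda>x. f x - p x) p = 0"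
proof -
  define D where "D g = (nrm M (\<lambda>x. f x - g x))\<^sup>2" for g
  define d where "d = Inf (D ` K)"
  have L: "g \<in> L2 M" if "g \<in> K" for g using KL that by auto
  have bb: "bdd_below (D ` K)" by (rule bdd_belowI[of _ 0]) (auto simp: D_def)
  have dle: "d \<le> D g" if "g \<in> K" for g unfolding d_def using that bb by (intro cInf_lower) auto
  have "\<exists>g\<in>K. D g < d + (1 / 4) ^ n / 4" for n
  proof -
    have "\<exists>y\<in>D ` K. y < d + (1 / 4) ^ n / 4"
      by (rule cInf_lessD) (use ne in \<open>auto simp: d_def\<close>)
    then show ?thesis by auto
  qed
  then obtain g where g: "\<And>n. g n \<in> K" "\<And>n. D (g n) < d + (1 / 4) ^ n / 4" by metis
  have c: "nrm M (\<lambda>x. g n x - g m x) \<le> (1 / 2) ^ n" if nm: "n \<le> m" for n m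
  proof -
    define a where "a x = f x - g n x" for x
    define b where "b x = f x - g m x" for x
    have ab: "a \<in> L2 M" "b \<in> L2 M" using f L[OF g(1)] by (auto simp: a_def[abs_def] b_def[abs_def] L2_diff)
    define h where "h x = (1 / 2) * (g n x + g m x)" for x
    have "h \<in> K" unfolding h_def[abs_def] by (intro scale add g) auto
    then have dh: "d \<le> D h" by (rule dle)
    have fh: "(\<lambda>x. f x - h x) = (\<lambda>x. (1 / 2) * (a x + b x))"
      by (simp add: fun_eq_iff a_def b_def h_def field_simps)
    have "D h = (1 / 4) * (nrm M (\<lambda>x. a x + b x))\<^sup>2"
      unfolding D_def fh nrm_cmult by (simp add: power2_eq_square)
    moreover have "(nrm M (\<lambda>x. a x + b x))\<^sup>2 = D (g n) + 2 * ip M a b + D (g m)"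
      using nrm_add_sq[OF ab] by (simp add: D_def a_def[abs_def] b_def[abs_def])
    moreover have "(nrm M (\<lambda>x. g n x - g m x))\<^sup>2 = D (g n) - 2 * ip M a b + D (g m)"
    proof -
      have "(nrm M (\<lambda>x. g n x - g m x))\<^sup>2 = (nrm M (\<lambda>x. a x - b x))\<^sup>2"
        using nrm_minus_commute[of M "g n" "g m"] by (simp add: a_def b_def)
      then show ?thesis using nrm_diff_sq[OF ab] by (simp add: D_def a_def[abs_def] b_def[abs_def])
    qed
    ultimately have "(nrm M (\<lambda>x. g n x - g m x))\<^sup>2 \<le> 2 * (D (g n) - d) + 2 * (D (g m) - d)"
      using dh by simp
    also have "\<dots> \<le> 2 * ((1 / 4) ^ n / 4) + 2 * ((1 / 4) ^ m / 4)"
      using g(2)[of n] g(2)[of m] by simp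
    also have "(1 / 4 :: real) ^ m \<le> (1 / 4) ^ n" using nm by (intro power_decreasing) auto
    finally have "(nrm M (\<lambda>x. g n x - g m x))\<^sup>2 \<le> (1 / 4) ^ n" by simp
    also have "(1 / 4 :: real) ^ n = ((1 / 2) ^ n)\<^sup>2"
      by (simp add: power2_eq_square flip: power_mult_distrib)
    finally show ?thesis by (rule power2_le_imp_le) simp
  qed
  obtain p where p: "p \<in> K" "\<And>n. nrm M (\<lambda>x. g n x - p x) \<le> (1 / 2) ^ n"
    using closed[OF g(1) c] by blast
  have Dp: "D p \<le> D g'" if "g' \<in> K" for g'
  proof -
    have "nrm M (\<lambda>x. f x - p x) \<le> sqrt (d + (1 / 4) ^ n / 4) + (1 / 2) ^ n" for n
    proof -
      have "nrm M (\<lambda>x. f x - p x) = nrm M (\<lambda>x. (f x - g n x) + (g n x - p x))" by simp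
      also have "\<dots> \<le> nrm M (\<lambda>x. f x - g n x) + nrm M (\<lambda>x. g n x - p x)"
        by (intro nrm_triangle L2_diff f L g p)
      also have "nrm M (\<lambda>x. f x - g n x) \<le> sqrt (d + (1 / 4) ^ n / 4)"
        using g(2)[of n] by (intro real_le_rsqrt) (simp add: D_def)
      finally show ?thesis using p(2)[of n] by simp
    qed
    moreover have "(\<lambda>n. sqrt (d + (1 / 4) ^ n / 4) + (1 / 2) ^ n) \<longlonglongrightarrow> sqrt (d + 0 / 4) + 0"
      by (intro tendsto_intros) auto
    ultimately have "nrm M (\<lambda>x. f x - p x) \<le> sqrt d"
      by (intro tendsto_lowerbound[of _ _ sequentially]) auto
    then have "D p \<le> (sqrt d)\<^sup>2" unfolding D_def by (intro power_mono nrm_nonneg)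
    also have "(sqrt d)\<^sup>2 = d"
      unfolding d_def using ne by (simp, intro cInf_greatest) (auto simp: D_def)
    finally show ?thesis using dle[OF that] by simp
  qed
  define r where "r x = f x - p x" for x
  have rL: "r \<in> L2 M" unfolding r_def[abs_def] by (intro L2_diff f L p)
  have key: "ip M r h \<le> e / 2 * (nrm M h)\<^sup>2"
    if "e > 0" "(\<lambda>x. p x + e * h x) \<in> K" "h \<in> L2 M" for e h
  proof -
    have "D p \<le> D (\<lambda>x. p x + e * h x)" by (rule Dp) fact
    also have "D (\<lambda>x. p x + e * h x) = (nrm M (\<lambda>x. r x - e * h x))\<^sup>2"
      by (simp add: D_def r_def algebra_simps)
    also have "\<dots> = D p - 2 * e * ip M r h + e\<^sup>2 * (nrm M h)\<^sup>2"
      using that rL by (subst nrm_diff_sq)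
        (auto simp: L2_cmult ip_linear nrm_cmult power_mult_distrib D_def r_def[abs_def])
    finally have "e * ip M r h \<le> e * (e / 2 * (nrm M h)\<^sup>2)" by (simp add: power2_eq_square)
    then show ?thesis using that by simp
  qed
  have sm: "y \<le> 0" if "\<And>e. 0 < e \<Longrightarrow> e \<le> 1 \<Longrightarrow> y \<le> e / 2 * c" for y c :: real
  proof (rule tendsto_lowerbound[of "\<lambda>e. e / 2 * c" _ "at_right 0"])
    have "((\<lambda>e. e / 2 * c) \<longlongrightarrow> 0 / 2 * c) (at_right 0)" by (intro tendsto_intros) auto
    then show "((\<lambda>e. e / 2 * c) \<longlongrightarrow> 0) (at_right 0)" by simp
    have "\<forall>\<^sub>F e in at_right (0::real). e < 1"
      by (rule eventually_at_rightI[of 0 1]) auto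
    then show "\<forall>\<^sub>F e in at_right 0. y \<le> e / 2 * c"
      using eventually_at_right_less[of 0] by eventually_elim (use that in auto)
  qed simp
  have 1: "ip M r g \<le> 0" if "g \<in> K" for g
    by (rule sm, rule key) (use that in \<open>auto intro!: add scale p L\<close>)
  have "- ip M r p \<le> 0"
  proof (rule sm[of _ "(nrm M p)\<^sup>2"])
    fix e :: real assume e: "0 < e" "e \<le> 1"
    have eq: "(\<lambda>x. p x + e * (-1 * p x)) = (\<lambda>x. (1 - e) * p x)" by (auto simp: algebra_simps)
    have "ip M r (\<lambda>x. -1 * p x) \<le> e / 2 * (nrm M (\<lambda>x. -1 * p x))\<^sup>2"
    proof (rule key[OF e(1)])
      show "(\<lambda>x. p x + e * (-1 * p x)) \<in> K" unfolding eq using e by (intro scale p) auto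
      show "(\<lambda>x. -1 * p x) \<in> L2 M" by (intro L2_cmult L p)
    qed
    then show "- ip M r p \<le> e / 2 * (nrm M p)\<^sup>2" unfolding ip_cmult_right nrm_cmult by simp
  qed
  then show ?thesis using p(1) 1 unfolding r_def[abs_def] by (intro bexI[of _ p]) (auto intro: antisym)
qed

text \<open>
  Each projection is tested against the other one; the sum of the two variational inequalities
  bounds \<open>\<parallel>p - q\<parallel>\<^sup>2\<close> by \<open>\<langle>f - g, p - q\<rangle>\<close>.
\<close>

lemma cone_projection_nonexpansive:
  assumes L: "f \<in> L2 M" "g \<in> L2 M" "p \<in> L2 M" "q \<in> L2 M"
    and f: "ip M (\<lambda>x. f x - p x) q \<le> 0" "ip M (\<lambda>x. f x - p x) p = 0"
    and g: "ip M (\<lambda>x. g x - q x) p \<le> 0" "ip M (\<lambda>x. g x - q x) q = 0"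
  shows "nrm M (\<lambda>x. p x - q x) \<le> nrm M (\<lambda>x. f x - g x)"
proof -
  let ?n = "nrm M (\<lambda>x. p x - q x)"
  have "?n\<^sup>2 \<le> ip M (\<lambda>x. f x - g x) (\<lambda>x. p x - q x)"
    using f g L by (simp add: nrm_sq ip_linear L2_diff ip_commute[of M q p])
  also have "\<dots> \<le> nrm M (\<lambda>x. f x - g x) * ?n"
    using ip_Cauchy_Schwarz[of "\<lambda>x. f x - g x" M "\<lambda>x. p x - q x"] L by (simp add: L2_diff)
  finally have "?n * ?n \<le> nrm M (\<lambda>x. f x - g x) * ?n" by (simp add: power2_eq_square)
  then show ?thesis using nrm_nonneg[of M "\<lambda>x. p x - q x"] nrm_nonneg[of M "\<lambda>x. f x - g x"]
    by (cases "?n = 0") (auto simp: mult_le_cancel_right)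
qed

section \<open>Nondecreasing functions on the unit interval\<close>

definition U :: "real measure" where
  "U = restrict_space lborel {0<..<1}"

lemma space_U: "space U = {0<..<1}"
  by (simp add: U_def space_restrict_space)

lemma sets_U: "sets U = sets (restrict_space borel {0<..<1})"
  by (simp add: U_def sets_restrict_space)

lemma prob_space_U: "prob_space U"
  by (auto simp: U_def emeasure_restrict_space space_restrict_space intro!: prob_spaceI)

interpretation U: prob_space U
  by (rule prob_space_U)

interpretation UU: pair_prob_space U U
  by standard

text \<open>
  Monotonicity everywhere, and not only almost everywhere, makes the fibres of elements of \<open>K\<close>
  intervals.
\<close>

definition K :: "(real \<Rightarrow> real) set" where
  "K = {f \<in> L2 U. mono_on {0<..<1} f}"

lemma K_L2: "f \<in> K \<Longrightarrow> f \<in> L2 U"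
  by (simp add: K_def)

lemma mono_on_measurable_U:
  fixes f :: "real \<Rightarrow> real"
  shows "mono_on {0<..<1} f \<Longrightarrow> f \<in> borel_measurable U"
  using borel_measurable_mono_on_fnc[of "{0<..<1}" f]
  by (simp add: sets_U cong: measurable_cong_sets)

lemma K_add: "f \<in> K \<Longrightarrow> g \<in> K \<Longrightarrow> (\<lambda>x. f x + g x) \<in> K"
  by (auto simp: K_def L2_add mono_on_def intro!: add_mono)

lemma K_scale: "0 \<le> c \<Longrightarrow> f \<in> K \<Longrightarrow> (\<lambda>x. c * f x) \<in> K"
  by (auto simp: K_def L2_cmult mono_on_def intro!: mult_left_mono)

lemma AE_U_dense:
  assumes "AE x in U. P x" "0 \<le> a" "a < b" "b \<le> 1"
  shows "\<exists>x. a < x \<and> x < b \<and> P x"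
proof (rule ccontr)
  assume n: "\<not> ?thesis"
  have "AE x in lborel. x \<in> {0<..<1} \<longrightarrow> P x"
    using assms(1) unfolding U_def by (subst (asm) AE_restrict_space_iff) auto
  then have "AE x in lborel. x \<notin> {a<..<b}"
    by eventually_elim (use n assms in auto)
  then have "emeasure lborel {a<..<b} = 0"
    by (subst (asm) AE_iff_measurable[of "{a<..<b}"]) auto
  then show False using assms by simp
qed

text \<open>
  At every point of the open interval, a sequence of nondecreasing functions that converges almost
  everywhere is squeezed between its values at two points of convergence. So the pointwise upper
  limit is finite everywhere, and it is nondecreasing without exceptional points. This makes the cone
  closed.
\<close>

lemma mono_AE_limit:
  assumes mono: "\<And>n. mono_on {0<..<1} (g n)" and conv: "AE x in U. convergent (\<lambda>n. g n x)"
  shows "\<exists>p :: real \<Rightarrow> real. mono_on {0<..<1} p \<and> (AE x in U. (\<lambda>n. g n x) \<longlonglongrightarrow> p x)"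
proof -
  define e where "e x = limsup (\<lambda>n. ereal (g n x))" for x
  have emono: "e x \<le> e y" if "0 < x" "x \<le> y" "y < 1" for x y
    unfolding e_def using that mono by (intro Limsup_mono always_eventually) (auto simp: mono_on_def)
  have elim: "e x = ereal (lim (\<lambda>n. g n x))" if "convergent (\<lambda>n. g n x)" for x
    unfolding e_def using that
    by (intro lim_imp_Limsup) (auto simp: convergent_LIMSEQ_iff)
  have fin: "\<bar>e x\<bar> \<noteq> \<infinity>" if x: "0 < x" "x < 1" for x
  proof -
    obtain a where a: "0 < a" "a < x" "convergent (\<lambda>n. g n a)"
      using AE_U_dense[OF conv, of 0 x] x by auto
    obtain b where b: "x < b" "b < 1" "convergent (\<lambda>n. g n b)"
      using AE_U_dense[OF conv, of x 1] x by auto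
    have "e a \<le> e x" "e x \<le> e b" using a b x by (auto intro!: emono)
    then show ?thesis unfolding elim[OF a(3)] elim[OF b(3)] by auto
  qed
  let ?p = "\<lambda>x. real_of_ereal (e x)"
  have "mono_on {0<..<1} ?p"
  proof (rule mono_onI)
    fix x y :: real assume xy: "x \<in> {0<..<1}" "y \<in> {0<..<1}" "x \<le> y"
    then have "ereal (?p x) \<le> ereal (?p y)"
      using emono[of x y] fin[of x] fin[of y] by (auto simp: ereal_real)
    then show "?p x \<le> ?p y" by simp
  qed
  moreover have "AE x in U. (\<lambda>n. g n x) \<longlonglongrightarrow> ?p x"
    using conv by eventually_elim (simp add: elim convergent_LIMSEQ_iff)
  ultimately show ?thesis by blast
qed

lemma K_closed:
  assumes g: "\<And>n. g n \<in> K" and c: "\<And>n m. n \<le> m \<Longrightarrow> nrm U (\<lambda>x. g n x - g m x) \<le> (1 / 2) ^ n"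
  shows "\<exists>p\<in>K. \<forall>n. nrm U (\<lambda>x. g n x - p x) \<le> (1 / 2) ^ n"
proof -
  have "AE x in U. convergent (\<lambda>n. g n x)"
    using c[of n "Suc n" for n] g
    by (intro U.L2_geometric_Cauchy_AE_convergent) (auto simp: K_L2 nrm_minus_commute[of U "g (Suc _)"])
  then obtain p where p: "mono_on {0<..<1} p" "AE x in U. (\<lambda>n. g n x) \<longlonglongrightarrow> p x"
    using mono_AE_limit[of g] g by (auto simp: K_def)
  have "p \<in> borel_measurable U" by (rule mono_on_measurable_U) fact
  note lim = L2_limit[of g U p "\<lambda>n. (1 / 2) ^ n", OF K_L2[OF g] this p(2) c]
  then show ?thesis using p(1) by (auto simp: K_def)
qed

lemma K_projection_exists:
  assumes "f \<in> L2 U"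
  shows "\<exists>p\<in>K. (\<forall>g\<in>K. ip U (\<lambda>x. f x - p x) g \<le> 0) \<and> ip U (\<lambda>x. f x - p x) p = 0"
proof (rule cone_projection_exists[OF _ _ K_add K_scale K_closed assms])
  show "K \<noteq> {}" using U.L2_const[of 0] by (auto simp: K_def mono_on_def intro!: exI[of _ "\<lambda>x. 0"])
qed (auto simp: K_L2)

section \<open>Averages over fibres\<close>

definition fmass :: "(real \<Rightarrow> real) \<Rightarrow> real \<Rightarrow> real" where
  "fmass X x = (LINT y|U. indicator {X x} (X y))"

text \<open>
  On a fibre without mass the kernel is \<open>0\<close> because division by \<open>0\<close> is.
\<close>

definition fker :: "(real \<Rightarrow> real) \<Rightarrow> real \<Rightarrow> real \<Rightarrow> real" where
  "fker X x y = indicator {X x} (X y) / fmass X x"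

text \<open>
  If \<open>X\<close> is nondecreasing, a fibre without mass is a single point, and this is a version of the
  conditional expectation of \<open>g\<close> given \<open>X\<close>. This version preserves monotonicity at every point.
\<close>

definition favg :: "(real \<Rightarrow> real) \<Rightarrow> (real \<Rightarrow> real) \<Rightarrow> real \<Rightarrow> real" where
  "favg X g x = (LINT y|U. fker X x y * g y) + (if fmass X x = 0 then g x else 0)"

definition const_on_fibres :: "(real \<Rightarrow> real) \<Rightarrow> (real \<Rightarrow> real) \<Rightarrow> bool" where
  "const_on_fibres X h \<longleftrightarrow> (\<forall>x\<in>{0<..<1}. \<forall>y\<in>{0<..<1}. X x = X y \<longrightarrow> h x = h y)"

lemma const_on_fibresD:
  "const_on_fibres X h \<Longrightarrow> x \<in> space U \<Longrightarrow> y \<in> space U \<Longrightarrow> X x = X y \<Longrightarrow> h x = h y"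
  unfolding const_on_fibres_def space_U by blast

lemma fmass_nonneg: "0 \<le> fmass X x"
  by (simp add: fmass_def)

lemma fmass_cong: "X x = X y \<Longrightarrow> fmass X x = fmass X y"
  by (simp add: fmass_def)

lemma fker_nonneg: "0 \<le> fker X x y"
  by (simp add: fker_def fmass_nonneg)

lemma fker_sym: "fker X x y = fker X y x"
  using fmass_cong[of X x y] by (auto simp: fker_def indicator_def)

lemma fker_nonzero: "fker X x y \<noteq> 0 \<Longrightarrow> X x = X y"
  by (auto simp: fker_def indicator_def split: if_splits)

context
  fixes X :: "real \<Rightarrow> real"
  assumes X[measurable]: "X \<in> borel_measurable U"
begin

lemma fmass_measurable[measurable]: "fmass X \<in> borel_measurable U"
proof -
  have "(\<lambda>x. LINT y|U. (if X y = X x then 1 else 0 :: real)) \<in> borel_measurable U"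
    by measurable
  then show ?thesis by (simp add: fmass_def[abs_def] indicator_def eq_commute)
qed

lemma fmass_zero_measurable[measurable]: "Measurable.pred U (\<lambda>x. fmass X x = 0)"
proof -
  have "fmass X x = 0 \<longleftrightarrow> fmass X x \<le> 0" for x using fmass_nonneg[of X x] by auto
  then show ?thesis by simp
qed

lemma fker_measurable[measurable]: "(\<lambda>p. fker X (fst p) (snd p)) \<in> borel_measurable (U \<Otimes>\<^sub>M U)"
proof -
  have "(\<lambda>p. (if X (snd p) = X (fst p) then 1 else 0) / fmass X (fst p)) \<in> borel_measurable (U \<Otimes>\<^sub>M U)"
    by measurable
  then show ?thesis by (simp add: fker_def[abs_def] indicator_def)
qed

lemma fker_measurable1:
  assumes "x \<in> space U"
  shows "fker X x \<in> borel_measurable U"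
proof -
  have "(\<lambda>y. (if X y = X x then 1 else 0) / fmass X x) \<in> borel_measurable U"
    by measurable
  then show ?thesis by (simp add: fker_def[abs_def] indicator_def)
qed

lemma fker_integral:
  assumes "x \<in> space U"
  shows "integrable U (fker X x)" "(LINT y|U. fker X x y) = (if fmass X x = 0 then 0 else 1)"
proof -
  have [measurable]: "(\<lambda>y. indicator {X x} (X y) :: real) \<in> borel_measurable U"
    unfolding indicator_def by measurable
  have i: "integrable U (\<lambda>y. indicator {X x} (X y) :: real)"
    by (rule U.integrable_const_bound[of _ 1]) (auto simp: indicator_def)
  then show "integrable U (fker X x)" by (simp add: fker_def[abs_def])
  show "(LINT y|U. fker X x y) = (if fmass X x = 0 then 0 else 1)"
    by (simp add: fker_def[abs_def]) (simp add: fmass_def)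
qed

lemma fker_pair_integrable:
  assumes u: "integrable U u"
  shows "integrable (U \<Otimes>\<^sub>M U) (\<lambda>(x, y). fker X x y * u y)"
proof (rule integrableI_bounded)
  have [measurable]: "u \<in> borel_measurable U" using u by auto
  show "(\<lambda>(x, y). fker X x y * u y) \<in> borel_measurable (U \<Otimes>\<^sub>M U)" by (simp add: split_beta')
  have "(\<integral>\<^sup>+p. ennreal (norm (case p of (x, y) \<Rightarrow> fker X x y * u y)) \<partial>(U \<Otimes>\<^sub>M U))
      = (\<integral>\<^sup>+y. \<integral>\<^sup>+x. ennreal (norm (fker X x y * u y)) \<partial>U \<partial>U)"
    by (subst UU.nn_integral_snd[symmetric]) (auto simp: split_beta')
  also have "\<dots> \<le> (\<integral>\<^sup>+y. ennreal \<bar>u y\<bar> \<partial>U)"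
  proof (rule nn_integral_mono)
    fix y assume y: "y \<in> space U"
    have "(\<integral>\<^sup>+x. ennreal (norm (fker X x y * u y)) \<partial>U) = (\<integral>\<^sup>+x. ennreal (fker X y x * \<bar>u y\<bar>) \<partial>U)"
      by (simp add: abs_mult fker_nonneg fker_sym[of X y])
    also have "\<dots> = ennreal (LINT x|U. fker X y x * \<bar>u y\<bar>)"
      using fker_integral[OF y] by (intro nn_integral_eq_integral) (auto simp: fker_nonneg)
    also have "\<dots> \<le> ennreal \<bar>u y\<bar>"
      using fker_integral[OF y] by (intro ennreal_leI) auto
    finally show "(\<integral>\<^sup>+x. ennreal (norm (fker X x y * u y)) \<partial>U) \<le> ennreal \<bar>u y\<bar>" .
  qed
  also have "\<dots> < \<infinity>" using u by (simp add: integrable_iff_bounded)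
  finally show "(\<integral>\<^sup>+p. ennreal (norm (case p of (x, y) \<Rightarrow> fker X x y * u y)) \<partial>(U \<Otimes>\<^sub>M U)) < \<infinity>" .
qed

lemma fker_pair_integral:
  assumes u: "integrable U u"
  shows "(LINT x|U. LINT y|U. fker X x y * u y) = (LINT y|U. (if fmass X y = 0 then 0 else u y))"
    and "(LINT p|(U \<Otimes>\<^sub>M U). fker X (fst p) (snd p) * u (snd p)) = (LINT y|U. (if fmass X y = 0 then 0 else u y))"
    and "integrable U (\<lambda>x. LINT y|U. fker X x y * u y)"
proof -
  note i = fker_pair_integrable[OF u]
  have "(LINT p|(U \<Otimes>\<^sub>M U). (case p of (x, y) \<Rightarrow> fker X x y * u y)) = (LINT y|U. LINT x|U. fker X x y * u y)"
    by (rule UU.integral_snd[OF i, symmetric])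
  also have "\<dots> = (LINT y|U. (if fmass X y = 0 then 0 else u y))"
  proof (rule Bochner_Integration.integral_cong[OF refl])
    fix y assume y: "y \<in> space U"
    have "(LINT x|U. fker X x y * u y) = (LINT x|U. fker X y x) * u y"
      by (subst fker_sym) simp
    then show "(LINT x|U. fker X x y * u y) = (if fmass X y = 0 then 0 else u y)"
      unfolding fker_integral(2)[OF y] by (simp only: if_distrib[of "\<lambda>c. c * u y"] mult_zero_left mult_1_left)
  qed
  finally show 2: "(LINT p|(U \<Otimes>\<^sub>M U). fker X (fst p) (snd p) * u (snd p)) = (LINT y|U. (if fmass X y = 0 then 0 else u y))"
    by (simp add: split_beta')
  show "(LINT x|U. LINT y|U. fker X x y * u y) = (LINT y|U. (if fmass X y = 0 then 0 else u y))"
    using UU.integral_fst'[OF i] 2 by (simp add: split_beta')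
  show "integrable U (\<lambda>x. LINT y|U. fker X x y * u y)"
    using UU.integrable_fst'[OF i] by simp
qed

lemma fker_mult_integrable:
  assumes x: "x \<in> space U" and g: "g \<in> L2 U"
  shows "integrable U (\<lambda>y. fker X x y * g y)" "integrable U (\<lambda>y. fker X x y * (g y)\<^sup>2)"
proof -
  have [measurable]: "g \<in> borel_measurable U" using g by (rule L2_measurable)
  have k: "fker X x y \<le> 1 / fmass X x" for y
    by (auto simp: fker_def indicator_def fmass_nonneg)
  have kx: "fker X x \<in> borel_measurable U" by (rule fker_measurable1[OF x])
  show "integrable U (\<lambda>y. fker X x y * g y)"
    using k by (intro U.L2_integrable L2_mult_bounded[OF g, where C = "1 / fmass X x"] kx)
      (simp add: fker_nonneg)
  show "integrable U (\<lambda>y. fker X x y * (g y)\<^sup>2)"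
  proof (rule Bochner_Integration.integrable_bound)
    show "integrable U (\<lambda>y. 1 / fmass X x * (g y)\<^sup>2)" using g by (simp add: L2_def)
    show "AE y in U. norm (fker X x y * (g y)\<^sup>2) \<le> norm (1 / fmass X x * (g y)\<^sup>2)"
    proof (rule AE_I2)
      fix y
      have "fker X x y * (g y)\<^sup>2 \<le> 1 / fmass X x * (g y)\<^sup>2" by (rule mult_right_mono[OF k zero_le_power2])
      then show "norm (fker X x y * (g y)\<^sup>2) \<le> norm (1 / fmass X x * (g y)\<^sup>2)"
        using fker_nonneg[of X x y] fmass_nonneg[of X x] by (simp add: abs_mult)
    qed
  qed (intro borel_measurable_times borel_measurable_power kx \<open>g \<in> borel_measurable U\<close>)
qed

lemma favg_const_on_fibres:
  assumes x: "x \<in> space U" and h: "const_on_fibres X h"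
  shows "favg X (\<lambda>y. g y * h y) x = favg X g x * h x"
proof -
  have "(LINT y|U. fker X x y * (g y * h y)) = (LINT y|U. (fker X x y * g y) * h x)"
  proof (rule Bochner_Integration.integral_cong[OF refl])
    fix y assume y: "y \<in> space U"
    have "h x = h y" if "fker X x y \<noteq> 0"
      by (rule const_on_fibresD[OF h x y fker_nonzero[OF that]])
    then show "fker X x y * (g y * h y) = (fker X x y * g y) * h x" by (cases "fker X x y = 0") simp_all
  qed
  then show ?thesis by (simp add: favg_def distrib_right)
qed

text \<open>
  Fubini and the symmetry of the kernel make fibre averaging measure preserving.
\<close>

lemma favg_integral:
  assumes u: "integrable U u"
  shows "integrable U (favg X u)" "(LINT x|U. favg X u x) = (LINT x|U. u x)"
proof -
  have [measurable]: "u \<in> borel_measurable U" using u by auto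
  have i0: "integrable U (\<lambda>x. if fmass X x = 0 then u x else 0)"
    and i1: "integrable U (\<lambda>x. if fmass X x = 0 then 0 else u x)"
    by (auto intro!: Bochner_Integration.integrable_bound[OF u])
  note k = fker_pair_integral[OF u]
  show "integrable U (favg X u)" unfolding favg_def[abs_def]
    by (intro Bochner_Integration.integrable_add k i0)
  have "(LINT x|U. favg X u x) = (LINT x|U. (if fmass X x = 0 then 0 else u x)) + (LINT x|U. (if fmass X x = 0 then u x else 0))"
    unfolding favg_def k(1)[symmetric] by (intro Bochner_Integration.integral_add k i0)
  also have "\<dots> = (LINT x|U. u x)"
    by (subst Bochner_Integration.integral_add[OF i1 i0, symmetric])
      (intro Bochner_Integration.integral_cong, auto)
  finally show "(LINT x|U. favg X u x) = (LINT x|U. u x)" .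
qed

text \<open>
  Jensen's inequality on one fibre, from the nonnegativity of the variance.
\<close>

lemma favg_sq_le:
  assumes x: "x \<in> space U" and g: "g \<in> L2 U"
  shows "(favg X g x)\<^sup>2 \<le> favg X (\<lambda>y. (g y)\<^sup>2) x"
proof (cases "fmass X x = 0")
  case True
  then show ?thesis by (simp add: favg_def fker_def)
next
  case False
  define c where "c = (LINT y|U. fker X x y * g y)"
  have "0 \<le> (LINT y|U. fker X x y * (g y - c)\<^sup>2)"
    by (simp add: fker_nonneg)
  also have "\<dots> = (LINT y|U. fker X x y * (g y)\<^sup>2 - 2 * c * (fker X x y * g y) + c\<^sup>2 * fker X x y)"
    by (simp add: power2_eq_square algebra_simps)
  also have "\<dots> = (LINT y|U. fker X x y * (g y)\<^sup>2) - c\<^sup>2"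
    using fker_mult_integrable[OF x g] fker_integral[OF x] False
    by (simp add: c_def[symmetric] power2_eq_square)
  finally show ?thesis using False by (simp add: favg_def c_def)
qed

lemma favg_L2:
  assumes g: "g \<in> L2 U"
  shows "favg X g \<in> L2 U"
proof -
  have 1: "favg X g \<in> borel_measurable U"
    using favg_integral(1)[OF U.L2_integrable[OF g]] by auto
  have "integrable U (\<lambda>x. (favg X g x)\<^sup>2)"
  proof (rule Bochner_Integration.integrable_bound)
    show "integrable U (favg X (\<lambda>y. (g y)\<^sup>2))" using g by (intro favg_integral) (simp add: L2_def)
    show "(\<lambda>x. (favg X g x)\<^sup>2) \<in> borel_measurable U" using 1 by measurable
    show "AE x in U. norm ((favg X g x)\<^sup>2) \<le> norm (favg X (\<lambda>y. (g y)\<^sup>2) x)"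
      using favg_sq_le[OF _ g] by (auto intro!: AE_I2 order_trans[OF _ abs_ge_self])
  qed
  then show ?thesis using 1 by (simp add: L2_def)
qed

lemma ip_favg:
  assumes g: "g \<in> L2 U" and h: "h \<in> L2 U" "const_on_fibres X h"
  shows "ip U (favg X g) h = ip U g h"
proof -
  have "ip U (favg X g) h = (LINT x|U. favg X (\<lambda>y. g y * h y) x)"
    unfolding ip_def by (intro Bochner_Integration.integral_cong refl) (simp add: favg_const_on_fibres h)
  then show ?thesis using favg_integral[OF L2_mult_integrable[OF g h(1)]] by (simp add: ip_def)
qed

lemma favg_le:
  assumes x: "x \<in> space U" and g: "g \<in> L2 U"
    and c: "\<And>y. y \<in> space U \<Longrightarrow> X y = X x \<Longrightarrow> g y \<le> c"
  shows "favg X g x \<le> c"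
proof (cases "fmass X x = 0")
  case True
  then have "favg X g x = g x" by (simp add: favg_def fker_def)
  then show ?thesis using c[OF x] by simp
next
  case False
  have "(LINT y|U. fker X x y * g y) \<le> (LINT y|U. fker X x y * c)"
  proof (rule integral_mono)
    fix y assume y: "y \<in> space U"
    show "fker X x y * g y \<le> fker X x y * c"
    proof (cases "fker X x y = 0")
      case False
      then show ?thesis using c[OF y] fker_nonzero[OF False] by (intro mult_left_mono) (auto simp: fker_nonneg)
    qed simp
  next
    show "integrable U (\<lambda>y. fker X x y * g y)" by (rule fker_mult_integrable[OF x g])
    show "integrable U (\<lambda>y. fker X x y * c)" by (intro integrable_mult_left fker_integral(1)[OF x])
  qed
  also have "(LINT y|U. fker X x y * c) = (LINT y|U. fker X x y) * c" by (rule integral_mult_left_zero)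
  also have "\<dots> = c" unfolding fker_integral(2)[OF x] using False by simp
  finally show ?thesis using False by (simp add: favg_def)
qed

lemma favg_ge:
  assumes x: "x \<in> space U" and g: "g \<in> L2 U"
    and c: "\<And>y. y \<in> space U \<Longrightarrow> X y = X x \<Longrightarrow> c \<le> g y"
  shows "c \<le> favg X g x"
proof -
  have "favg X (\<lambda>y. - g y) x \<le> - c"
  proof (rule favg_le[OF x])
    show "(\<lambda>y. - g y) \<in> L2 U" using L2_cmult[OF g, of "-1"] by simp
    show "- g y \<le> - c" if "y \<in> space U" "X y = X x" for y using c[OF that] by simp
  qed
  moreover have "favg X (\<lambda>y. - g y) x = - favg X g x" by (simp add: favg_def)
  ultimately show ?thesis by simp
qed

end

text \<open>
  A fibre with two points contains the interval between them, which has positive mass.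
\<close>

lemma mono_fibre_singleton:
  assumes X: "mono_on {0<..<1} X" and x: "x \<in> space U" "y \<in> space U" "X x = X y" "fmass X x = 0"
  shows "x = y"
proof (rule ccontr)
  note [measurable] = mono_on_measurable_U[OF X]
  assume "x \<noteq> y"
  define a b where "a = min x y" "b = max x y"
  then have ab: "a < b" "0 < a" "b < 1" "X a = X x" "X b = X x"
    using x \<open>x \<noteq> y\<close> by (auto simp: space_U min_def max_def)
  have Xz: "X z = X x" if "a < z" "z < b" for z
    using monotone_onD[OF X, of a z] monotone_onD[OF X, of z b] ab that by auto
  have [measurable]: "(\<lambda>y. indicator {X x} (X y) :: real) \<in> borel_measurable U"
    unfolding indicator_def by measurable
  have i: "integrable U (\<lambda>y. indicator {X x} (X y) :: real)"
    by (rule U.integrable_const_bound[of _ 1]) (auto simp: indicator_def)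
  have "AE y in U. indicator {X x} (X y) = (0::real)"
    using x(4) unfolding fmass_def by (subst (asm) integral_nonneg_eq_0_iff_AE[OF i]) auto
  then obtain z where "a < z" "z < b" "indicator {X x} (X z) = (0::real)"
    using AE_U_dense[of _ a b] ab by force
  then show False using Xz by simp
qed

text \<open>
  The fibres of a nondecreasing function are ordered, and so are the averages over them.
\<close>

lemma favg_K:
  assumes X: "mono_on {0<..<1} X" and g: "g \<in> K"
  shows "const_on_fibres X (favg X g)" "favg X g \<in> K"
proof -
  note XM = mono_on_measurable_U[OF X]
  show c: "const_on_fibres X (favg X g)"
    unfolding const_on_fibres_def
  proof (intro ballI impI)
    fix x y :: real assume xy: "x \<in> {0<..<1}" "y \<in> {0<..<1}" "X x = X y"
    show "favg X g x = favg X g y"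
    proof (cases "fmass X x = 0")
      case True
      then show ?thesis using mono_fibre_singleton[OF X _ _ xy(3)] xy by (simp add: space_U)
    next
      case False
      then show ?thesis using fmass_cong[of X x y] xy by (simp add: favg_def fker_def)
    qed
  qed
  have "mono_on {0<..<1} (favg X g)"
  proof (rule mono_onI)
    fix x y :: real assume xy: "x \<in> {0<..<1}" "y \<in> {0<..<1}" "x \<le> y"
    show "favg X g x \<le> favg X g y"
    proof (cases "X x = X y")
      case True
      then show ?thesis using const_on_fibresD[OF c _ _ True] xy by (simp add: space_U)
    next
      case False
      then have less: "X x < X y" using monotone_onD[OF X xy] by simp
      have *: "g z \<le> g w" if "z \<in> space U" "w \<in> space U" "X z = X x" "X w = X y" for z w
      proof -
        have "z \<le> w" using monotone_onD[OF X, of w z] that less by (force simp: space_U)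
        then show ?thesis using g that mono_onD[of "{0<..<1}" g z w] by (simp add: K_def space_U)
      qed
      show ?thesis
        using xy by (intro favg_ge favg_le XM K_L2 g) (auto simp: space_U intro!: *)
    qed
  qed
  then show "favg X g \<in> K" using favg_L2[OF XM K_L2[OF g]] by (simp add: K_def)
qed

text \<open>
  Chebyshev's inequality on each fibre: nondecreasing functions are positively correlated under
  the kernel, by the sign of \<open>(f x - f y) * (g x - g y)\<close>.
\<close>

lemma ip_favg_diff_nonneg:
  assumes X[measurable]: "X \<in> borel_measurable U" and f: "f \<in> K" and g: "g \<in> K"
  shows "0 \<le> ip U f (\<lambda>x. g x - favg X g x)"
proof -
  have L: "f \<in> L2 U" "g \<in> L2 U" using f g by (auto simp: K_L2)
  have [measurable]: "f \<in> borel_measurable U" "g \<in> borel_measurable U"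
    using L by (auto intro: L2_measurable)
  let ?UU = "U \<Otimes>\<^sub>M U"
  define k where "k p = fker X (fst p) (snd p)" for p
  have [measurable]: "k \<in> borel_measurable ?UU" unfolding k_def[abs_def] by measurable
  have yy: "integrable ?UU (\<lambda>p. k p * u (snd p))" if "integrable U u" for u
    using fker_pair_integrable[OF X that] by (simp add: split_beta' k_def)
  have xx: "integrable ?UU (\<lambda>p. k p * u (fst p))" "(LINT p|?UU. k p * u (fst p)) = (LINT p|?UU. k p * u (snd p))"
    if "integrable U u" for u
  proof -
    have eq: "(\<lambda>(x, y). k (y, x) * u (snd (y, x))) = (\<lambda>p. k p * u (fst p))"
      by (auto simp: k_def fker_sym)
    show "integrable ?UU (\<lambda>p. k p * u (fst p))"
      using UU.integrable_product_swap[OF yy[OF that]] by (simp only: eq)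
    show "(LINT p|?UU. k p * u (fst p)) = (LINT p|?UU. k p * u (snd p))"
      using that UU.integral_product_swap[of "\<lambda>p. k p * u (snd p)"] by (simp only: eq) measurable
  qed
  note fg = L2_mult_integrable[OF L]
  have s: "integrable U (\<lambda>x. (f x)\<^sup>2)" "integrable U (\<lambda>x. (g x)\<^sup>2)" using L by (auto simp: L2_def)
  have bd: "integrable ?UU (\<lambda>p. k p * (a (fst p) * b (snd p)))"
    if a: "a \<in> L2 U" and b: "b \<in> L2 U" for a b
  proof (rule Bochner_Integration.integrable_bound)
    have [measurable]: "a \<in> borel_measurable U" "b \<in> borel_measurable U"
      using a b by (auto intro: L2_measurable)
    show "(\<lambda>p. k p * (a (fst p) * b (snd p))) \<in> borel_measurable ?UU" by measurable
    show "integrable ?UU (\<lambda>p. k p * (a (fst p))\<^sup>2 + k p * (b (snd p))\<^sup>2)"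
      using a b by (intro Bochner_Integration.integrable_add xx(1) yy) (auto simp: L2_def)
    have "\<bar>u * v\<bar> \<le> u\<^sup>2 + v\<^sup>2" for u v :: real
    proof -
      have "2 * (\<bar>u\<bar> * \<bar>v\<bar>) \<le> u\<^sup>2 + v\<^sup>2"
        using sum_squares_bound[of "\<bar>u\<bar>" "\<bar>v\<bar>"] by (simp add: mult.assoc)
      moreover have "0 \<le> \<bar>u\<bar> * \<bar>v\<bar>" by simp
      ultimately show ?thesis unfolding abs_mult by linarith
    qed
    note le = mult_left_mono[OF this]
    show "AE p in ?UU. norm (k p * (a (fst p) * b (snd p))) \<le> norm (k p * (a (fst p))\<^sup>2 + k p * (b (snd p))\<^sup>2)"
    proof (rule AE_I2)
      fix p
      have k0: "0 \<le> k p" by (simp add: k_def fker_nonneg)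
      have "norm (k p * (a (fst p) * b (snd p))) = k p * \<bar>a (fst p) * b (snd p)\<bar>"
        using k0 by (simp add: abs_mult)
      also have "\<dots> \<le> k p * ((a (fst p))\<^sup>2 + (b (snd p))\<^sup>2)" by (rule le[OF k0])
      also have "\<dots> \<le> norm (k p * (a (fst p))\<^sup>2 + k p * (b (snd p))\<^sup>2)" by (simp add: distrib_left)
      finally show "norm (k p * (a (fst p) * b (snd p))) \<le> norm (k p * (a (fst p))\<^sup>2 + k p * (b (snd p))\<^sup>2)" .
    qed
  qed
  have bdv: "(LINT p|?UU. k p * (a (fst p) * b (snd p))) = (LINT x|U. a x * (LINT y|U. fker X x y * b y))"
    if a: "a \<in> L2 U" and b: "b \<in> L2 U" for a b
  proof -
    have "(LINT p|?UU. k p * (a (fst p) * b (snd p))) = (LINT x|U. LINT y|U. k (x, y) * (a x * b y))"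
      using UU.integral_fst'[OF bd[OF a b]] by simp
    also have "\<dots> = (LINT x|U. LINT y|U. a x * (fker X x y * b y))"
      by (simp add: k_def mult_ac)
    finally show ?thesis by simp
  qed
  have sw: "(LINT p|?UU. k p * (f (snd p) * g (fst p))) = (LINT p|?UU. k p * (f (fst p) * g (snd p)))"
  proof -
    have "(\<lambda>(x, y). k (y, x) * (f (fst (y, x)) * g (snd (y, x)))) = (\<lambda>p. k p * (f (snd p) * g (fst p)))"
      by (auto simp: k_def fker_sym)
    then show ?thesis
      using UU.integral_product_swap[of "\<lambda>p. k p * (f (fst p) * g (snd p))"] by simp
  qed
  have "0 \<le> (LINT p|?UU. k p * ((f (fst p) - f (snd p)) * (g (fst p) - g (snd p))))"
  proof (rule integral_nonneg_AE, rule AE_I2)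
    fix p assume "p \<in> space ?UU"
    then have "fst p \<in> {0<..<1}" "snd p \<in> {0<..<1}" by (auto simp: space_pair_measure space_U)
    moreover have "mono_on {0<..<1} f" "mono_on {0<..<1} g" using f g by (auto simp: K_def)
    ultimately have "0 \<le> (f (fst p) - f (snd p)) * (g (fst p) - g (snd p))"
      using mono_onD[of "{0<..<1}" f "fst p" "snd p"] mono_onD[of "{0<..<1}" f "snd p" "fst p"]
        mono_onD[of "{0<..<1}" g "fst p" "snd p"] mono_onD[of "{0<..<1}" g "snd p" "fst p"]
      by (cases "fst p \<le> snd p") (auto intro!: mult_nonneg_nonneg mult_nonpos_nonpos)
    then show "0 \<le> k p * ((f (fst p) - f (snd p)) * (g (fst p) - g (snd p)))"
      by (simp add: k_def fker_nonneg)
  qed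
  also have "\<dots> = (LINT p|?UU. (k p * (f (fst p) * g (fst p)) + k p * (f (snd p) * g (snd p)))
       - (k p * (f (fst p) * g (snd p)) + k p * (f (snd p) * g (fst p))))"
    by (intro Bochner_Integration.integral_cong refl) (simp add: algebra_simps)
  also have "\<dots> = 2 * (LINT p|?UU. k p * (f (snd p) * g (snd p))) - 2 * (LINT p|?UU. k p * (f (fst p) * g (snd p)))"
  proof -
    have i4: "integrable ?UU (\<lambda>p. k p * (f (snd p) * g (fst p)))"
      using bd[OF L(2,1)] by (simp add: mult.commute)
    show ?thesis
      using xx[OF fg] yy[OF fg] bd[OF L] i4 sw by simp
  qed
  also have "(LINT p|?UU. k p * (f (snd p) * g (snd p))) = (LINT y|U. (if fmass X y = 0 then 0 else f y * g y))"
    using fker_pair_integral(2)[OF X fg] by (simp add: k_def)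
  also have "(LINT p|?UU. k p * (f (fst p) * g (snd p))) = (LINT x|U. f x * (LINT y|U. fker X x y * g y))"
    by (rule bdv[OF L])
  also have "2 * (LINT y|U. (if fmass X y = 0 then 0 else f y * g y)) - 2 * \<dots> = 2 * ip U f (\<lambda>x. g x - favg X g x)"
  proof -
    have i0: "integrable U (\<lambda>x. if fmass X x = 0 then 0 else f x * g x)"
      by (rule Bochner_Integration.integrable_bound[OF fg]) auto
    have "integrable U (\<lambda>x. LINT y|U. (\<lambda>p. k p * (f (fst p) * g (snd p))) (x, y))"
      by (rule UU.integrable_fst'[OF bd[OF L]])
    then have i1: "integrable U (\<lambda>x. f x * (LINT y|U. fker X x y * g y))"
      by (simp add: k_def mult.left_commute)
    have "ip U f (\<lambda>x. g x - favg X g x)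
        = (LINT x|U. (if fmass X x = 0 then 0 else f x * g x) - f x * (LINT y|U. fker X x y * g y))"
      unfolding ip_def
      by (intro Bochner_Integration.integral_cong refl) (auto simp: favg_def algebra_simps)
    then show ?thesis using i0 i1 by simp
  qed
  finally show ?thesis by simp
qed

section \<open>Functions of a random variable\<close>

definition fun_of :: "'a measure \<Rightarrow> ('a \<Rightarrow> real) \<Rightarrow> ('a \<Rightarrow> real) \<Rightarrow> bool" where
  "fun_of M X h \<longleftrightarrow> (\<exists>H\<in>borel_measurable borel. AE x in M. h x = H (X x))"

lemma fun_ofI: "H \<in> borel_measurable borel \<Longrightarrow> AE x in M. h x = H (X x) \<Longrightarrow> fun_of M X h"
  unfolding fun_of_def by blast

lemma fun_of_self: "fun_of M X X"
  by (rule fun_ofI[of "\<lambda>x. x"]) auto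

lemma fun_of_const: "fun_of M X (\<lambda>x. c)"
  by (rule fun_ofI[of "\<lambda>x. c"]) auto

lemma fun_of_comp: "fun_of M X h \<Longrightarrow> G \<in> borel_measurable borel \<Longrightarrow> fun_of M X (\<lambda>x. G (h x))"
proof -
  assume "fun_of M X h" and G[measurable]: "G \<in> borel_measurable borel"
  then obtain H where H[measurable]: "H \<in> borel_measurable borel" "AE x in M. h x = H (X x)"
    unfolding fun_of_def by blast
  show ?thesis by (rule fun_ofI[of "\<lambda>u. G (H u)"]) (use H(2) in auto)
qed

lemma fun_of_comp2:
  assumes "fun_of M X h" "fun_of M X k" and G: "(\<lambda>p. G (fst p) (snd p)) \<in> borel_measurable (borel \<Otimes>\<^sub>M borel)"
  shows "fun_of M X (\<lambda>x. G (h x) (k x))"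
proof -
  obtain H where H[measurable]: "H \<in> borel_measurable borel" and 1: "AE x in M. h x = H (X x)"
    using assms unfolding fun_of_def by blast
  obtain L where L[measurable]: "L \<in> borel_measurable borel" and 2: "AE x in M. k x = L (X x)"
    using assms unfolding fun_of_def by blast
  have "(\<lambda>u. G (H u) (L u)) = (\<lambda>u. (\<lambda>p. G (fst p) (snd p)) (H u, L u))" by simp
  also have "\<dots> \<in> borel_measurable borel" by (rule measurable_compose[OF _ G]) measurable
  finally show ?thesis
    by (rule fun_ofI) (use 1 2 in auto)
qed

lemma fun_of_add: "fun_of M X h \<Longrightarrow> fun_of M X k \<Longrightarrow> fun_of M X (\<lambda>x. h x + k x)"
  by (rule fun_of_comp2) auto

lemma fun_of_diff: "fun_of M X h \<Longrightarrow> fun_of M X k \<Longrightarrow> fun_of M X (\<lambda>x. h x - k x)"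
  by (rule fun_of_comp2) auto

lemma fun_of_mult: "fun_of M X h \<Longrightarrow> fun_of M X k \<Longrightarrow> fun_of M X (\<lambda>x. h x * k x)"
  by (rule fun_of_comp2) auto

lemma fun_of_divide: "fun_of M X h \<Longrightarrow> fun_of M X (\<lambda>x. h x / c)"
  by (rule fun_of_comp[where G = "\<lambda>u. u / c"]) auto

lemma fun_of_trans: "fun_of M X Y \<Longrightarrow> fun_of M Y h \<Longrightarrow> fun_of M X h"
proof -
  assume XY: "fun_of M X Y" and "fun_of M Y h"
  then obtain H where H: "H \<in> borel_measurable borel" "AE x in M. h x = H (Y x)"
    unfolding fun_of_def by blast
  from fun_of_comp[OF XY H(1)] obtain L where
    L: "L \<in> borel_measurable borel" "AE x in M. H (Y x) = L (X x)" unfolding fun_of_def by blast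
  show ?thesis by (rule fun_ofI[OF L(1)]) (use H(2) L(2) in auto)
qed

lemma fun_of_AE_cong: "fun_of M X h \<Longrightarrow> AE x in M. h x = k x \<Longrightarrow> fun_of M X k"
  unfolding fun_of_def by (elim bexE, rule bexI) auto

text \<open>
  A function with vanishing integral over all superlevel sets of \<open>X\<close> has conditional expectation
  \<open>0\<close> given \<open>X\<close>, since the superlevel sets generate the \<open>\<sigma>\<close>-algebra of \<open>X\<close>.
\<close>

lemma (in prob_space) integral_mult_fun_of_eq_0:
  fixes X R h :: "'a \<Rightarrow> real"
  assumes X[measurable]: "X \<in> borel_measurable M" and R: "integrable M R"
    and h[measurable]: "h \<in> borel_measurable M" and Rh: "integrable M (\<lambda>x. R x * h x)"
    and fo: "fun_of M X h" and R0: "(LINT x|M. R x) = 0"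
    and Rc: "\<And>c. (LINT x|M. R x * indicator {c<..} (X x)) = 0"
  shows "(LINT x|M. R x * h x) = 0"
proof -
  have [measurable]: "R \<in> borel_measurable M" using R by auto
  define F where "F = vimage_algebra (space M) X borel"
  have sub: "subalgebra M F"
    unfolding subalgebra_def F_def
    by (auto simp: sets_vimage_algebra2)
  interpret F: finite_measure_subalgebra M F
    by standard (rule sub)
  define Q where "Q A \<longleftrightarrow> (LINT x:(X -` A \<inter> space M)|M. R x) = 0" for A
  have Ri: "set_integrable M B R" if "B \<in> sets M" for B
    using R that unfolding set_integrable_def by (intro integrable_mult_indicator)
  have Q: "Q A" if "A \<in> sets borel" for A
  proof -
    have "Int_stable (range greaterThan :: real set set)"
    proof (rule Int_stableI)
      fix A B :: "real set" assume "A \<in> range greaterThan" "B \<in> range greaterThan"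
      then obtain a b where "A = {a<..}" "B = {b<..}" by auto
      then have "A \<inter> B = {max a b<..}" by auto
      then show "A \<inter> B \<in> range greaterThan" by blast
    qed
    moreover have "range greaterThan \<subseteq> Pow (UNIV :: real set)" by simp
    moreover have "A \<in> sigma_sets UNIV (range greaterThan)"
      using that by (simp add: borel_Ioi)
    ultimately show "Q A"
    proof (induction rule: sigma_sets_induct_disjoint)
      case (basic A)
      then obtain c where "A = {c<..}" by auto
      then show ?case
        using Rc[of c] unfolding Q_def set_lebesgue_integral_def
        by (subst Bochner_Integration.integral_cong[of M M _ "\<lambda>x. R x * indicator {c<..} (X x)"])
          (auto simp: indicator_def)
    next
      case empty
      then show ?case by (simp add: Q_def set_lebesgue_integral_def)
    next
      case (compl A)
      then have A[measurable]: "A \<in> sets borel" by (simp add: borel_Ioi)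
      have "(LINT x|M. R x) = (LINT x|M. indicator (X -` A \<inter> space M) x *\<^sub>R R x + indicator (X -` (UNIV - A) \<inter> space M) x *\<^sub>R R x)"
        by (intro Bochner_Integration.integral_cong) (auto simp: indicator_def)
      also have "\<dots> = (LINT x:(X -` A \<inter> space M)|M. R x) + (LINT x:(X -` (UNIV - A) \<inter> space M)|M. R x)"
        unfolding set_lebesgue_integral_def
        using Ri[of "X -` A \<inter> space M"] Ri[of "X -` (UNIV - A) \<inter> space M"]
        by (intro Bochner_Integration.integral_add) (auto simp: set_integrable_def)
      finally show ?case using compl R0 by (simp add: Q_def)
    next
      case (union A)
      have A[measurable]: "A i \<in> sets borel" for i using union by (auto simp: borel_Ioi)
      have "(LINT x:(\<Union>i. X -` A i \<inter> space M)|M. R x) = (\<Sum>i. (LINT x:(X -` A i \<inter> space M)|M. R x))"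
        by (rule lebesgue_integral_countable_add)
          (use union in \<open>auto simp: disjoint_family_on_def intro!: Ri sets.countable_UN\<close>)
      also have "\<dots> = 0" using union by (simp add: Q_def)
      finally show ?case by (simp add: Q_def vimage_UN)
    qed
  qed
  have AE0: "AE x in M. real_cond_exp M F R x = 0"
  proof (rule F.real_cond_exp_charact)
    fix B assume "B \<in> sets F"
    then obtain A where "A \<in> sets borel" "B = X -` A \<inter> space M"
      by (auto simp: F_def sets_vimage_algebra2)
    then show "(LINT x:B|M. R x) = (LINT x:B|M. 0)"
      using Q[of A] by (simp add: Q_def)
  qed (use R in auto)
  obtain H where H[measurable]: "H \<in> borel_measurable borel" and ae: "AE x in M. h x = H (X x)"
    using fo unfolding fun_of_def by blast
  have XF: "X \<in> measurable F borel" unfolding F_def by (rule measurable_vimage_algebra1) auto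
  have HF: "(\<lambda>x. H (X x)) \<in> borel_measurable F" by (rule measurable_compose[OF XF H])
  have HR: "integrable M (\<lambda>x. H (X x) * R x)"
    by (rule integrable_cong_AE_imp[OF Rh]) (use ae in \<open>auto simp: mult.commute\<close>)
  have "(LINT x|M. R x * h x) = (LINT x|M. H (X x) * R x)"
    by (rule integral_cong_AE) (use ae in \<open>auto simp: mult.commute\<close>)
  also have "\<dots> = (LINT x|M. H (X x) * real_cond_exp M F R x)"
    by (rule F.real_cond_exp_intg(2)[OF HR HF, symmetric]) auto
  also have "\<dots> = (LINT x|M. 0)"
    by (rule integral_cong_AE) (use AE0 in auto)
  finally show ?thesis by simp
qed

section \<open>Fibre averages as limits of kernel averages\<close>

definition tent :: "nat \<Rightarrow> real \<Rightarrow> real" where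
  "tent n u = max 0 (1 - real (Suc n) * \<bar>u\<bar>)"

text \<open>
  The quotient of this integral for \<open>g\<close> and for the constant \<open>1\<close> is an average of \<open>g\<close> over labels
  with \<open>X\<close> near \<open>\<xi>\<close>. Fibre averages do not depend continuously on \<open>\<xi>\<close> and \<open>X\<close>, but these integrals
  do, so that the limit of the quotients is measurable in \<open>\<xi>\<close> and in any parameter of \<open>X\<close>.
\<close>

definition tent_integral :: "(real \<Rightarrow> real) \<Rightarrow> (real \<Rightarrow> real) \<Rightarrow> nat \<Rightarrow> real \<Rightarrow> real" where
  "tent_integral X g n \<xi> = (LINT y|U. g y * tent n (\<xi> - X y))"

lemma tent_bounds: "0 \<le> tent n u" "tent n u \<le> 1"
  by (auto simp: tent_def)

lemma tent_nonzero: "tent n u \<noteq> 0 \<Longrightarrow> \<bar>u\<bar> < 1 / real (Suc n)"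
  by (auto simp: tent_def max_def field_simps split: if_splits)

lemma tent_pos: "\<bar>u\<bar> < 1 / real (Suc n) \<Longrightarrow> 0 < tent n u"
  by (auto simp: tent_def field_simps)

lemma tent_Lipschitz: "\<bar>tent n u - tent n v\<bar> \<le> real (Suc n) * \<bar>u - v\<bar>"
proof -
  have "\<bar>tent n u - tent n v\<bar> \<le> \<bar>real (Suc n) * \<bar>u\<bar> - real (Suc n) * \<bar>v\<bar>\<bar>"
    unfolding tent_def by linarith
  also have "\<dots> = real (Suc n) * \<bar>\<bar>u\<bar> - \<bar>v\<bar>\<bar>" by (simp add: abs_mult flip: right_diff_distrib)
  also have "\<dots> \<le> real (Suc n) * \<bar>u - v\<bar>" by (intro mult_left_mono) auto
  finally show ?thesis .
qed

lemma tent_measurable[measurable]: "tent n \<in> borel_measurable borel"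
  unfolding tent_def[abs_def] by measurable

lemma tent_tendsto: "(\<lambda>n. tent n u) \<longlonglongrightarrow> indicator {0} u"
proof (cases "u = 0")
  case True
  then show ?thesis by (simp add: tent_def)
next
  case False
  then obtain N where N: "1 / real (Suc N) < \<bar>u\<bar>" using nat_approx_posE[of "\<bar>u\<bar>"] by auto
  have "\<forall>\<^sub>F n in sequentially. tent n u = 0"
    using eventually_ge_at_top[of N]
  proof eventually_elim
    case (elim n)
    then have "1 / real (Suc n) \<le> 1 / real (Suc N)" by (simp add: frac_le)
    then show ?case using N tent_nonzero[of n u] by force
  qed
  then show ?thesis using False by (auto intro: tendsto_eventually)
qed

context
  fixes X :: "real \<Rightarrow> real"
  assumes X[measurable]: "X \<in> borel_measurable U"
begin

lemma tent_comp_L2: "(\<lambda>y. tent n (\<xi> - X y)) \<in> L2 U"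
  by (rule U.L2_bounded[of _ 1]) (auto simp: tent_bounds)

lemma tent_integrable: "g \<in> L2 U \<Longrightarrow> integrable U (\<lambda>y. g y * tent n (\<xi> - X y))"
  by (intro L2_mult_integrable tent_comp_L2)

lemma tent_integral_diff:
  assumes Y[measurable]: "Y \<in> borel_measurable U" and XY: "X \<in> L2 U" "Y \<in> L2 U" and g: "g \<in> L2 U"
  shows "\<bar>tent_integral X g n \<xi> - tent_integral Y g n \<eta>\<bar>
    \<le> real (Suc n) * nrm U g * (\<bar>\<xi> - \<eta>\<bar> + nrm U (\<lambda>y. X y - Y y))"
proof -
  have [measurable]: "g \<in> borel_measurable U" using g by (rule L2_measurable)
  have L2Y: "(\<lambda>y. tent n (\<eta> - Y y)) \<in> L2 U" by (rule U.L2_bounded[of _ 1]) (auto simp: tent_bounds)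
  define D where "D y = tent n (\<xi> - X y) - tent n (\<eta> - Y y)" for y
  define B where "B y = \<bar>\<xi> - \<eta>\<bar> + \<bar>X y - Y y\<bar>" for y
  have DL: "D \<in> L2 U" unfolding D_def[abs_def] by (intro L2_diff tent_comp_L2 L2Y)
  have BL: "B \<in> L2 U" unfolding B_def[abs_def] by (intro L2_add U.L2_const L2_abs L2_diff XY)
  have "tent_integral X g n \<xi> - tent_integral Y g n \<eta> = ip U g D"
    unfolding tent_integral_def ip_def D_def
    using L2_mult_integrable[OF g tent_comp_L2, of n \<xi>] L2_mult_integrable[OF g L2Y]
    by (simp add: right_diff_distrib)
  then have 1: "\<bar>tent_integral X g n \<xi> - tent_integral Y g n \<eta>\<bar> \<le> nrm U g * nrm U D"
    using ip_Cauchy_Schwarz[OF g DL] by simp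
  have "nrm U D \<le> nrm U (\<lambda>y. real (Suc n) * B y)"
  proof (rule nrm_mono(2))
    show "(\<lambda>y. real (Suc n) * B y) \<in> L2 U" by (intro L2_cmult BL)
    show "D \<in> borel_measurable U" using DL by (rule L2_measurable)
    fix y
    have "\<bar>D y\<bar> \<le> real (Suc n) * \<bar>(\<xi> - X y) - (\<eta> - Y y)\<bar>" unfolding D_def by (rule tent_Lipschitz)
    also have "\<dots> \<le> real (Suc n) * B y" unfolding B_def by (intro mult_left_mono) auto
    finally show "\<bar>D y\<bar> \<le> \<bar>real (Suc n) * B y\<bar>" by linarith
  qed
  then have 2: "nrm U D \<le> real (Suc n) * nrm U B" by (simp add: nrm_cmult)
  have "nrm U B \<le> nrm U (\<lambda>y. \<bar>\<xi> - \<eta>\<bar>) + nrm U (\<lambda>y. \<bar>X y - Y y\<bar>)"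
    unfolding B_def[abs_def] by (intro nrm_triangle U.L2_const L2_abs L2_diff XY)
  also have "nrm U (\<lambda>y. \<bar>\<xi> - \<eta>\<bar>) = \<bar>\<xi> - \<eta>\<bar>" by (simp add: nrm_def ip_def U.prob_space)
  also have "nrm U (\<lambda>y. \<bar>X y - Y y\<bar>) = nrm U (\<lambda>y. X y - Y y)" by (simp add: nrm_def ip_def flip: abs_mult)
  finally have 3: "real (Suc n) * nrm U B \<le> real (Suc n) * (\<bar>\<xi> - \<eta>\<bar> + nrm U (\<lambda>y. X y - Y y))"
    by (intro mult_left_mono) auto
  show ?thesis
    using 1 mult_left_mono[OF order_trans[OF 2 3] nrm_nonneg[of U g]] by (simp add: mult_ac)
qed

lemma tent_integral_measurable[measurable]:
  assumes "X \<in> L2 U" "g \<in> L2 U"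
  shows "tent_integral X g n \<in> borel_measurable borel"
proof (rule borel_measurable_continuous_onI)
  show "continuous_on UNIV (tent_integral X g n)"
  proof (rule lipschitz_on_continuous_on[of "real (Suc n) * nrm U g"], rule lipschitz_onI)
    fix \<xi> \<eta>
    have "nrm U (\<lambda>y. X y - X y) = 0" by (simp add: nrm_def ip_def)
    then show "dist (tent_integral X g n \<xi>) (tent_integral X g n \<eta>) \<le> real (Suc n) * nrm U g * dist \<xi> \<eta>"
      using tent_integral_diff[OF X assms(1) assms(1) assms(2), of n \<xi> \<eta>] by (simp add: dist_real_def)
  qed (simp add: nrm_nonneg)
qed

lemma tent_integral_1_nonneg: "0 \<le> tent_integral X (\<lambda>y. 1) n \<xi>"
  unfolding tent_integral_def by (simp add: tent_bounds)

end

lemma tent_integral_pos: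
  assumes X: "X \<in> borel_measurable U" and x: "x \<in> {0<..<1}" and c: "isCont X x"
  shows "0 < tent_integral X (\<lambda>y. 1) n (X x)"
proof (rule ccontr)
  assume "\<not> ?thesis"
  then have "(LINT y|U. tent n (X x - X y)) = 0"
    using tent_integral_1_nonneg[OF X, of n "X x"] by (simp add: tent_integral_def)
  then have ae: "AE y in U. tent n (X x - X y) = 0"
    using U.L2_integrable[OF tent_comp_L2[OF X]] by (subst integral_nonneg_eq_0_iff_AE[symmetric]) (auto simp: tent_bounds)
  obtain d where d: "d > 0" "\<And>y. \<bar>y - x\<bar> < d \<Longrightarrow> \<bar>X y - X x\<bar> < 1 / real (Suc n)"
    using c unfolding continuous_at_eps_delta by (metis dist_real_def of_nat_0_less_iff zero_less_Suc zero_less_divide_1_iff)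
  obtain y where "x < y" "y < min 1 (x + d)" "tent n (X x - X y) = 0"
    using AE_U_dense[OF ae, of x "min 1 (x + d)"] x d by auto
  then show False using d(2)[of y] tent_pos[of "X x - X y" n] by (simp add: abs_minus_commute)
qed

text \<open>
  On a fibre with mass, numerator and denominator converge separately, by dominated convergence. If
  the fibre is \<open>{x}\<close>, both tend to \<open>0\<close>, but the weights concentrate at \<open>x\<close>, where \<open>g\<close> is continuous.
\<close>

lemma tent_average_tendsto:
  assumes XL: "X \<in> K" and gL: "g \<in> K" and x: "x \<in> {0<..<1}" and Xc: "isCont X x" and gc: "isCont g x"
  shows "(\<lambda>n. tent_integral X g n (X x) / tent_integral X (\<lambda>y. 1) n (X x)) \<longlonglongrightarrow> favg X g x"
proof -
  have X: "mono_on {0<..<1} X" and L: "X \<in> L2 U" "g \<in> L2 U" using XL gL by (auto simp: K_def)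
  have [measurable]: "X \<in> borel_measurable U" "g \<in> borel_measurable U" using L by (auto intro: L2_measurable)
  have xU: "x \<in> space U" using x by (simp add: space_U)
  show ?thesis
  proof (cases "fmass X x = 0")
    case False
    have *: "(\<lambda>n. tent_integral X h n (X x)) \<longlonglongrightarrow> (LINT y|U. h y * indicator {X x} (X y))"
      if h: "h \<in> L2 U" for h
      unfolding tent_integral_def
    proof (rule integral_dominated_convergence[where w = "\<lambda>y. \<bar>h y\<bar>"])
      have [measurable]: "h \<in> borel_measurable U" using h by (rule L2_measurable)
      show "(\<lambda>y. h y * indicator {X x} (X y)) \<in> borel_measurable U" by measurable
      show "(\<lambda>y. h y * tent n (X x - X y)) \<in> borel_measurable U" for n by measurable
      show "integrable U (\<lambda>y. \<bar>h y\<bar>)" using U.L2_integrable[OF h] by simp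
      show "AE y in U. (\<lambda>n. h y * tent n (X x - X y)) \<longlonglongrightarrow> h y * indicator {X x} (X y)"
      proof (rule AE_I2)
        fix y
        have "indicator {0} (X x - X y) = (indicator {X x} (X y) :: real)" by (auto simp: indicator_def)
        then show "(\<lambda>n. h y * tent n (X x - X y)) \<longlonglongrightarrow> h y * indicator {X x} (X y)"
          using tendsto_mult_left[OF tent_tendsto[of "X x - X y"], of "h y"] by simp
      qed
      show "AE y in U. norm (h y * tent n (X x - X y)) \<le> \<bar>h y\<bar>" for n
        by (intro AE_I2) (auto simp: abs_mult tent_bounds intro!: mult_left_le)
    qed
    have "(\<lambda>n. tent_integral X g n (X x) / tent_integral X (\<lambda>y. 1) n (X x))
        \<longlonglongrightarrow> (LINT y|U. g y * indicator {X x} (X y)) / (LINT y|U. 1 * indicator {X x} (X y))"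
      using False by (intro tendsto_divide * L U.L2_const) (simp add: fmass_def)
    also have "(LINT y|U. g y * indicator {X x} (X y)) / (LINT y|U. 1 * indicator {X x} (X y)) = favg X g x"
    proof -
      have "favg X g x = (LINT y|U. (g y * indicator {X x} (X y)) / fmass X x)"
        using False by (simp add: favg_def fker_def mult.commute)
      then show ?thesis by (simp add: fmass_def)
    qed
    finally show ?thesis .
  next
    case True
    have fx: "favg X g x = g x" using True by (simp add: favg_def fker_def)
    show ?thesis unfolding fx
    proof (rule LIMSEQ_I)
      fix r :: real assume r: "0 < r"
      obtain d where d: "d > 0" "\<And>y. \<bar>y - x\<bar> < d \<Longrightarrow> \<bar>g y - g x\<bar> < r / 2"
        using gc r unfolding continuous_at_eps_delta by (metis dist_real_def half_gt_zero)
      define e where "e = min d (min x (1 - x)) / 2"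
      have e: "0 < e" "e < d" "x - e \<in> {0<..<1}" "x + e \<in> {0<..<1}"
        using x d by (auto simp: e_def min_def field_simps)
      have sep: "X (x - e) < X x" "X x < X (x + e)"
        using monotone_onD[OF X e(3) x] monotone_onD[OF X x e(4)] e
          mono_fibre_singleton[OF X xU _ _ True, of "x - e"] mono_fibre_singleton[OF X xU _ _ True, of "x + e"]
        by (auto simp: space_U less_le)
      obtain N where N: "1 / real (Suc N) < min (X x - X (x - e)) (X (x + e) - X x)"
        using nat_approx_posE[of "min (X x - X (x - e)) (X (x + e) - X x)"] sep by auto
      show "\<exists>n0. \<forall>n\<ge>n0. norm (tent_integral X g n (X x) / tent_integral X (\<lambda>y. 1) n (X x) - g x) < r"
      proof (intro exI allI impI)
        fix n assume n: "N \<le> n"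
        then have nN: "1 / real (Suc n) \<le> 1 / real (Suc N)" by (simp add: frac_le)
        have close: "\<bar>g y - g x\<bar> < r / 2" if y: "y \<in> space U" "tent n (X x - X y) \<noteq> 0" for y
        proof (rule d(2))
          have "\<bar>X x - X y\<bar> < min (X x - X (x - e)) (X (x + e) - X x)"
            using tent_nonzero[OF y(2)] nN N by linarith
          then have "X (x - e) < X y" "X y < X (x + e)" by auto
          then have "x - e < y" "y < x + e"
            using monotone_onD[OF X, of y "x - e"] monotone_onD[OF X, of "x + e" y] y e
            by (auto simp: space_U not_le[symmetric])
          then show "\<bar>y - x\<bar> < d" using e by auto
        qed
        define den where "den = tent_integral X (\<lambda>y. 1) n (X x)"
        have den: "den > 0" unfolding den_def by (rule tent_integral_pos) (use x Xc in auto)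
        have ti: "integrable U (\<lambda>y. tent n (X x - X y))" by (intro U.L2_integrable tent_comp_L2) simp
        have gi: "integrable U (\<lambda>y. g y * tent n (X x - X y))" by (intro tent_integrable L) simp
        have "tent_integral X g n (X x) - g x * den = (LINT y|U. g y * tent n (X x - X y) - g x * tent n (X x - X y))"
          unfolding den_def tent_integral_def using ti gi by simp
        then have "\<bar>tent_integral X g n (X x) - g x * den\<bar>
            \<le> (LINT y|U. \<bar>g y * tent n (X x - X y) - g x * tent n (X x - X y)\<bar>)"
          using integral_abs_bound by metis
        also have "\<dots> \<le> (LINT y|U. r / 2 * tent n (X x - X y))"
        proof (rule integral_mono)
          show "integrable U (\<lambda>y. \<bar>g y * tent n (X x - X y) - g x * tent n (X x - X y)\<bar>)" using ti gi by auto
          show "integrable U (\<lambda>y. r / 2 * tent n (X x - X y))" using ti by auto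
          fix y assume y: "y \<in> space U"
          have "\<bar>g y * tent n (X x - X y) - g x * tent n (X x - X y)\<bar> = \<bar>g y - g x\<bar> * tent n (X x - X y)"
            by (simp add: tent_bounds abs_mult flip: left_diff_distrib)
          also have "\<dots> \<le> r / 2 * tent n (X x - X y)"
            using close[OF y] tent_bounds(1)[of n "X x - X y"]
            by (cases "tent n (X x - X y) = 0") (auto intro!: mult_right_mono less_imp_le)
          finally show "\<bar>g y * tent n (X x - X y) - g x * tent n (X x - X y)\<bar> \<le> r / 2 * tent n (X x - X y)" .
        qed
        also have "\<dots> = r / 2 * den" by (simp add: den_def tent_integral_def)
        also have "\<dots> < r * den" using r den by simp
        finally have "\<bar>tent_integral X g n (X x) - g x * den\<bar> / den < r" using den by (simp add: divide_less_eq)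
        moreover have "tent_integral X g n (X x) / den - g x = (tent_integral X g n (X x) - g x * den) / den"
          using den by (simp add: field_simps)
        ultimately show "norm (tent_integral X g n (X x) / tent_integral X (\<lambda>y. 1) n (X x) - g x) < r"
          using den unfolding den_def[symmetric] by (simp add: abs_divide)
      qed
    qed
  qed
qed

lemma AE_isCont_mono:
  fixes g :: "real \<Rightarrow> real"
  assumes "mono_on {0<..<1} g"
  shows "AE x in U. isCont g x"
proof -
  have "countable {a \<in> {0<..<1}. \<not> isCont g a}"
    by (rule mono_on_ctble_discont_open[OF _ assms]) auto
  then have "AE x in lborel. x \<notin> {a \<in> {0<..<1}. \<not> isCont g a}"
    by (intro AE_not_in countable_imp_null_set_lborel)
  then show ?thesis unfolding U_def by (subst AE_restrict_space_iff) auto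
qed

lemma AE_tent_average_tendsto:
  assumes X: "X \<in> K" and g: "g \<in> K"
  shows "AE x in U. 0 < tent_integral X (\<lambda>y. 1) n (X x)"
    and "AE x in U. (\<lambda>n. tent_integral X g n (X x) / tent_integral X (\<lambda>y. 1) n (X x)) \<longlonglongrightarrow> favg X g x"
proof -
  have c: "AE x in U. isCont X x" "AE x in U. isCont g x" using X g by (auto simp: K_def intro: AE_isCont_mono)
  have Xm: "X \<in> borel_measurable U" using X by (intro L2_measurable K_L2)
  show "AE x in U. 0 < tent_integral X (\<lambda>y. 1) n (X x)"
    using c(1) AE_space by eventually_elim (auto simp: space_U intro!: tent_integral_pos Xm)
  show "AE x in U. (\<lambda>n. tent_integral X g n (X x) / tent_integral X (\<lambda>y. 1) n (X x)) \<longlonglongrightarrow> favg X g x"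
    using c AE_space by eventually_elim (auto simp: space_U intro!: tent_average_tendsto X g)
qed

lemma fun_of_favg:
  assumes X: "X \<in> K" and g: "g \<in> K"
  shows "fun_of U X (favg X g)"
proof (rule fun_ofI)
  note m = tent_integral_measurable[OF L2_measurable[OF K_L2[OF X]] K_L2[OF X]]
  show "(\<lambda>\<xi>. lim (\<lambda>n. tent_integral X g n \<xi> / tent_integral X (\<lambda>y. 1) n \<xi>)) \<in> borel_measurable borel"
    by (intro borel_measurable_lim_metric borel_measurable_divide m K_L2 g U.L2_const)
  show "AE x in U. favg X g x = lim (\<lambda>n. tent_integral X g n (X x) / tent_integral X (\<lambda>y. 1) n (X x))"
    using AE_tent_average_tendsto(2)[OF X g] by eventually_elim (simp add: limI)
qed

text \<open>
  The averaging identity for \<open>h\<close> that is only almost everywhere of the form \<open>H (X x)\<close>; the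
  representative \<open>H (X x)\<close> is constant on fibres.
\<close>

lemma ip_favg_fun_of:
  assumes X: "X \<in> borel_measurable U" and g: "g \<in> L2 U" and h: "h \<in> L2 U" "fun_of U X h"
  shows "ip U (favg X g) h = ip U g h"
proof -
  obtain H where H[measurable]: "H \<in> borel_measurable borel" and ae: "AE x in U. h x = H (X x)"
    using h(2) unfolding fun_of_def by blast
  note [measurable] = X L2_measurable[OF h(1)] L2_measurable[OF g] L2_measurable[OF favg_L2[OF X g]]
  have HX: "(\<lambda>x. H (X x)) \<in> L2 U"
  proof -
    have "integrable U (\<lambda>x. (h x)\<^sup>2)" using h by (simp add: L2_def)
    then have "integrable U (\<lambda>x. (H (X x))\<^sup>2)"
      by (rule integrable_cong_AE_imp) (use ae in auto)
    then show ?thesis by (simp add: L2_def)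
  qed
  have "ip U (favg X g) h = ip U (favg X g) (\<lambda>x. H (X x))"
    by (rule ip_cong_AE) (use ae in auto)
  also have "\<dots> = ip U g (\<lambda>x. H (X x))"
    by (rule ip_favg[OF X g HX]) (simp add: const_on_fibres_def)
  also have "\<dots> = ip U g h"
    by (rule ip_cong_AE) (use ae in auto)
  finally show ?thesis .
qed

section \<open>The projected free flow\<close>

text \<open>
  \<open>X0\<close> and \<open>W\<close> are the initial position and velocity of the particles, labelled by mass.
\<close>

locale sticky_flow =
  fixes X0 W :: "real \<Rightarrow> real"
  assumes X0: "X0 \<in> K" and W: "W \<in> L2 U"
begin

definition X :: "real \<Rightarrow> real \<Rightarrow> real" where
  "X t = (SOME p. p \<in> K \<and> (\<forall>g\<in>K. ip U (\<lambda>x. X0 x + t * W x - p x) g \<le> 0)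
            \<and> ip U (\<lambda>x. X0 x + t * W x - p x) p = 0)"

definition R :: "real \<Rightarrow> real \<Rightarrow> real" where
  "R t x = X0 x + t * W x - X t x"

text \<open>
  The velocity is defined without averaging \<open>W\<close>: as the mean of \<open>X0 + t W\<close> over a fibre of \<open>X t\<close> is
  \<open>X t\<close>, this difference quotient is the mean of \<open>W\<close>. In this form it is visibly a function of \<open>X t\<close>,
  being built from two nondecreasing functions that are constant on the fibres of \<open>X t\<close>.
\<close>

definition V :: "real \<Rightarrow> real \<Rightarrow> real" where
  "V t x = (X t x - favg (X t) X0 x) / t"

lemma free_L2: "(\<lambda>x. X0 x + t * W x) \<in> L2 U"
  by (intro L2_intros K_L2 X0 W)

lemma X_spec:
  "X t \<in> K" "g \<in> K \<Longrightarrow> ip U (R t) g \<le> 0" "ip U (R t) (X t) = 0"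
proof -
  have "\<exists>p. p \<in> K \<and> (\<forall>g\<in>K. ip U (\<lambda>x. X0 x + t * W x - p x) g \<le> 0)
            \<and> ip U (\<lambda>x. X0 x + t * W x - p x) p = 0"
    using K_projection_exists[OF free_L2, of t] by blast
  from someI_ex[OF this] show "X t \<in> K" "g \<in> K \<Longrightarrow> ip U (R t) g \<le> 0" "ip U (R t) (X t) = 0"
    unfolding X_def[symmetric] R_def[abs_def] by blast+
qed

lemma X_L2: "X t \<in> L2 U"
  by (intro K_L2 X_spec)

lemma X_measurable[measurable]: "X t \<in> borel_measurable U"
  by (intro L2_measurable X_L2)

lemma X_mono: "mono_on {0<..<1} (X t)"
  using X_spec(1) by (simp add: K_def)

lemma R_L2: "R t \<in> L2 U"
  unfolding R_def[abs_def] by (intro L2_diff free_L2 X_L2)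

lemma R_measurable[measurable]: "R t \<in> borel_measurable U"
  by (intro L2_measurable R_L2)

lemma X_Lipschitz: "nrm U (\<lambda>x. X t x - X s x) \<le> \<bar>t - s\<bar> * nrm U W"
proof -
  have "nrm U (\<lambda>x. X t x - X s x) \<le> nrm U (\<lambda>x. (X0 x + t * W x) - (X0 x + s * W x))"
    using X_spec unfolding R_def[abs_def]
    by (intro cone_projection_nonexpansive free_L2 X_L2) auto
  also have "\<dots> = nrm U (\<lambda>x. (t - s) * W x)" by (simp add: algebra_simps)
  finally show ?thesis unfolding nrm_cmult .
qed

lemma X_0: "AE x in U. X 0 x = X0 x"
proof -
  have "nrm U (\<lambda>x. X 0 x - X0 x) \<le> nrm U (\<lambda>x. X0 x - X0 x)"
  proof (rule cone_projection_nonexpansive)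
    have R0: "R 0 = (\<lambda>x. X0 x - X 0 x)" by (auto simp: R_def)
    show "ip U (\<lambda>x. X0 x - X 0 x) X0 \<le> 0" "ip U (\<lambda>x. X0 x - X 0 x) (X 0) = 0"
      using X_spec(2)[OF X0, of 0] X_spec(3)[of 0] unfolding R0 by auto
  qed (auto simp: ip_def intro: X_L2 K_L2 X0)
  also have "\<dots> = 0" by (simp add: nrm_def ip_def)
  finally have "nrm U (\<lambda>x. X 0 x - X0 x) = 0" using nrm_nonneg[of U "\<lambda>x. X 0 x - X0 x"] by linarith
  then have "AE x in U. X 0 x - X0 x = 0" by (intro nrm_zero_AE L2_diff X_L2 K_L2 X0)
  then show ?thesis by simp
qed

text \<open>
  The indicator function of a superlevel set of \<open>X t\<close> belongs to \<open>K\<close>, which gives one inequality. For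
  the other one, subtracting the truncation of \<open>X t - c\<close> to \<open>[0, 1 / n]\<close> from \<open>X t\<close> leaves a
  nondecreasing function, and \<open>n\<close> times this truncation tends to the indicator function.
\<close>

lemma R_superlevel: "(LINT x|U. R t x * indicator {c<..} (X t x)) = 0"
proof (rule antisym)
  have "(\<lambda>x. indicator {c<..} (X t x)) \<in> K"
    unfolding K_def
  proof (safe intro!: U.L2_bounded[of _ 1] mono_onI)
    fix r s :: real assume "r \<in> {0<..<1}" "s \<in> {0<..<1}" "r \<le> s"
    then have "X t r \<le> X t s" by (rule monotone_onD[OF X_mono])
    then show "indicator {c<..} (X t r) \<le> (indicator {c<..} (X t s) :: real)" by (auto simp: indicator_def)
  qed (auto simp: indicator_def)
  from X_spec(2)[OF this] show "(LINT x|U. R t x * indicator {c<..} (X t x)) \<le> 0" by (simp add: ip_def)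
  define G where "G n u = min (1 / real (Suc n)) (max 0 (u - c))" for n u
  have [measurable]: "G n \<in> borel_measurable borel" for n unfolding G_def[abs_def] by measurable
  have GL: "(\<lambda>x. G n (X t x)) \<in> L2 U" for n
    by (rule U.L2_bounded[of _ "1 / real (Suc n)"]) (auto simp: G_def)
  have G0: "0 \<le> ip U (R t) (\<lambda>x. G n (X t x))" for n
  proof -
    have "(\<lambda>x. X t x - G n (X t x)) \<in> K"
      unfolding K_def
    proof (safe intro!: L2_diff X_L2 GL mono_onI)
      fix r s :: real assume "r \<in> {0<..<1}" "s \<in> {0<..<1}" "r \<le> s"
      then have "X t r \<le> X t s" by (rule monotone_onD[OF X_mono])
      then show "X t r - G n (X t r) \<le> X t s - G n (X t s)"
        unfolding G_def min_def max_def by auto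
    qed
    from X_spec(2)[OF this, of t] show ?thesis
      using X_spec(3) by (simp add: ip_diff_right R_L2 X_L2 GL)
  qed
  have "(\<lambda>n. LINT x|U. R t x * (real (Suc n) * G n (X t x))) \<longlonglongrightarrow> (LINT x|U. R t x * indicator {c<..} (X t x))"
  proof (rule integral_dominated_convergence[where w = "\<lambda>x. \<bar>R t x\<bar>"])
    show "integrable U (\<lambda>x. \<bar>R t x\<bar>)" using U.L2_integrable[OF R_L2] by simp
    show "AE x in U. norm (R t x * (real (Suc n) * G n (X t x))) \<le> \<bar>R t x\<bar>" for n
    proof (rule AE_I2)
      fix x
      have "\<bar>G n (X t x)\<bar> \<le> 1 / real (Suc n)" by (auto simp: G_def)
      then have "real (Suc n) * \<bar>G n (X t x)\<bar> \<le> 1" by (simp add: field_simps)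
      then have "\<bar>R t x\<bar> * (real (Suc n) * \<bar>G n (X t x)\<bar>) \<le> \<bar>R t x\<bar> * 1" by (intro mult_left_mono) auto
      then show "norm (R t x * (real (Suc n) * G n (X t x))) \<le> \<bar>R t x\<bar>" by (simp add: abs_mult)
    qed
    show "AE x in U. (\<lambda>n. R t x * (real (Suc n) * G n (X t x))) \<longlonglongrightarrow> R t x * indicator {c<..} (X t x)"
    proof (rule AE_I2)
      fix x
      have "(\<lambda>n. real (Suc n) * G n (X t x)) \<longlonglongrightarrow> indicator {c<..} (X t x)"
      proof (cases "c < X t x")
        case True
        then obtain N where N: "1 / real (Suc N) < X t x - c" using nat_approx_posE[of "X t x - c"] by auto
        have "\<forall>\<^sub>F n in sequentially. real (Suc n) * G n (X t x) = 1"
          using eventually_ge_at_top[of N]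
        proof eventually_elim
          case (elim n)
          then have "1 / real (Suc n) \<le> 1 / real (Suc N)" by (simp add: frac_le)
          then have "G n (X t x) = 1 / real (Suc n)" using N unfolding G_def by linarith
          then show ?case by simp
        qed
        then show ?thesis using True by (auto intro: tendsto_eventually)
      next
        case False
        then have "G n (X t x) = 0" for n by (auto simp: G_def)
        then show ?thesis using False by simp
      qed
      then show "(\<lambda>n. R t x * (real (Suc n) * G n (X t x))) \<longlonglongrightarrow> R t x * indicator {c<..} (X t x)"
        by (intro tendsto_intros)
    qed
  qed measurable
  then show "0 \<le> (LINT x|U. R t x * indicator {c<..} (X t x))"
  proof (rule tendsto_lowerbound)
    have "(LINT x|U. R t x * (real (Suc n) * G n (X t x))) = real (Suc n) * ip U (R t) (\<lambda>x. G n (X t x))" for n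
      unfolding ip_cmult_right[symmetric] by (simp add: ip_def)
    then show "\<forall>\<^sub>F n in sequentially. 0 \<le> (LINT x|U. R t x * (real (Suc n) * G n (X t x)))"
      using G0 by (intro always_eventually allI) simp
  qed simp
qed

lemma R_orthogonal:
  assumes h: "h \<in> L2 U" "fun_of U (X t) h"
  shows "ip U (R t) h = 0"
  unfolding ip_def
proof (rule U.integral_mult_fun_of_eq_0[where X = "X t"])
  have c: "(\<lambda>x. c) \<in> K" for c using U.L2_const[of c] by (auto simp: K_def mono_on_def)
  from X_spec(2)[OF c, of t 1] X_spec(2)[OF c, of t "-1"] show "(LINT x|U. R t x) = 0"
    by (simp add: ip_def)
qed (use h R_superlevel in \<open>auto intro: U.L2_integrable R_L2 L2_mult_integrable L2_measurable\<close>)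

text \<open>
  Particles that have met stay together. For \<open>N = X t - favg (X s) (X t)\<close>, minimality of \<open>X s\<close> and
  of \<open>X t\<close> gives \<open>\<langle>X0 + s W, N\<rangle> \<le> 0\<close> and \<open>\<langle>X0 + t W, N\<rangle> \<ge> \<parallel>N\<parallel>\<^sup>2\<close>. Eliminating \<open>W\<close> leaves
  \<open>(t - s) \<langle>X0, N\<rangle> + s \<parallel>N\<parallel>\<^sup>2 \<le> 0\<close>, where \<open>\<langle>X0, N\<rangle> \<ge> 0\<close> by Chebyshev's inequality on the fibres.
\<close>

lemma sticky:
  assumes st: "0 < s" "s \<le> t"
  shows "fun_of U (X s) (X t)"
proof -
  define A where "A = favg (X s) (X t)"
  define N where "N x = X t x - A x" for x
  have AK: "A \<in> K" and Af: "fun_of U (X s) A"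
    unfolding A_def by (auto intro!: favg_K fun_of_favg X_spec X_mono)
  have AL: "A \<in> L2 U" using AK by (rule K_L2)
  have NL: "N \<in> L2 U" unfolding N_def[abs_def] by (intro L2_diff X_L2 AL)
  have X0L: "X0 \<in> L2 U" by (intro K_L2 X0)
  have N: "ip U h N = ip U h (X t) - ip U h A" if "h \<in> L2 U" for h
    unfolding N_def[abs_def] using that by (intro ip_diff_right X_L2 AL)
  have orth: "ip U N h = 0" if "h \<in> L2 U" "fun_of U (X s) h" for h
    unfolding N_def[abs_def] using that ip_favg_fun_of[OF X_measurable X_L2 that, of t]
    by (simp add: ip_diff_left X_L2 AL A_def[symmetric])
  have R: "ip U (R r) N = ip U X0 N + r * ip U W N - ip U (X r) N" for r
    unfolding R_def[abs_def] using X0L W NL X_L2 by (simp add: ip_linear L2_intros)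
  have 1: "ip U X0 N + s * ip U W N \<le> 0"
  proof -
    have "ip U (R s) N \<le> 0"
      using X_spec(2)[OF X_spec(1)[of t], of s] R_orthogonal[OF AL Af] by (simp add: N R_L2)
    moreover have "ip U (X s) N = 0" using orth[OF X_L2 fun_of_self] by (simp add: ip_commute)
    ultimately show ?thesis by (simp add: R)
  qed
  have 2: "(nrm U N)\<^sup>2 \<le> ip U X0 N + t * ip U W N"
  proof -
    have "0 \<le> ip U (R t) N"
      using X_spec(2)[OF AK, of t] X_spec(3)[of t] by (simp add: N R_L2)
    moreover have "ip U (X t) N = (nrm U N)\<^sup>2"
      using orth[OF AL Af] N[OF NL] by (simp add: nrm_sq ip_commute)
    ultimately show ?thesis by (simp add: R)
  qed
  have 3: "0 \<le> ip U X0 N"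
    unfolding N_def A_def by (intro ip_favg_diff_nonneg X_measurable X0 X_spec)
  have "s * (nrm U N)\<^sup>2 \<le> s * (ip U X0 N + t * ip U W N)" using 2 st by (intro mult_left_mono) auto
  also have "\<dots> = t * (ip U X0 N + s * ip U W N) - (t - s) * ip U X0 N" by (simp add: algebra_simps)
  also have "\<dots> \<le> 0"
    using mult_nonneg_nonpos[of t, OF _ 1] mult_nonneg_nonneg[of "t - s", OF _ 3] st by simp
  finally have "nrm U N = 0" using st by (simp add: mult_le_0_iff)
  then have "AE x in U. N x = 0" by (intro nrm_zero_AE NL)
  then have "AE x in U. A x = X t x" by eventually_elim (simp add: N_def)
  with Af show ?thesis by (rule fun_of_AE_cong)
qed

section \<open>Velocities\<close>

lemma V_L2: "V t \<in> L2 U"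
  unfolding V_def[abs_def] by (intro L2_divide L2_diff X_L2 favg_L2 X_measurable K_L2 X0)

lemma V_measurable[measurable]: "V t \<in> borel_measurable U"
  by (intro L2_measurable V_L2)

lemma fun_of_V: "fun_of U (X t) (V t)"
  unfolding V_def[abs_def] by (intro fun_of_divide fun_of_diff fun_of_self fun_of_favg X_spec X0)

lemma fun_of_V_earlier: "0 < s \<Longrightarrow> s \<le> t \<Longrightarrow> fun_of U (X s) (V t)"
  by (rule fun_of_trans[OF sticky fun_of_V])

text \<open>
  The velocity is the conditional expectation of the initial velocity given the position: both
  \<open>R t\<close> and \<open>X0 - favg (X t) X0\<close> are orthogonal to the functions of \<open>X t\<close>.
\<close>

lemma V_orthogonal:
  assumes t: "0 < t" and h: "h \<in> L2 U" "fun_of U (X t) h"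
  shows "ip U (\<lambda>x. W x - V t x) h = 0"
proof -
  have AL: "favg (X t) X0 \<in> L2 U" by (intro favg_L2 X_measurable K_L2 X0)
  have X0L: "X0 \<in> L2 U" by (intro K_L2 X0)
  have "(\<lambda>x. t * (W x - V t x)) = (\<lambda>x. R t x - (X0 x - favg (X t) X0 x))"
    using t by (auto simp: R_def V_def field_simps)
  then have "t * ip U (\<lambda>x. W x - V t x) h = ip U (\<lambda>x. R t x - (X0 x - favg (X t) X0 x)) h"
    by (simp add: ip_cmult_left[symmetric])
  also have "\<dots> = 0"
    using R_orthogonal[OF h] ip_favg_fun_of[OF X_measurable X0L h] AL X0L h(1)
    by (simp add: ip_linear L2_intros R_L2)
  finally show ?thesis using t by simp
qed

lemma ip_V: "0 < t \<Longrightarrow> h \<in> L2 U \<Longrightarrow> fun_of U (X t) h \<Longrightarrow> ip U W h = ip U (V t) h"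
  using V_orthogonal[of t h] by (simp add: ip_diff_left W V_L2)

text \<open>
  Pythagoras: \<open>V t\<close> is the conditional expectation of \<open>V s\<close> given \<open>X t\<close>.
\<close>

lemma V_diff_sq:
  assumes "0 < s" "s \<le> t"
  shows "(nrm U (\<lambda>x. V s x - V t x))\<^sup>2 = (nrm U (V s))\<^sup>2 - (nrm U (V t))\<^sup>2"
proof -
  have "ip U (V s) (V t) = ip U (V t) (V t)"
    using ip_V[of s "V t"] ip_V[of t "V t"] assms fun_of_V_earlier fun_of_V V_L2 by simp
  then show ?thesis using nrm_diff_sq[OF V_L2[of s] V_L2[of t]] by (simp add: nrm_sq)
qed

lemma V_norm_antimono:
  assumes "0 < s" "s \<le> t"
  shows "nrm U (V t) \<le> nrm U (V s)"
proof (rule power2_le_imp_le)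
  have "0 \<le> (nrm U (\<lambda>x. V s x - V t x))\<^sup>2" by simp
  then show "(nrm U (V t))\<^sup>2 \<le> (nrm U (V s))\<^sup>2" using V_diff_sq[OF assms] by simp
qed (rule nrm_nonneg)

lemma V_norm_le:
  assumes t: "0 < t"
  shows "nrm U (V t) \<le> nrm U W"
proof -
  have "(nrm U (V t))\<^sup>2 \<le> nrm U W * nrm U (V t)"
    using ip_V[OF t V_L2 fun_of_V] ip_Cauchy_Schwarz[OF W V_L2, of t] by (simp add: nrm_sq)
  then have "nrm U (V t) * nrm U (V t) \<le> nrm U W * nrm U (V t)" by (simp add: power2_eq_square)
  then show ?thesis using nrm_nonneg[of U "V t"] nrm_nonneg[of U W]
    by (cases "nrm U (V t) = 0") (auto simp: mult_le_cancel_right)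
qed

text \<open>
  The displacement from time \<open>s\<close> to \<open>t\<close> is not \<open>(t - s) V t\<close>, as particles in the cluster of \<open>x\<close> at
  time \<open>t\<close> arrive from different places; only the mean over the cluster of this error vanishes.
\<close>

definition err :: "real \<Rightarrow> real \<Rightarrow> real \<Rightarrow> real" where
  "err s t x = X t x - X s x - (t - s) * V t x"

lemma err_L2: "err s t \<in> L2 U"
  unfolding err_def[abs_def] by (intro L2_diff L2_cmult X_L2 V_L2)

lemma err_norm:
  assumes "0 < s" "s \<le> t"
  shows "nrm U (err s t) \<le> 2 * (t - s) * nrm U W"
proof -
  have "nrm U (err s t) \<le> nrm U (\<lambda>x. X t x - X s x) + nrm U (\<lambda>x. (t - s) * V t x)"
    unfolding err_def[abs_def] by (intro nrm_triangle_diff L2_diff L2_cmult X_L2 V_L2)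
  also have "\<dots> \<le> (t - s) * nrm U W + (t - s) * nrm U W"
    using X_Lipschitz[of t s] V_norm_le[of t] assms
    by (intro add_mono) (auto simp: nrm_cmult intro!: mult_left_mono)
  finally show ?thesis by (simp add: algebra_simps)
qed

lemma fun_of_err: "0 < s \<Longrightarrow> s \<le> t \<Longrightarrow> fun_of U (X s) (err s t)"
  unfolding err_def[abs_def]
  by (intro fun_of_diff sticky fun_of_self fun_of_comp[OF fun_of_V_earlier, where G = "\<lambda>u. (t - s) * u"]) auto

text \<open>
  The error is \<open>(t - s) (W - V t) - R t + R s\<close>. All three terms are orthogonal to functions of \<open>X t\<close>,
  the last one because these are functions of \<open>X s\<close>.
\<close>

lemma err_orthogonal:
  assumes st: "0 < s" "s \<le> t" and h: "h \<in> L2 U" "fun_of U (X t) h"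
  shows "ip U (err s t) h = 0"
proof -
  have "err s t = (\<lambda>x. (t - s) * (W x - V t x) - R t x + R s x)"
    by (auto simp: err_def R_def algebra_simps)
  then have "ip U (err s t) h = (t - s) * ip U (\<lambda>x. W x - V t x) h - ip U (R t) h + ip U (R s) h"
    using W V_L2 R_L2 h by (simp add: ip_linear L2_intros)
  also have "\<dots> = 0"
    using V_orthogonal[OF _ h] R_orthogonal[OF h] R_orthogonal[OF h(1) fun_of_trans[OF sticky h(2)]] st by simp
  finally show ?thesis .
qed

end

section \<open>Test functions\<close>

lemma half_plane_convex: "convex half_plane"
  unfolding half_plane_def by (intro convex_Times) auto

lemma half_plane_closed: "closed half_plane"
  unfolding half_plane_def by (intro closed_Times) auto

abbreviation deriv_half_plane :: "(real \<times> real \<Rightarrow> real) \<Rightarrow> real \<times> real \<Rightarrow> real \<times> real \<Rightarrow> real" where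
  "deriv_half_plane f p \<equiv> frechet_derivative f (at p within half_plane)"

lemma deriv_half_plane_works:
  "f differentiable_on half_plane \<Longrightarrow> p \<in> half_plane \<Longrightarrow>
    (f has_derivative deriv_half_plane f p) (at p within half_plane)"
  by (simp add: differentiable_on_def frechet_derivative_works)

lemma linear_pair_expand:
  fixes L :: "real \<times> real \<Rightarrow> real"
  assumes "linear L"
  shows "L h = fst h * L (1, 0) + snd h * L (0, 1)"
proof -
  have "L h = L (fst h *\<^sub>R (1, 0) + snd h *\<^sub>R (0, 1))" by (cases h) simp
  also have "\<dots> = fst h * L (1, 0) + snd h * L (0, 1)"
    using assms by (simp add: linear_add linear_scale del: scaleR_Pair)
  finally show ?thesis .
qed

lemma onorm_pair_le:
  fixes L :: "real \<times> real \<Rightarrow> real"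
  assumes "linear L" "\<bar>L (1, 0)\<bar> \<le> C" "\<bar>L (0, 1)\<bar> \<le> C"
  shows "onorm L \<le> 2 * C"
proof (rule onorm_le)
  fix h :: "real \<times> real"
  have h: "\<bar>fst h\<bar> \<le> norm h" "\<bar>snd h\<bar> \<le> norm h"
    using norm_fst_le[of "fst h" "snd h"] norm_snd_le[of "snd h" "fst h"] by auto
  have "\<bar>L h\<bar> \<le> \<bar>fst h * L (1, 0)\<bar> + \<bar>snd h * L (0, 1)\<bar>"
    unfolding linear_pair_expand[OF assms(1), of h] by simp
  also have "\<dots> \<le> norm h * C + norm h * C"
    unfolding abs_mult using h assms by (intro add_mono mult_mono) auto
  finally show "norm (L h) \<le> 2 * C * norm h" by simp
qed

lemma compact_support_bounded:
  fixes g :: "real \<times> real \<Rightarrow> real"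
  assumes "continuous_on half_plane g" "compact S" "S \<subseteq> half_plane" "\<And>p. p \<in> half_plane - S \<Longrightarrow> g p = 0"
  shows "\<exists>C\<ge>0. \<forall>p\<in>half_plane. \<bar>g p\<bar> \<le> C"
proof -
  have "compact (g ` S)"
    using assms by (intro compact_continuous_image) (auto intro: continuous_on_subset)
  then obtain C where C: "\<And>p. p \<in> S \<Longrightarrow> \<bar>g p\<bar> \<le> C"
    using compact_imp_bounded[of "g ` S"] unfolding bounded_iff by auto
  show ?thesis
  proof (intro exI[of _ "max 0 C"] conjI ballI)
    fix p assume "p \<in> half_plane"
    then show "\<bar>g p\<bar> \<le> max 0 C" using C[of p] assms(4)[of p] by (cases "p \<in> S") auto
  qed simp
qed

lemma deriv_half_plane_zero:
  assumes "closed S" "\<And>p. p \<in> half_plane - S \<Longrightarrow> f p = 0" "p \<in> half_plane - S"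
  shows "deriv_half_plane f p = (\<lambda>w. 0)"
proof (rule frechet_derivative_half_plane)
  show "p \<in> half_plane" using assms by auto
  obtain e where e: "e > 0" "ball p e \<subseteq> - S"
    using openE[of "- S" p] assms by (metis ComplI DiffD2 open_Compl)
  show "(f has_derivative (\<lambda>w. 0)) (at p within half_plane)"
  proof (rule has_derivative_transform_within[OF has_derivative_const[of 0] e(1)])
    fix q assume q: "q \<in> half_plane" "dist q p < e"
    then have "q \<in> ball p e" by (simp add: dist_commute)
    then show "0 = f q" using e q assms(2)[of q] by auto
  qed (use assms in auto)
qed

lemma C1_compact_support_Lipschitz:
  fixes f :: "real \<times> real \<Rightarrow> real"
  assumes d: "f differentiable_on half_plane"
    and c: "\<And>w. continuous_on half_plane (\<lambda>p. deriv_half_plane f p w)"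
    and S: "compact S" "S \<subseteq> half_plane" "\<And>p. p \<in> half_plane - S \<Longrightarrow> f p = 0"
  shows "\<exists>C\<ge>0. \<forall>p\<in>half_plane. \<forall>q\<in>half_plane.
    \<bar>f p\<bar> \<le> C \<and> \<bar>deriv_half_plane f p (1, 0)\<bar> \<le> C \<and> \<bar>deriv_half_plane f p (0, 1)\<bar> \<le> C \<and>
    \<bar>f p - f q\<bar> \<le> C * norm (p - q)"
proof -
  have z: "deriv_half_plane f p w = 0" if "p \<in> half_plane - S" for p w
    using deriv_half_plane_zero[OF compact_imp_closed[OF S(1)] S(3) that] by simp
  obtain C0 where C0: "C0 \<ge> 0" "\<And>p. p \<in> half_plane \<Longrightarrow> \<bar>f p\<bar> \<le> C0"
    using compact_support_bounded[OF differentiable_imp_continuous_on[OF d] S] by blast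
  obtain C1 where C1: "C1 \<ge> 0" "\<And>p. p \<in> half_plane \<Longrightarrow> \<bar>deriv_half_plane f p (1, 0)\<bar> \<le> C1"
    using compact_support_bounded[OF c S(1,2) z] by blast
  obtain C2 where C2: "C2 \<ge> 0" "\<And>p. p \<in> half_plane \<Longrightarrow> \<bar>deriv_half_plane f p (0, 1)\<bar> \<le> C2"
    using compact_support_bounded[OF c S(1,2) z] by blast
  define C where "C = C0 + C1 + C2"
  have on: "onorm (deriv_half_plane f p) \<le> 2 * C" if "p \<in> half_plane" for p
    using C0(1) C1(1) C2(1) C1(2)[OF that] C2(2)[OF that]
    by (intro onorm_pair_le has_derivative_linear[OF deriv_half_plane_works[OF d that]])
      (simp_all add: C_def)
  show ?thesis
  proof (intro exI[of _ "2 * C"] conjI ballI)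
    fix p q :: "real \<times> real" assume p: "p \<in> half_plane" and q: "q \<in> half_plane"
    show "\<bar>f p\<bar> \<le> 2 * C" "\<bar>deriv_half_plane f p (1, 0)\<bar> \<le> 2 * C" "\<bar>deriv_half_plane f p (0, 1)\<bar> \<le> 2 * C"
      using C0 C1 C2 p unfolding C_def by (smt (verit))+
    show "\<bar>f p - f q\<bar> \<le> 2 * C * norm (p - q)"
      using differentiable_bound[OF half_plane_convex deriv_half_plane_works[OF d] on p q] by simp
  qed (use C0 C1 C2 in \<open>simp add: C_def\<close>)
qed

lemma norm_pair_le_sum: "norm ((y, s) - (x, t) :: real \<times> real) \<le> \<bar>y - x\<bar> + \<bar>s - t\<bar>"
  by (simp add: norm_prod_def sqrt_sum_squares_le_sum_abs)

text \<open>
  The bounds by which test functions enter the weak equations. The derivatives are those within the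
  half plane, so the estimates hold up to \<open>t = 0\<close>.
\<close>

locale bounded_test_function =
  fixes \<phi> :: "real \<times> real \<Rightarrow> real" and C T :: real
  assumes C: "0 \<le> C" and T: "0 < T"
    and \<phi>_bound: "\<And>x t. 0 \<le> t \<Longrightarrow> \<bar>\<phi> (x, t)\<bar> \<le> C"
    and px_bound: "\<And>x t. 0 \<le> t \<Longrightarrow> \<bar>partial_x \<phi> x t\<bar> \<le> C"
    and pt_bound: "\<And>x t. 0 \<le> t \<Longrightarrow> \<bar>partial_t \<phi> x t\<bar> \<le> C"
    and \<phi>_support: "\<And>x t. T \<le> t \<Longrightarrow> \<phi> (x, t) = 0"
    and \<phi>_Lipschitz: "\<And>x y s t. 0 \<le> s \<Longrightarrow> 0 \<le> t \<Longrightarrow> \<bar>\<phi> (y, s) - \<phi> (x, t)\<bar> \<le> C * (\<bar>y - x\<bar> + \<bar>s - t\<bar>)"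
    and \<phi>_Taylor: "\<And>x y s t. 0 \<le> s \<Longrightarrow> 0 \<le> t \<Longrightarrow>
       \<bar>\<phi> (y, s) - \<phi> (x, t) - partial_x \<phi> x t * (y - x) - partial_t \<phi> x t * (s - t)\<bar>
         \<le> C * (\<bar>y - x\<bar> + \<bar>s - t\<bar>)\<^sup>2"
    and \<phi>_measurable: "\<And>t. 0 \<le> t \<Longrightarrow> (\<lambda>x. \<phi> (x, t)) \<in> borel_measurable borel"
    and px_measurable: "\<And>t. 0 \<le> t \<Longrightarrow> (\<lambda>x. partial_x \<phi> x t) \<in> borel_measurable borel"
    and pt_measurable: "\<And>t. 0 \<le> t \<Longrightarrow> (\<lambda>x. partial_t \<phi> x t) \<in> borel_measurable borel"

text \<open>
  The second derivatives are continuous with compact support, so the first derivatives are Lipschitz,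
  and the half plane is convex.
\<close>

lemma test_function_bounds:
  assumes "test_function \<phi>"
  shows "\<exists>C T. bounded_test_function \<phi> C T"
proof -
  let ?H = half_plane
  let ?D = "\<lambda>w p. deriv_half_plane \<phi> p w"
  define S where "S = closure {p \<in> ?H. \<phi> p \<noteq> 0}"
  have Ck: "Ck_on n ?H \<phi>" for n using assms by (simp add: test_function_def)
  have S: "compact S" using assms by (simp add: test_function_def S_def)
  have SH: "S \<subseteq> ?H" unfolding S_def by (intro closure_minimal half_plane_closed) auto
  have z: "\<phi> p = 0" if "p \<in> ?H - S" for p
    using that closure_subset[of "{p \<in> ?H. \<phi> p \<noteq> 0}"] unfolding S_def by blast
  have d: "\<phi> differentiable_on ?H" using Ck[of 1] by simp
  have Dz: "?D w p = 0" if "p \<in> ?H - S" for p w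
    using deriv_half_plane_zero[OF compact_imp_closed[OF S] z that] by simp
  have Dd: "?D w differentiable_on ?H" for w
    using Ck[of "Suc (Suc 0)"] unfolding Ck_on.simps by blast
  have Dc: "continuous_on ?H (?D w)" for w by (rule differentiable_imp_continuous_on[OF Dd])
  have DDc: "continuous_on ?H (\<lambda>p. deriv_half_plane (?D w) p v)" for v w
    using Ck[of "Suc (Suc 0)"] unfolding Ck_on.simps by blast
  obtain C0 where C0: "C0 \<ge> 0" "\<forall>p\<in>?H. \<forall>q\<in>?H. \<bar>\<phi> p\<bar> \<le> C0 \<and> \<bar>?D (1, 0) p\<bar> \<le> C0 \<and> \<bar>?D (0, 1) p\<bar> \<le> C0 \<and>
    \<bar>\<phi> p - \<phi> q\<bar> \<le> C0 * norm (p - q)"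
    using C1_compact_support_Lipschitz[OF d Dc S SH z] by blast
  obtain C1 where C1: "C1 \<ge> 0" "\<forall>p\<in>?H. \<forall>q\<in>?H. \<bar>?D (1, 0) p - ?D (1, 0) q\<bar> \<le> C1 * norm (p - q)"
    using C1_compact_support_Lipschitz[OF Dd[of "(1, 0)"] DDc S SH Dz] by blast
  obtain C2 where C2: "C2 \<ge> 0" "\<forall>p\<in>?H. \<forall>q\<in>?H. \<bar>?D (0, 1) p - ?D (0, 1) q\<bar> \<le> C2 * norm (p - q)"
    using C1_compact_support_Lipschitz[OF Dd[of "(0, 1)"] DDc S SH Dz] by blast
  obtain T0 where T0: "\<And>p. p \<in> S \<Longrightarrow> norm p \<le> T0"
    using compact_imp_bounded[OF S] unfolding bounded_iff by blast
  define T where "T = max 0 T0 + 1"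
  have TS: "(x, t) \<in> ?H - S" if "T \<le> t" for x t
    using that T0[of "(x, t)"] norm_snd_le[of t x] by (auto simp: T_def half_plane_def)
  define C where "C = C0 + 2 * (C1 + C2)"
  have H: "(x, t) \<in> ?H" if "0 \<le> t" for x t using that by (simp add: half_plane_def)
  have CC: "C0 \<le> C" "0 \<le> C" using C0(1) C1(1) C2(1) by (auto simp: C_def)
  have "bounded_test_function \<phi> C T"
  proof
    show "0 \<le> C" "0 < T" using CC by (auto simp: T_def)
    fix x y s t :: real
    show "\<phi> (x, t) = 0" if "T \<le> t"
      by (rule z[OF TS[OF that]])
    show "\<bar>\<phi> (x, t)\<bar> \<le> C" "\<bar>partial_x \<phi> x t\<bar> \<le> C" "\<bar>partial_t \<phi> x t\<bar> \<le> C" if "0 \<le> t"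
      using C0(2) H[OF that, of x] CC unfolding partial_x_def partial_t_def by (meson order_trans)+
    have m: "(\<lambda>x. g (x, t)) \<in> borel_measurable borel" if "continuous_on ?H g" "0 \<le> t" for g :: "real \<times> real \<Rightarrow> real"
      by (intro borel_measurable_continuous_onI continuous_on_compose2[OF that(1)] continuous_intros)
        (use H[OF that(2)] in auto)
    show "(\<lambda>x. \<phi> (x, t)) \<in> borel_measurable borel" "(\<lambda>x. partial_x \<phi> x t) \<in> borel_measurable borel"
      "(\<lambda>x. partial_t \<phi> x t) \<in> borel_measurable borel" if "0 \<le> t"
      using m[OF differentiable_imp_continuous_on[OF d] that] m[OF Dc that] by (auto simp: partial_x_def partial_t_def)
    assume s: "0 \<le> s" and t: "0 \<le> t"
    define a where "a = \<bar>y - x\<bar> + \<bar>s - t\<bar>"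
    have na: "norm ((y, s) - (x, t)) \<le> a" unfolding a_def by (rule norm_pair_le_sum)
    have a0: "0 \<le> a" by (simp add: a_def)
    have "\<bar>\<phi> (y, s) - \<phi> (x, t)\<bar> \<le> C0 * norm ((y, s) - (x, t))" using C0(2) H s t by blast
    also have "\<dots> \<le> C * a" using na CC by (intro mult_mono) auto
    finally show "\<bar>\<phi> (y, s) - \<phi> (x, t)\<bar> \<le> C * (\<bar>y - x\<bar> + \<bar>s - t\<bar>)" by (simp add: a_def)
    let ?p = "(x, t)" and ?q = "(y, s)"
    let ?Q = "closed_segment ?p ?q"
    have QH: "?Q \<subseteq> ?H" by (intro closed_segment_subset half_plane_convex H s t)
    have "norm (\<phi> ?q - \<phi> ?p - deriv_half_plane \<phi> ?p (?q - ?p)) \<le> norm (?q - ?p) * (2 * ((C1 + C2) * a))"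
    proof (rule differentiable_bound_linearization[where S = ?Q])
      show "?p + r *\<^sub>R (?q - ?p) \<in> ?Q" if "r \<in> {0..1}" for r
        using that unfolding closed_segment_def by (auto simp: algebra_simps intro!: exI[of _ r])
      show "(\<phi> has_derivative deriv_half_plane \<phi> u) (at u within ?Q)" if "u \<in> ?Q" for u
        using that QH by (intro has_derivative_subset[OF deriv_half_plane_works[OF d]]) auto
      show "onorm (deriv_half_plane \<phi> u - deriv_half_plane \<phi> ?p) \<le> 2 * ((C1 + C2) * a)" if u: "u \<in> ?Q" for u
      proof (rule onorm_pair_le)
        have uH: "u \<in> ?H" using u QH by auto
        have "linear (\<lambda>h. deriv_half_plane \<phi> u h - deriv_half_plane \<phi> ?p h)"
          by (intro linear_compose_sub has_derivative_linear[OF deriv_half_plane_works[OF d]] uH H t)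
        then show "linear (deriv_half_plane \<phi> u - deriv_half_plane \<phi> ?p)" by (simp add: fun_diff_def)
        have "norm (u - ?p) \<le> norm (?q - ?p)" using u by (rule segment_bound1)
        then have ua: "norm (u - ?p) \<le> a" using na by linarith
        have "\<bar>?D (1, 0) u - ?D (1, 0) ?p\<bar> \<le> C1 * norm (u - ?p)" using C1(2) uH H t by blast
        also have "\<dots> \<le> (C1 + C2) * a" using ua C1(1) C2(1) a0 by (intro mult_mono) auto
        finally show "\<bar>(deriv_half_plane \<phi> u - deriv_half_plane \<phi> ?p) (1, 0)\<bar> \<le> (C1 + C2) * a" by simp
        have "\<bar>?D (0, 1) u - ?D (0, 1) ?p\<bar> \<le> C2 * norm (u - ?p)" using C2(2) uH H t by blast
        also have "\<dots> \<le> (C1 + C2) * a" using ua C1(1) C2(1) a0 by (intro mult_mono) auto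
        finally show "\<bar>(deriv_half_plane \<phi> u - deriv_half_plane \<phi> ?p) (0, 1)\<bar> \<le> (C1 + C2) * a" by simp
      qed
    qed simp
    also have "\<dots> \<le> a * (2 * ((C1 + C2) * a))" using na a0 C1(1) C2(1) by (intro mult_right_mono) auto
    also have "\<dots> = 2 * (C1 + C2) * a\<^sup>2" by (simp add: power2_eq_square algebra_simps)
    also have "\<dots> \<le> C * a\<^sup>2" using C0(1) by (intro mult_right_mono) (auto simp: C_def)
    also have "deriv_half_plane \<phi> ?p (?q - ?p) = partial_x \<phi> x t * (y - x) + partial_t \<phi> x t * (s - t)"
      using linear_pair_expand[OF has_derivative_linear[OF deriv_half_plane_works[OF d H[OF t, of x]]], of "?q - ?p"]
      by (simp add: partial_x_def partial_t_def mult.commute)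
    finally show "\<bar>\<phi> (y, s) - \<phi> (x, t) - partial_x \<phi> x t * (y - x) - partial_t \<phi> x t * (s - t)\<bar>
         \<le> C * (\<bar>y - x\<bar> + \<bar>s - t\<bar>)\<^sup>2" by (simp add: a_def diff_diff_eq)
  qed
  then show ?thesis by blast
qed

section \<open>A fundamental theorem for left derivatives\<close>

text \<open>
  The integral of the difference quotient of step \<open>\<delta>\<close> over \<open>[0, \<infinity>)\<close> is the mean of \<open>- h\<close> over
  \<open>[- \<delta>, 0]\<close>, by translation invariance; continuing \<open>h\<close> to the left by the constant \<open>h 0\<close> makes
  this mean equal to \<open>- h 0\<close> for every \<open>\<delta>\<close>. The Lipschitz bound dominates the quotients.
\<close>

lemma integral_left_derivative:
  fixes h g :: "real \<Rightarrow> real"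
  assumes lip: "\<And>s t. 0 \<le> s \<Longrightarrow> 0 \<le> t \<Longrightarrow> \<bar>h t - h s\<bar> \<le> L * \<bar>t - s\<bar>"
    and supp: "\<And>t. T \<le> t \<Longrightarrow> h t = 0" and T: "0 < T" and N: "countable N"
    and lim: "\<And>t. 0 < t \<Longrightarrow> t \<notin> N \<Longrightarrow>
        (\<lambda>n. real (Suc n) * (h t - h (t - 1 / real (Suc n)))) \<longlonglongrightarrow> g t"
  shows "(LINT t:{0..}|lborel. g t) = - h 0"
proof -
  have L: "0 \<le> L" using lip[of 0 1] by auto
  define H where "H t = h (max 0 t)" for t
  have Hlip: "\<bar>H t - H s\<bar> \<le> L * \<bar>t - s\<bar>" for s t
  proof -
    have "\<bar>H t - H s\<bar> \<le> L * \<bar>max 0 t - max 0 s\<bar>" unfolding H_def by (intro lip) auto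
    also have "\<dots> \<le> L * \<bar>t - s\<bar>" using L by (intro mult_left_mono) auto
    finally show ?thesis .
  qed
  have [measurable]: "H \<in> borel_measurable borel"
    by (rule borel_measurable_continuous_onI, rule lipschitz_on_continuous_on[of L], rule lipschitz_onI)
      (use Hlip L in \<open>auto simp: dist_real_def\<close>)
  define q where "q n t = indicator {0..} t * (real (Suc n) * (H t - H (t - 1 / real (Suc n))))" for n t
  have [measurable]: "q n \<in> borel_measurable borel" for n unfolding q_def[abs_def] by measurable
  have qint: "(LINT t|lborel. q n t) = - h 0" for n
  proof -
    let ?d = "1 / real (Suc n)"
    have d: "0 < ?d" "?d \<le> 1" by auto
    \<comment> \<open>Cutting off at \<open>-1\<close> makes the extension integrable; since \<open>1 / Suc n \<le> 1\<close>, it changes the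
      difference quotients only at negative times, by the last term of the identity for \<open>q\<close> below.\<close>
    define k where "k t = indicator {-1..T} t * H t" for t
    have ki: "integrable lborel k"
    proof -
      have "continuous_on {-1..T} H"
        by (rule lipschitz_on_continuous_on[of L], rule lipschitz_onI) (use Hlip L in \<open>auto simp: dist_real_def\<close>)
      then show ?thesis
        using borel_integrable_compact[of "{-1..T}" H] by (simp add: k_def[abs_def] indicator_scaleR_eq_if)
    qed
    have ks: "integrable lborel (\<lambda>t. k (- ?d + t))"
      using lborel_integrable_real_affine[OF ki, of 1 "- ?d"] by simp
    have kI: "(LINT t|lborel. k (- ?d + t)) = (LINT t|lborel. k t)"
      using lborel_integral_real_affine[of 1 k "- ?d"] by simp
    have kH: "k t = H t" if "-1 \<le> t" for t using that T supp[of t] by (cases "t \<le> T") (auto simp: k_def H_def max_def)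
    have k0: "k t = 0" if "t < -1" for t using that by (simp add: k_def)
    have H0: "H t = h 0" if "t \<le> 0" for t using that by (simp add: H_def)
    have "indicator {0..} t * (H t - H (t - d)) = k t - k (- d + t) - h 0 * indicator {-1..<-1 + d} t"
      if d: "0 < d" "d \<le> 1" for t d
    proof -
      consider "t < -1" | "-1 \<le> t" "t < -1 + d" | "-1 + d \<le> t" "t < 0" | "0 \<le> t" using d by linarith
      then show ?thesis
        by cases (use d in \<open>simp_all add: kH k0 H0 indicator_def algebra_simps\<close>)
    qed
    note this[OF d]
    from arg_cong[OF this, of "\<lambda>u. real (Suc n) * u"]
    have "q n t = real (Suc n) * (k t - k (- ?d + t)) - real (Suc n) * h 0 * indicator {-1..<-1 + ?d} t" for t
      by (simp add: q_def algebra_simps del: of_nat_Suc)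
    then have "(LINT t|lborel. q n t)
        = (LINT t|lborel. real (Suc n) * (k t - k (- ?d + t)) - real (Suc n) * h 0 * indicator {-1..<-1 + ?d} t)"
      by simp
    also have "\<dots> = (LINT t|lborel. real (Suc n) * (k t - k (- ?d + t))) - (LINT t|lborel. real (Suc n) * h 0 * indicator {-1..<-1 + ?d} t)"
      using ki ks by (intro Bochner_Integration.integral_diff) auto
    also have "(LINT t|lborel. real (Suc n) * (k t - k (- ?d + t))) = 0"
      using ki ks kI by simp
    also have "(LINT t|lborel. real (Suc n) * h 0 * indicator {-1..<-1 + ?d} t) = h 0"
      by simp
    finally show ?thesis by simp
  qed
  have qlim: "(\<lambda>n. q n t) \<longlonglongrightarrow> indicator {0..} t * g t" if "t \<notin> N \<union> {0}" for t
  proof (cases "t < 0")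
    case True
    then show ?thesis by (simp add: q_def)
  next
    case False
    then have t: "0 < t" "t \<notin> N" using that by auto
    obtain n0 where n0: "1 / real (Suc n0) < t" using nat_approx_posE[OF t(1)] by auto
    have "\<forall>\<^sub>F n in sequentially. real (Suc n) * (h t - h (t - 1 / real (Suc n))) = q n t"
      using eventually_ge_at_top[of n0]
    proof eventually_elim
      case (elim n)
      then have "1 / real (Suc n) \<le> 1 / real (Suc n0)" by (simp add: frac_le)
      then show ?case using n0 t by (simp add: q_def H_def max_def del: of_nat_Suc)
    qed
    from Lim_transform_eventually[OF lim[OF t] this] show ?thesis using t by simp
  qed
  have gm: "(\<lambda>t. indicator {0..} t * g t) \<in> borel_measurable lborel"
  proof (rule measurable_discrete_difference[of "\<lambda>t. lim (\<lambda>n. q n t)" _ _ "N \<union> {0}"])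
    show "(\<lambda>t. lim (\<lambda>n. q n t)) \<in> borel_measurable lborel" by measurable
  qed (use N qlim in \<open>auto simp: limI\<close>)
  have "(\<lambda>n. LINT t|lborel. q n t) \<longlonglongrightarrow> (LINT t|lborel. indicator {0..} t * g t)"
  proof (rule integral_dominated_convergence[where w = "\<lambda>t. L * indicator {0..T + 1} t"])
    show "(\<lambda>t. indicator {0..} t * g t) \<in> borel_measurable lborel" by (rule gm)
    show "integrable lborel (\<lambda>t. L * indicator {0..T + 1} t)"
      using T by (intro integrable_mult_right integrable_real_indicator) auto
    have "AE t in lborel. t \<notin> N \<union> {0}"
      using N by (intro AE_not_in countable_imp_null_set_lborel) auto
    then show "AE t in lborel. (\<lambda>n. q n t) \<longlonglongrightarrow> indicator {0..} t * g t"
      by eventually_elim (rule qlim)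
    show "AE t in lborel. norm (q n t) \<le> L * indicator {0..T + 1} t" for n
    proof (rule AE_I2)
      fix t :: real
      let ?d = "1 / real (Suc n)"
      have d: "0 < ?d" "?d \<le> 1" by auto
      have "real (Suc n) * \<bar>H t - H (t - ?d)\<bar> \<le> real (Suc n) * (L * ?d)"
        using Hlip[of t "t - ?d"] d by (intro mult_left_mono) (auto simp del: of_nat_Suc)
      also have "\<dots> = L" by simp
      finally have 1: "real (Suc n) * \<bar>H t - H (t - ?d)\<bar> \<le> L" .
      have 2: "H t - H (t - ?d) = 0" if "T + 1 < t"
      proof -
        have "T \<le> t - ?d" "T \<le> t" using that d by linarith+
        then show ?thesis using T supp[of t] supp[of "t - ?d"] by (simp add: H_def del: of_nat_Suc)
      qed
      show "norm (q n t) \<le> L * indicator {0..T + 1} t"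
        using 1 2 L by (cases "0 \<le> t"; cases "t \<le> T + 1")
          (auto simp: q_def abs_mult simp del: of_nat_Suc)
    qed
  qed (simp)
  then have "(LINT t|lborel. indicator {0..} t * g t) = - h 0"
    unfolding qint by (simp add: LIMSEQ_const_iff)
  then show ?thesis by (simp add: set_lebesgue_integral_def)
qed

section \<open>The weak equations\<close>

context sticky_flow
begin

text \<open>
  With the weights \<open>1\<close> and \<open>W\<close> this is the integral of \<open>\<phi>\<close> against the mass and the momentum at time
  \<open>t\<close>.
\<close>

definition observable :: "(real \<Rightarrow> real) \<Rightarrow> (real \<times> real \<Rightarrow> real) \<Rightarrow> real \<Rightarrow> real" where
  "observable Z \<phi> t = (LINT x|U. Z x * \<phi> (X t x, t))"

text \<open>
  Here \<open>Zt t\<close> stands for the conditional expectation of the weight given \<open>X t\<close>.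
\<close>

definition observable_rate :: "(real \<Rightarrow> real \<Rightarrow> real) \<Rightarrow> (real \<times> real \<Rightarrow> real) \<Rightarrow> real \<Rightarrow> real" where
  "observable_rate Zt \<phi> t =
    (LINT x|U. Zt t x * (partial_t \<phi> (X t x) t + V t x * partial_x \<phi> (X t x) t))"

context
  fixes \<phi> :: "real \<times> real \<Rightarrow> real" and C T :: real and Z :: "real \<Rightarrow> real"
  assumes bounds: "bounded_test_function \<phi> C T" and Z: "Z \<in> L2 U"
begin

interpretation bounded_test_function \<phi> C T
  by (rule bounds)

lemma bounded_comp_measurable:
  assumes t: "0 \<le> t"
  shows "(\<lambda>x. \<phi> (X t x, t)) \<in> borel_measurable U" "(\<lambda>x. partial_x \<phi> (X t x) t) \<in> borel_measurable U"
    "(\<lambda>x. partial_t \<phi> (X t x) t) \<in> borel_measurable U"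
  using measurable_compose[OF X_measurable[of t] \<phi>_measurable[OF t]]
    measurable_compose[OF X_measurable[of t] px_measurable[OF t]]
    measurable_compose[OF X_measurable[of t] pt_measurable[OF t]] by auto

lemma phi_comp_L2: "0 \<le> t \<Longrightarrow> (\<lambda>x. \<phi> (X t x, t)) \<in> L2 U"
  by (rule U.L2_bounded[of _ C]) (auto intro: bounded_comp_measurable \<phi>_bound)

lemma pt_comp: "0 \<le> t \<Longrightarrow> (\<lambda>x. partial_t \<phi> (X t x) t) \<in> L2 U" "0 \<le> t \<Longrightarrow> fun_of U (X t) (\<lambda>x. partial_t \<phi> (X t x) t)"
  by (rule U.L2_bounded[of _ C], auto intro: bounded_comp_measurable pt_bound)
    (rule fun_of_comp[OF fun_of_self pt_measurable])

lemma px_mult: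
  assumes t: "0 \<le> t" and h: "h \<in> L2 U"
  shows "(\<lambda>x. partial_x \<phi> (X t x) t * h x) \<in> L2 U" "nrm U (\<lambda>x. partial_x \<phi> (X t x) t * h x) \<le> C * nrm U h"
    "fun_of U (X t) h \<Longrightarrow> fun_of U (X t) (\<lambda>x. partial_x \<phi> (X t x) t * h x)"
proof -
  have b: "\<bar>partial_x \<phi> (X t x) t * h x\<bar> \<le> \<bar>C * h x\<bar>" for x
    using mult_right_mono[OF px_bound[OF t, of "X t x"] abs_ge_zero[of "h x"]] C by (simp add: abs_mult)
  have m: "(\<lambda>x. partial_x \<phi> (X t x) t * h x) \<in> borel_measurable U"
    by (intro borel_measurable_times bounded_comp_measurable t L2_measurable h)
  note n = nrm_mono[OF L2_cmult[OF h, of C] m b]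
  show "(\<lambda>x. partial_x \<phi> (X t x) t * h x) \<in> L2 U" by (rule n)
  show "nrm U (\<lambda>x. partial_x \<phi> (X t x) t * h x) \<le> C * nrm U h" using n(2) C by (simp add: nrm_cmult)
  show "fun_of U (X t) (\<lambda>x. partial_x \<phi> (X t x) t * h x)" if "fun_of U (X t) h"
    by (intro fun_of_mult fun_of_comp[OF fun_of_self px_measurable[OF t]] that)
qed

text \<open>
  The distance in space-time that enters the Taylor estimates.
\<close>

definition gap :: "real \<Rightarrow> real \<Rightarrow> real \<Rightarrow> real" where
  "gap s t x = \<bar>X s x - X t x\<bar> + \<bar>s - t\<bar>"

lemma gap_L2: "gap s t \<in> L2 U"
  unfolding gap_def[abs_def] by (intro L2_add L2_abs L2_diff X_L2 U.L2_const)

lemma gap_nonneg: "0 \<le> gap s t x"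
  by (simp add: gap_def)

lemma gap_norm: "nrm U (gap s t) \<le> (nrm U W + 1) * \<bar>s - t\<bar>"
proof -
  have "nrm U (gap s t) \<le> nrm U (\<lambda>x. \<bar>X s x - X t x\<bar>) + nrm U (\<lambda>x. \<bar>s - t\<bar>)"
    unfolding gap_def[abs_def] by (intro nrm_triangle L2_abs L2_diff X_L2 U.L2_const)
  also have "nrm U (\<lambda>x. \<bar>s - t\<bar>) = \<bar>s - t\<bar>" by (simp add: nrm_def ip_def U.prob_space)
  also have "nrm U (\<lambda>x. \<bar>X s x - X t x\<bar>) = nrm U (\<lambda>x. X s x - X t x)" by (simp add: nrm_def ip_def flip: abs_mult)
  also have "nrm U (\<lambda>x. X s x - X t x) \<le> \<bar>s - t\<bar> * nrm U W" by (rule X_Lipschitz)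
  finally show ?thesis by (simp add: algebra_simps)
qed

lemma observable_Lipschitz:
  assumes st: "0 \<le> s" "0 \<le> t"
  shows "\<bar>observable Z \<phi> t - observable Z \<phi> s\<bar> \<le> C * nrm U Z * (nrm U W + 1) * \<bar>t - s\<bar>"
proof -
  let ?d = "\<lambda>x. \<phi> (X t x, t) - \<phi> (X s x, s)"
  have dL: "?d \<in> L2 U" by (intro L2_diff phi_comp_L2 st)
  have "observable Z \<phi> t - observable Z \<phi> s = ip U Z ?d"
    unfolding ip_diff_right[OF phi_comp_L2[OF st(2)] phi_comp_L2[OF st(1)] Z] by (simp add: observable_def ip_def)
  then have 1: "\<bar>observable Z \<phi> t - observable Z \<phi> s\<bar> \<le> nrm U Z * nrm U ?d"
    using ip_Cauchy_Schwarz[OF Z dL] by simp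
  have "nrm U ?d \<le> nrm U (\<lambda>x. C * gap t s x)"
  proof (rule nrm_mono(2)[OF L2_cmult[OF gap_L2] L2_measurable[OF dL]])
    show "\<bar>?d x\<bar> \<le> \<bar>C * gap t s x\<bar>" for x
      using \<phi>_Lipschitz[OF st(2,1), of "X t x" "X s x"] unfolding gap_def
      by (rule order_trans[OF _ abs_ge_self])
  qed
  also have "\<dots> = C * nrm U (gap t s)" using C by (simp add: nrm_cmult)
  also have "\<dots> \<le> C * ((nrm U W + 1) * \<bar>t - s\<bar>)" using C gap_norm by (intro mult_left_mono)
  finally show ?thesis using 1 mult_left_mono[OF _ nrm_nonneg[of U Z]] by (smt (verit) mult.assoc mult.commute)
qed

text \<open>
  One step of the flow. In the first order term the displacement is \<open>(t - s) V t + err s t\<close>. The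
  error is orthogonal to functions of \<open>X t\<close>, and it is a function of \<open>X s\<close>, so that \<open>Z\<close> can be
  replaced first by \<open>Zt s\<close> and then by \<open>Zt s - Zt t\<close>. The Taylor remainder is quadratic for small
  and linear for large displacements.
\<close>

lemma observable_step:
  assumes st: "0 < s" "s \<le> t"
    and Zt: "\<And>t. 0 < t \<Longrightarrow> Zt t \<in> L2 U" "\<And>t. 0 < t \<Longrightarrow> fun_of U (X t) (Zt t)"
      "\<And>t h. 0 < t \<Longrightarrow> h \<in> L2 U \<Longrightarrow> fun_of U (X t) h \<Longrightarrow> ip U Z h = ip U (Zt t) h"
  shows "\<bar>observable Z \<phi> t - observable Z \<phi> s - (t - s) * observable_rate Zt \<phi> t\<bar>
    \<le> (t - s) * (2 * C * nrm U W * nrm U (\<lambda>x. Zt s x - Zt t x)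
        + 3 * C * (nrm U W + 1) * nrm U (\<lambda>x. min 1 (gap s t x) * Z x))"
proof -
  have s0: "0 \<le> s" and t0: "0 \<le> t" and t: "0 < t" using st by auto
  define p where "p x = partial_x \<phi> (X t x) t" for x
  define q where "q x = partial_t \<phi> (X t x) t" for x
  define r where "r x = \<phi> (X s x, s) - \<phi> (X t x, t) - p x * (X s x - X t x) - q x * (s - t)" for x
  have q: "q \<in> L2 U" "fun_of U (X t) q" using pt_comp[OF t0] by (auto simp: q_def[abs_def])
  have pm: "(\<lambda>x. p x * h x) \<in> L2 U" "nrm U (\<lambda>x. p x * h x) \<le> C * nrm U h"
    "fun_of U (X t) h \<Longrightarrow> fun_of U (X t) (\<lambda>x. p x * h x)" if "h \<in> L2 U" for h
    using px_mult[OF t0 that] by (auto simp: p_def[abs_def])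
  have [measurable]: "p \<in> borel_measurable U"
    unfolding p_def[abs_def] by (intro bounded_comp_measurable t0)
  have rL: "r \<in> L2 U"
  proof -
    have "(\<lambda>x. (\<phi> (X s x, s) - \<phi> (X t x, t) - p x * (X s x - X t x)) - (s - t) * q x) \<in> L2 U"
      by (intro L2_diff L2_cmult phi_comp_L2 s0 t0 pm q X_L2)
    then show ?thesis by (simp add: r_def[abs_def] mult.commute)
  qed
  have eL: "err s t \<in> L2 U" by (rule err_L2)
  have expand: "(\<lambda>x. \<phi> (X t x, t) - \<phi> (X s x, s))
      = (\<lambda>x. (t - s) * (q x + p x * V t x) + p x * err s t x - r x)"
    by (auto simp: r_def err_def algebra_simps)
  have pV: "(\<lambda>x. p x * V t x) \<in> L2 U" "fun_of U (X t) (\<lambda>x. p x * V t x)"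
    using pm[OF V_L2] fun_of_V by auto
  have "observable Z \<phi> t - observable Z \<phi> s = ip U Z (\<lambda>x. \<phi> (X t x, t) - \<phi> (X s x, s))"
    unfolding ip_diff_right[OF phi_comp_L2[OF t0] phi_comp_L2[OF s0] Z] by (simp add: observable_def ip_def)
  also have "\<dots> = (t - s) * ip U Z (\<lambda>x. q x + p x * V t x) + ip U Z (\<lambda>x. p x * err s t x) - ip U Z r"
    unfolding expand using Z q pV pm(1)[OF eL] rL by (simp add: ip_linear L2_intros)
  also have "ip U Z (\<lambda>x. q x + p x * V t x) = observable_rate Zt \<phi> t"
    unfolding observable_rate_def using Zt(3)[OF t L2_add[OF q(1) pV(1)] fun_of_add[OF q(2) pV(2)]]
    by (simp add: ip_def p_def q_def mult.commute)
  finally have 1: "observable Z \<phi> t - observable Z \<phi> s - (t - s) * observable_rate Zt \<phi> t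
      = ip U Z (\<lambda>x. p x * err s t x) - ip U Z r" by simp
  have "\<bar>ip U Z (\<lambda>x. p x * err s t x)\<bar> \<le> (t - s) * (2 * C * nrm U W * nrm U (\<lambda>x. Zt s x - Zt t x))"
  proof -
    have "fun_of U (X s) (\<lambda>x. p x * err s t x)"
      unfolding p_def by (intro fun_of_mult fun_of_err st fun_of_comp[OF sticky px_measurable[OF t0]])
    then have "ip U Z (\<lambda>x. p x * err s t x) = ip U (Zt s) (\<lambda>x. p x * err s t x)"
      by (intro Zt st pm(1) eL)
    also have "\<dots> = ip U (\<lambda>x. Zt s x - Zt t x) (\<lambda>x. p x * err s t x) + ip U (Zt t) (\<lambda>x. p x * err s t x)"
      using Zt(1)[OF st(1)] Zt(1)[OF t] pm(1)[OF eL] by (simp add: ip_diff_left)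
    also have "ip U (Zt t) (\<lambda>x. p x * err s t x) = ip U (err s t) (\<lambda>x. p x * Zt t x)"
      by (simp add: ip_def mult_ac)
    also have "\<dots> = 0" by (intro err_orthogonal st pm Zt t)
    finally have "\<bar>ip U Z (\<lambda>x. p x * err s t x)\<bar> \<le> nrm U (\<lambda>x. Zt s x - Zt t x) * nrm U (\<lambda>x. p x * err s t x)"
      using ip_Cauchy_Schwarz[OF L2_diff[OF Zt(1)[OF st(1)] Zt(1)[OF t]] pm(1)[OF eL]] by simp
    also have "\<dots> \<le> nrm U (\<lambda>x. Zt s x - Zt t x) * (C * (2 * (t - s) * nrm U W))"
    proof (rule mult_left_mono)
      have "C * nrm U (err s t) \<le> C * (2 * (t - s) * nrm U W)"
        by (rule mult_left_mono[OF err_norm[OF st] C])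
      then show "nrm U (\<lambda>x. p x * err s t x) \<le> C * (2 * (t - s) * nrm U W)"
        using pm(2)[OF eL] by linarith
    qed (rule nrm_nonneg)
    finally show ?thesis by (simp add: algebra_simps)
  qed
  moreover have "\<bar>ip U Z r\<bar> \<le> (t - s) * (3 * C * (nrm U W + 1) * nrm U (\<lambda>x. min 1 (gap s t x) * Z x))"
  proof -
    let ?m = "\<lambda>x. min 1 (gap s t x)"
    have rb: "\<bar>r x\<bar> \<le> 3 * C * (gap s t x * ?m x)" for x
    proof -
      let ?a = "gap s t x"
      have a: "0 \<le> ?a" "\<bar>X s x - X t x\<bar> \<le> ?a" "\<bar>s - t\<bar> \<le> ?a" by (auto simp: gap_def)
      have "\<bar>r x\<bar> \<le> C * ?a\<^sup>2"
        using \<phi>_Taylor[OF s0 t0, of "X s x" "X t x"] by (simp add: r_def p_def q_def gap_def)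
      moreover have "\<bar>r x\<bar> \<le> 3 * (C * ?a)"
      proof -
        have "\<bar>\<phi> (X s x, s) - \<phi> (X t x, t)\<bar> \<le> C * ?a" using \<phi>_Lipschitz[OF s0 t0] by (simp add: gap_def)
        moreover have "\<bar>p x * (X s x - X t x)\<bar> \<le> C * ?a"
          unfolding abs_mult p_def using a px_bound[OF t0] C by (intro mult_mono) auto
        moreover have "\<bar>q x * (s - t)\<bar> \<le> C * ?a"
          unfolding abs_mult q_def using a pt_bound[OF t0] C by (intro mult_mono) auto
        ultimately show ?thesis unfolding r_def by linarith
      qed
      moreover have "0 \<le> C * ?a\<^sup>2" using C by simp
      ultimately show ?thesis by (cases "?a \<le> 1") (auto simp: min_def power2_eq_square)
    qed
    have mL: "(\<lambda>x. ?m x * Z x) \<in> L2 U"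
    proof (rule L2_mult_bounded[OF Z, where C = 1])
      show "?m \<in> borel_measurable U" using L2_measurable[OF gap_L2] by measurable
      show "\<bar>?m x\<bar> \<le> 1" for x using gap_nonneg[of s t x] by simp
    qed
    have "\<bar>ip U Z r\<bar> \<le> (LINT x|U. \<bar>Z x * r x\<bar>)" unfolding ip_def by (rule integral_abs_bound)
    also have "\<dots> \<le> (LINT x|U. 3 * C * (gap s t x * \<bar>?m x * Z x\<bar>))"
    proof (rule integral_mono)
      show "integrable U (\<lambda>x. \<bar>Z x * r x\<bar>)" by (intro integrable_abs L2_mult_integrable Z rL)
      show "integrable U (\<lambda>x. 3 * C * (gap s t x * \<bar>?m x * Z x\<bar>))"
        by (intro integrable_mult_right L2_mult_integrable gap_L2 L2_abs mL)
      fix x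
      have "\<bar>Z x * r x\<bar> \<le> \<bar>Z x\<bar> * (3 * C * (gap s t x * ?m x))"
        unfolding abs_mult by (intro mult_left_mono rb) auto
      also have "\<dots> = 3 * C * (gap s t x * \<bar>?m x * Z x\<bar>)"
        using gap_nonneg[of s t x] by (simp add: abs_mult mult_ac)
      finally show "\<bar>Z x * r x\<bar> \<le> 3 * C * (gap s t x * \<bar>?m x * Z x\<bar>)" .
    qed
    also have "\<dots> = 3 * C * ip U (gap s t) (\<lambda>x. \<bar>?m x * Z x\<bar>)" by (simp add: ip_def)
    also have "\<dots> \<le> 3 * C * (nrm U (gap s t) * nrm U (\<lambda>x. ?m x * Z x))"
    proof (rule mult_left_mono)
      have "nrm U (\<lambda>x. \<bar>?m x * Z x\<bar>) = nrm U (\<lambda>x. ?m x * Z x)"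
        by (simp add: nrm_def ip_def flip: abs_mult)
      then show "ip U (gap s t) (\<lambda>x. \<bar>?m x * Z x\<bar>) \<le> nrm U (gap s t) * nrm U (\<lambda>x. ?m x * Z x)"
        using ip_Cauchy_Schwarz[OF gap_L2 L2_abs[OF mL], of s t] by simp
    qed (use C in simp)
    also have "\<dots> \<le> 3 * C * (((nrm U W + 1) * (t - s)) * nrm U (\<lambda>x. ?m x * Z x))"
      using gap_norm[of s t] st C by (intro mult_left_mono mult_right_mono nrm_nonneg) auto
    finally show ?thesis by (simp only: mult_ac)
  qed
  ultimately show ?thesis unfolding 1 by (simp add: distrib_left)
qed

text \<open>
  The weight is only square integrable, so its product with the quadratic remainder of the Taylor
  expansion need not be integrable; dividing the remainder by one power of the gap leaves the
  truncated gap as a bounded factor that tends to \<open>0\<close>.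
\<close>

lemma gap_weight_tendsto:
  assumes sn: "s \<longlonglongrightarrow> t"
  shows "(\<lambda>n. nrm U (\<lambda>x. min 1 (gap (s n) t x) * Z x)) \<longlonglongrightarrow> 0"
proof (rule LIMSEQ_I)
  fix e :: real assume e: "0 < e"
  have gm[measurable]: "gap r t \<in> borel_measurable U" for r by (rule L2_measurable[OF gap_L2])
  have [measurable]: "Z \<in> borel_measurable U" using Z by (rule L2_measurable)
  have Z2: "integrable U (\<lambda>x. (Z x)\<^sup>2)" using Z by (simp add: L2_def)
  obtain d where d: "d > 0" "\<And>\<psi>. integrable U \<psi> \<Longrightarrow> (\<forall>x\<in>space U. \<bar>\<psi> x\<bar> \<le> 1) \<Longrightarrow> (LINT x|U. \<bar>\<psi> x\<bar>) < d
      \<Longrightarrow> (LINT x|U. \<bar>(Z x)\<^sup>2\<bar> * \<bar>\<psi> x\<bar>) < e\<^sup>2"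
    using integrable_weight_small[OF Z2, of "e\<^sup>2" 1] e by auto
  have "(\<lambda>n. (nrm U W + 1) * \<bar>s n - t\<bar>) \<longlonglongrightarrow> (nrm U W + 1) * \<bar>t - t\<bar>" by (intro tendsto_intros sn)
  then have "\<forall>\<^sub>F n in sequentially. (nrm U W + 1) * \<bar>s n - t\<bar> < d" using d by (intro order_tendstoD) auto
  then obtain n0 where n0: "\<And>n. n \<ge> n0 \<Longrightarrow> (nrm U W + 1) * \<bar>s n - t\<bar> < d"
    by (auto simp: eventually_sequentially)
  show "\<exists>n0. \<forall>n\<ge>n0. norm (nrm U (\<lambda>x. min 1 (gap (s n) t x) * Z x) - 0) < e"
  proof (intro exI allI impI)
    fix n assume n: "n0 \<le> n"
    define \<psi> where "\<psi> x = (min 1 (gap (s n) t x))\<^sup>2" for x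
    have \<psi>: "0 \<le> \<psi> x" "\<psi> x \<le> 1" "\<psi> x \<le> gap (s n) t x" for x
    proof -
      have m: "0 \<le> min 1 (gap (s n) t x)" "min 1 (gap (s n) t x) \<le> 1" using gap_nonneg by auto
      show "0 \<le> \<psi> x" by (simp add: \<psi>_def)
      have "\<psi> x \<le> min 1 (gap (s n) t x)"
        unfolding \<psi>_def power2_eq_square using m by (intro mult_left_le) auto
      then show "\<psi> x \<le> 1" "\<psi> x \<le> gap (s n) t x" by auto
    qed
    have [measurable]: "\<psi> \<in> borel_measurable U" unfolding \<psi>_def[abs_def] by measurable
    have \<psi>i: "integrable U \<psi>" by (rule U.integrable_const_bound[of _ 1]) (use \<psi> in auto)
    have "(LINT x|U. \<bar>\<psi> x\<bar>) \<le> (LINT x|U. \<bar>gap (s n) t x\<bar>)"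
      using \<psi> \<psi>i U.L2_integrable[OF gap_L2] by (intro integral_mono) (auto simp: gap_nonneg)
    also have "\<dots> \<le> nrm U (gap (s n) t)" by (rule U.integral_le_nrm[OF gap_L2])
    also have "\<dots> < d" using gap_norm[of "s n" t] n0[OF n] by linarith
    finally have "(LINT x|U. \<bar>(Z x)\<^sup>2\<bar> * \<bar>\<psi> x\<bar>) < e\<^sup>2" using \<psi> by (intro d \<psi>i) auto
    also have "(LINT x|U. \<bar>(Z x)\<^sup>2\<bar> * \<bar>\<psi> x\<bar>) = (nrm U (\<lambda>x. min 1 (gap (s n) t x) * Z x))\<^sup>2"
      unfolding nrm_sq ip_def \<psi>_def by (simp add: power2_eq_square mult_ac)
    finally show "norm (nrm U (\<lambda>x. min 1 (gap (s n) t x) * Z x) - 0) < e"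
      using e power_less_imp_less_base[of _ 2 e] nrm_nonneg[of U] by simp
  qed
qed

lemma weak_equation:
  assumes Zt: "\<And>t. 0 < t \<Longrightarrow> Zt t \<in> L2 U" "\<And>t. 0 < t \<Longrightarrow> fun_of U (X t) (Zt t)"
      "\<And>t h. 0 < t \<Longrightarrow> h \<in> L2 U \<Longrightarrow> fun_of U (X t) h \<Longrightarrow> ip U Z h = ip U (Zt t) h"
    and N: "countable N"
    and cont: "\<And>t. 0 < t \<Longrightarrow> t \<notin> N \<Longrightarrow> ((\<lambda>s. nrm U (\<lambda>x. Zt s x - Zt t x)) \<longlongrightarrow> 0) (at_left t)"
    and g: "\<And>t. 0 < t \<Longrightarrow> g t = observable_rate Zt \<phi> t"
  shows "(LINT t:{0..}|lborel. g t) + observable Z \<phi> 0 = 0"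
proof -
  have "(LINT t:{0..}|lborel. g t) = - observable Z \<phi> 0"
  proof (rule integral_left_derivative[OF observable_Lipschitz _ T N])
    show "observable Z \<phi> t = 0" if "T \<le> t" for t using \<phi>_support[OF that] by (simp add: observable_def)
    fix t :: real assume t: "0 < t" "t \<notin> N"
    define s where "s n = t - 1 / real (Suc n)" for n
    have "(\<lambda>n. t - inverse (real (Suc n))) \<longlonglongrightarrow> t - 0"
      by (intro tendsto_intros LIMSEQ_inverse_real_of_nat)
    then have s: "s \<longlonglongrightarrow> t" by (simp add: s_def[abs_def] inverse_eq_divide)
    have sl: "s n < t" for n by (simp add: s_def)
    have "filterlim s (at_left t) sequentially"
      unfolding filterlim_at using s sl by (auto intro!: always_eventually)
    from filterlim_compose[OF cont[OF t] this]
    have Zl: "(\<lambda>n. nrm U (\<lambda>x. Zt (s n) x - Zt t x)) \<longlonglongrightarrow> 0" .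
    define b where "b n = 2 * C * nrm U W * nrm U (\<lambda>x. Zt (s n) x - Zt t x)
        + 3 * C * (nrm U W + 1) * nrm U (\<lambda>x. min 1 (gap (s n) t x) * Z x)" for n
    have "b \<longlonglongrightarrow> 2 * C * nrm U W * 0 + 3 * C * (nrm U W + 1) * 0"
      unfolding b_def[abs_def] by (intro tendsto_intros Zl gap_weight_tendsto s)
    then have b: "b \<longlonglongrightarrow> 0" by simp
    have "\<forall>\<^sub>F n in sequentially. 0 < s n" using s t by (intro order_tendstoD) auto
    then have "\<forall>\<^sub>F n in sequentially.
        norm (real (Suc n) * (observable Z \<phi> t - observable Z \<phi> (s n)) - observable_rate Zt \<phi> t) \<le> b n"
    proof eventually_elim
      case (elim n)
      have ts: "real (Suc n) * (t - s n) = 1" by (simp add: s_def)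
      have "norm (real (Suc n) * (observable Z \<phi> t - observable Z \<phi> (s n)) - observable_rate Zt \<phi> t)
          = \<bar>real (Suc n) * (observable Z \<phi> t - observable Z \<phi> (s n) - (t - s n) * observable_rate Zt \<phi> t)\<bar>"
      proof -
        have eq: "m * (a - d * c) = m * a - (m * d) * c" for m a d c :: real by (simp add: algebra_simps)
        show ?thesis unfolding eq ts by simp
      qed
      also have "\<dots> = real (Suc n) * \<bar>observable Z \<phi> t - observable Z \<phi> (s n) - (t - s n) * observable_rate Zt \<phi> t\<bar>"
        by (simp only: abs_mult abs_of_nat)
      also have "\<dots> \<le> real (Suc n) * ((t - s n) * b n)"
        using observable_step[OF elim less_imp_le[OF sl] Zt] unfolding b_def[symmetric] by (intro mult_left_mono) auto
      also have "\<dots> = b n" unfolding mult.assoc[symmetric] ts by simp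
      finally show ?case .
    qed
    then have "(\<lambda>n. real (Suc n) * (observable Z \<phi> t - observable Z \<phi> (s n)) - observable_rate Zt \<phi> t) \<longlonglongrightarrow> 0"
      using b by (rule Lim_null_comparison)
    then show "(\<lambda>n. real (Suc n) * (observable Z \<phi> t - observable Z \<phi> (t - 1 / real (Suc n)))) \<longlonglongrightarrow> g t"
      unfolding g[OF t(1)] s_def by (rule LIM_zero_cancel)
  qed
  then show ?thesis by simp
qed

end

text \<open>
  The sign makes the function nondecreasing.
\<close>

definition jump_times :: "real set" where
  "jump_times = {t \<in> {0<..}. \<not> isCont (\<lambda>t. - (nrm U (V t))\<^sup>2) t}"

lemma countable_jump_times: "countable jump_times"
  unfolding jump_times_def
proof (rule mono_on_ctble_discont_open)
  show "mono_on {0<..} (\<lambda>t. - (nrm U (V t))\<^sup>2)"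
    using V_norm_antimono nrm_nonneg by (auto intro!: mono_onI power_mono)
qed simp

text \<open>
  The kinetic energy controls the variation of the velocity, so the velocity is continuous in mean
  square wherever the energy is continuous.
\<close>

lemma V_left_continuous:
  assumes t: "0 < t" "t \<notin> jump_times"
  shows "((\<lambda>s. nrm U (\<lambda>x. V s x - V t x)) \<longlongrightarrow> 0) (at_left t)"
proof -
  have "isCont (\<lambda>t. - (nrm U (V t))\<^sup>2) t" using t by (simp add: jump_times_def)
  then have "((\<lambda>t. - (nrm U (V t))\<^sup>2) \<longlongrightarrow> - (nrm U (V t))\<^sup>2) (at_left t)"
    unfolding isCont_def by (rule filterlim_mono) (auto simp: at_le)
  from tendsto_minus[OF this] have "((\<lambda>s. (nrm U (V s))\<^sup>2) \<longlongrightarrow> (nrm U (V t))\<^sup>2) (at_left t)"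
    by (simp only: minus_minus)
  then have "((\<lambda>s. sqrt ((nrm U (V s))\<^sup>2 - (nrm U (V t))\<^sup>2)) \<longlongrightarrow> sqrt ((nrm U (V t))\<^sup>2 - (nrm U (V t))\<^sup>2)) (at_left t)"
    by (rule tendsto_real_sqrt[OF tendsto_diff[OF _ tendsto_const]])
  then have "((\<lambda>s. sqrt ((nrm U (V s))\<^sup>2 - (nrm U (V t))\<^sup>2)) \<longlongrightarrow> 0) (at_left t)" by simp
  moreover have "\<forall>\<^sub>F s in at_left t. sqrt ((nrm U (V s))\<^sup>2 - (nrm U (V t))\<^sup>2) = nrm U (\<lambda>x. V s x - V t x)"
  proof (rule eventually_at_leftI[of 0])
    fix s assume "s \<in> {0<..<t}"
    then show "sqrt ((nrm U (V s))\<^sup>2 - (nrm U (V t))\<^sup>2) = nrm U (\<lambda>x. V s x - V t x)"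
      using V_diff_sq[of s t] nrm_nonneg[of U "\<lambda>x. V s x - V t x"] by (simp flip: V_diff_sq)
  qed (rule t)
  ultimately show ?thesis by (rule Lim_transform_eventually)
qed

lemma continuity_equation:
  assumes \<phi>: "test_function \<phi>"
    and g: "\<And>t. 0 < t \<Longrightarrow> g t = (LINT x|U. partial_t \<phi> (X t x) t + V t x * partial_x \<phi> (X t x) t)"
  shows "(LINT t:{0..}|lborel. g t) + (LINT x|U. \<phi> (X 0 x, 0)) = 0"
proof -
  obtain C T where b: "bounded_test_function \<phi> C T" using test_function_bounds[OF \<phi>] by blast
  have "(LINT t:{0..}|lborel. g t) + observable (\<lambda>x. 1) \<phi> 0 = 0"
    by (rule weak_equation[OF b U.L2_const, where Zt = "\<lambda>t x. 1" and N = "{}"])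
      (auto simp: g observable_rate_def nrm_def ip_def intro: U.L2_const fun_of_const)
  then show ?thesis by (simp add: observable_def)
qed

lemma momentum_equation:
  assumes \<phi>: "test_function \<phi>"
    and g: "\<And>t. 0 < t \<Longrightarrow> g t = (LINT x|U. V t x * partial_t \<phi> (X t x) t + (V t x)\<^sup>2 * partial_x \<phi> (X t x) t)"
  shows "(LINT t:{0..}|lborel. g t) + (LINT x|U. W x * \<phi> (X 0 x, 0)) = 0"
proof -
  obtain C T where b: "bounded_test_function \<phi> C T" using test_function_bounds[OF \<phi>] by blast
  have "(LINT t:{0..}|lborel. g t) + observable W \<phi> 0 = 0"
  proof (rule weak_equation[OF b W, where Zt = V and N = jump_times])
    show "g t = observable_rate V \<phi> t" if "0 < t" for t
      by (simp add: g[OF that] observable_rate_def power2_eq_square distrib_left mult.assoc)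
  qed (auto intro: V_L2 fun_of_V ip_V countable_jump_times V_left_continuous)
  then show ?thesis by (simp add: observable_def)
qed

end

section \<open>The velocity field in Eulerian coordinates\<close>

text \<open>
  The weights of the two averages live on disjoint intervals of positions, and a nondecreasing \<open>g\<close>
  is separated by a constant on the corresponding sets of labels.
\<close>

lemma tent_average_mono:
  assumes X: "mono_on {0<..<1} X" and g: "g \<in> K" and less: "\<xi> < \<eta>"
    and n: "1 / real (Suc n) \<le> (\<eta> - \<xi>) / 2"
    and pos: "0 < tent_integral X (\<lambda>y. 1) n \<xi>" "0 < tent_integral X (\<lambda>y. 1) n \<eta>"
  shows "tent_integral X g n \<xi> / tent_integral X (\<lambda>y. 1) n \<xi>
    \<le> tent_integral X g n \<eta> / tent_integral X (\<lambda>y. 1) n \<eta>"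
proof -
  have XM: "X \<in> borel_measurable U" by (rule mono_on_measurable_U[OF X])
  have gL: "g \<in> L2 U" and gm: "mono_on {0<..<1} g" using g by (auto simp: K_def)
  define m where "m = (\<xi> + \<eta>) / 2"
  have lin: "\<bar>\<xi> - x\<bar> < k \<Longrightarrow> x < m" "\<bar>\<eta> - x\<bar> < k \<Longrightarrow> m < x" if "k \<le> (\<eta> - \<xi>) / 2" for x k
    using that unfolding m_def by (auto simp: abs_less_iff field_simps)
  have below: "X y < m" if "tent n (\<xi> - X y) \<noteq> 0" for y
    by (rule lin(1)[OF n tent_nonzero[OF that]])
  have above: "m < X y" if "tent n (\<eta> - X y) \<noteq> 0" for y
    by (rule lin(2)[OF n tent_nonzero[OF that]])
  have ex: "\<exists>y\<in>{0<..<1}. tent n (\<zeta> - X y) \<noteq> 0" if "0 < tent_integral X (\<lambda>y. 1) n \<zeta>" for \<zeta>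
  proof (rule ccontr)
    assume "\<not> ?thesis"
    then have "tent_integral X (\<lambda>y. 1) n \<zeta> = (LINT y|U. 0)"
      unfolding tent_integral_def by (intro Bochner_Integration.integral_cong) (auto simp: space_U)
    then show False using that by simp
  qed
  obtain y1 where y1: "y1 \<in> {0<..<1}" "X y1 < m" using ex[OF pos(1)] below by blast
  obtain y2 where y2: "y2 \<in> {0<..<1}" "m < X y2" using ex[OF pos(2)] above by blast
  define S where "S = g ` {y \<in> {0<..<1}. X y < m}"
  define c where "c = Sup S"
  have sep: "g y \<le> g z" if "y \<in> {0<..<1}" "X y < m" "z \<in> {0<..<1}" "m < X z" for y z
  proof (rule mono_onD[OF gm that(1,3)])
    show "y \<le> z" using mono_onD[OF X that(3,1)] that by linarith
  qed
  have bdd: "bdd_above S" unfolding S_def by (rule bdd_aboveI[of _ "g y2"]) (use sep y2 in auto)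
  have le: "g y \<le> c" if "y \<in> {0<..<1}" "X y < m" for y
    unfolding c_def using that bdd by (intro cSup_upper) (auto simp: S_def)
  have ge: "c \<le> g z" if "z \<in> {0<..<1}" "m < X z" for z
    unfolding c_def by (rule cSup_least) (use y1 sep that in \<open>auto simp: S_def\<close>)
  have ti: "integrable U (\<lambda>y. tent n (\<zeta> - X y))" for \<zeta> by (intro U.L2_integrable tent_comp_L2 XM)
  have tc: "(LINT y|U. c * tent n (\<zeta> - X y)) = c * tent_integral X (\<lambda>y. 1) n \<zeta>" for \<zeta>
    by (simp add: tent_integral_def)
  have "tent_integral X g n \<xi> \<le> (LINT y|U. c * tent n (\<xi> - X y))"
    unfolding tent_integral_def
  proof (rule integral_mono[OF tent_integrable[OF XM gL] integrable_mult_right[OF ti]])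
    fix y assume "y \<in> space U"
    then show "g y * tent n (\<xi> - X y) \<le> c * tent n (\<xi> - X y)"
      using le[of y] below[of y] tent_bounds(1)[of n "\<xi> - X y"]
      by (cases "tent n (\<xi> - X y) = 0") (auto simp: space_U intro!: mult_right_mono)
  qed
  then have 1: "tent_integral X g n \<xi> / tent_integral X (\<lambda>y. 1) n \<xi> \<le> c"
    unfolding tc using pos by (simp add: pos_divide_le_eq)
  have "(LINT y|U. c * tent n (\<eta> - X y)) \<le> tent_integral X g n \<eta>"
    unfolding tent_integral_def
  proof (rule integral_mono[OF integrable_mult_right[OF ti] tent_integrable[OF XM gL]])
    fix y assume "y \<in> space U"
    then show "c * tent n (\<eta> - X y) \<le> g y * tent n (\<eta> - X y)"
      using ge[of y] above[of y] tent_bounds(1)[of n "\<eta> - X y"]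
      by (cases "tent n (\<eta> - X y) = 0") (auto simp: space_U intro!: mult_right_mono)
  qed
  then have "c \<le> tent_integral X g n \<eta> / tent_integral X (\<lambda>y. 1) n \<eta>"
    unfolding tc using pos by (simp add: pos_le_divide_eq)
  with 1 show ?thesis by simp
qed

context sticky_flow
begin

definition bary :: "nat \<Rightarrow> real \<Rightarrow> real \<Rightarrow> real" where
  "bary n \<xi> t = tent_integral (X t) X0 n \<xi> / tent_integral (X t) (\<lambda>y. 1) n \<xi>"

text \<open>
  \<open>lim (\<lambda>n. bary n \<xi> t)\<close> is the mean initial position of the mass that is at \<open>\<xi>\<close> at time \<open>t\<close>. The
  value \<open>0\<close> at \<open>t = 0\<close> is a convention on a null set of times.
\<close>

definition vel :: "real \<Rightarrow> real \<Rightarrow> real" where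
  "vel \<xi> t = (if 0 < t then (\<xi> - lim (\<lambda>n. bary n \<xi> t)) / t else 0)"

lemma X0_L2: "X0 \<in> L2 U"
  by (rule K_L2[OF X0])

lemma tent_integral_flow_measurable:
  assumes g: "g \<in> L2 U"
  shows "(\<lambda>p. tent_integral (X (snd p)) g n (fst p)) \<in> borel_measurable borel"
proof (rule borel_measurable_continuous_onI, rule continuous_at_imp_continuous_on, rule ballI)
  fix p :: "real \<times> real"
  let ?b = "\<lambda>q. real (Suc n) * nrm U g * (\<bar>fst q - fst p\<bar> + \<bar>snd q - snd p\<bar> * nrm U W)"
  have "(?b \<longlongrightarrow> real (Suc n) * nrm U g * (\<bar>fst p - fst p\<bar> + \<bar>snd p - snd p\<bar> * nrm U W)) (at p)"
    by (intro tendsto_intros)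
  then have b: "(?b \<longlongrightarrow> 0) (at p)" by simp
  have "\<bar>tent_integral (X (snd q)) g n (fst q) - tent_integral (X (snd p)) g n (fst p)\<bar> \<le> ?b q" for q
  proof -
    have "\<bar>tent_integral (X (snd q)) g n (fst q) - tent_integral (X (snd p)) g n (fst p)\<bar>
        \<le> real (Suc n) * nrm U g * (\<bar>fst q - fst p\<bar> + nrm U (\<lambda>y. X (snd q) y - X (snd p) y))"
      by (intro tent_integral_diff X_measurable X_L2 g)
    also have "\<dots> \<le> ?b q" by (intro mult_left_mono add_left_mono X_Lipschitz mult_nonneg_nonneg nrm_nonneg) simp
    finally show ?thesis .
  qed
  then have "((\<lambda>q. tent_integral (X (snd q)) g n (fst q) - tent_integral (X (snd p)) g n (fst p)) \<longlongrightarrow> 0) (at p)"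
    by (intro Lim_null_comparison[OF _ b] always_eventually) simp
  then show "isCont (\<lambda>p. tent_integral (X (snd p)) g n (fst p)) p"
    unfolding isCont_def by (rule LIM_zero_cancel)
qed

lemma vel_measurable: "(\<lambda>(x, t). vel x t) \<in> borel_measurable borel"
proof -
  note m[measurable] = tent_integral_flow_measurable[OF X0_L2] tent_integral_flow_measurable[OF U.L2_const[of 1]]
  have l[measurable]: "(\<lambda>p. lim (\<lambda>n. bary n (fst p) (snd p))) \<in> borel_measurable borel"
    unfolding bary_def by (intro borel_measurable_lim_metric borel_measurable_divide m)
  have [measurable]: "fst \<in> borel_measurable (borel :: (real \<times> real) measure)"
    "snd \<in> borel_measurable (borel :: (real \<times> real) measure)"
    by (auto intro!: borel_measurable_continuous_onI continuous_intros)
  have "(\<lambda>p. if 0 < snd p then (fst p - lim (\<lambda>n. bary n (fst p) (snd p))) / snd p else 0) \<in> borel_measurable borel"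
    by measurable
  then show ?thesis by (simp add: vel_def split_beta')
qed

lemma vel_measurable1: "(\<lambda>x. vel x t) \<in> borel_measurable borel"
proof -
  have "(\<lambda>x. (\<lambda>(x, t). vel x t) (x, t)) \<in> borel_measurable borel"
    by (rule measurable_compose[OF _ vel_measurable]) (auto intro!: borel_measurable_continuous_onI continuous_intros)
  then show ?thesis by simp
qed

lemma bary_tendsto: "AE x in U. (\<lambda>n. bary n (X t x) t) \<longlonglongrightarrow> favg (X t) X0 x"
  unfolding bary_def by (rule AE_tent_average_tendsto(2)[OF X_spec(1) X0])

lemma vel_X: "0 < t \<Longrightarrow> AE x in U. vel (X t x) t = V t x"
  using bary_tendsto[of t] by eventually_elim (simp add: vel_def V_def limI)

text \<open>
  The positions at which the limit defining \<open>vel\<close> exists, as a limit of genuine averages.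
\<close>

definition good :: "real \<Rightarrow> real set" where
  "good t = {\<xi>. (\<forall>n. 0 < tent_integral (X t) (\<lambda>y. 1) n \<xi>) \<and> Cauchy (\<lambda>n. bary n \<xi> t)}"

lemma good_sets: "good t \<in> sets borel"
proof -
  note m[measurable] = tent_integral_measurable[OF X_measurable X_L2 X0_L2, of t]
    tent_integral_measurable[OF X_measurable X_L2 U.L2_const[of 1], of t]
  have b[measurable]: "(\<lambda>\<xi>. bary n \<xi> t) \<in> borel_measurable borel" for n unfolding bary_def by measurable
  have "{\<xi> \<in> space borel. \<forall>n. 0 < tent_integral (X t) (\<lambda>y. 1) n \<xi>} \<inter> {\<xi> \<in> space borel. Cauchy (\<lambda>n. bary n \<xi> t)} \<in> sets borel"
    by (intro sets.Int sets_Collect_Cauchy b) measurable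
  then show ?thesis by (simp add: good_def Collect_conj_eq)
qed

lemma AE_good: "AE x in U. X t x \<in> good t"
proof -
  have "AE x in U. \<forall>n. 0 < tent_integral (X t) (\<lambda>y. 1) n (X t x)"
    unfolding AE_all_countable by (intro allI AE_tent_average_tendsto(1)[OF X_spec(1) X0])
  then show ?thesis using bary_tendsto[of t]
    by eventually_elim (simp add: good_def LIMSEQ_imp_Cauchy)
qed

text \<open>
  \<open>\<xi> / t - vel \<xi> t\<close> is the mean initial position divided by \<open>t\<close>, and mean initial positions are
  ordered like the present positions.
\<close>

lemma vel_one_sided_Lipschitz:
  assumes t: "0 < t" and g: "\<xi> \<in> good t" "\<eta> \<in> good t"
  shows "(vel \<xi> t - vel \<eta> t) * (\<xi> - \<eta>) \<le> 1 / t * (\<xi> - \<eta>)\<^sup>2"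
proof -
  define e where "e \<zeta> = lim (\<lambda>n. bary n \<zeta> t)" for \<zeta>
  have e: "(\<lambda>n. bary n \<zeta> t) \<longlonglongrightarrow> e \<zeta>" if "\<zeta> \<in> good t" for \<zeta>
    using that unfolding e_def good_def by (simp add: Cauchy_convergent_iff convergent_LIMSEQ_iff)
  have mono: "e \<zeta> \<le> e \<zeta>'" if z: "\<zeta> \<in> good t" "\<zeta>' \<in> good t" "\<zeta> < \<zeta>'" for \<zeta> \<zeta>'
  proof (rule LIMSEQ_le[OF e[OF z(1)] e[OF z(2)]])
    obtain N where N: "1 / real (Suc N) < (\<zeta>' - \<zeta>) / 2" using nat_approx_posE[of "(\<zeta>' - \<zeta>) / 2"] z by auto
    show "\<exists>N. \<forall>n\<ge>N. bary n \<zeta> t \<le> bary n \<zeta>' t"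
    proof (intro exI allI impI)
      fix n assume n: "N \<le> n"
      then have "1 / real (Suc n) \<le> 1 / real (Suc N)" by (simp add: frac_le)
      then have "1 / real (Suc n) \<le> (\<zeta>' - \<zeta>) / 2" using N by linarith
      then show "bary n \<zeta> t \<le> bary n \<zeta>' t"
        unfolding bary_def using z by (intro tent_average_mono X_mono X0) (auto simp: good_def)
    qed
  qed
  have "0 \<le> (e \<xi> - e \<eta>) * (\<xi> - \<eta>)"
  proof (cases \<xi> \<eta> rule: linorder_cases)
    case less
    then show ?thesis using mono[OF g(1,2)] by (intro mult_nonpos_nonpos) auto
  next
    case greater
    then show ?thesis using mono[OF g(2,1)] by (intro mult_nonneg_nonneg) auto
  qed simp
  moreover have "(vel \<xi> t - vel \<eta> t) * (\<xi> - \<eta>) = 1 / t * (\<xi> - \<eta>)\<^sup>2 - 1 / t * ((e \<xi> - e \<eta>) * (\<xi> - \<eta>))"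
    using t by (simp add: vel_def e_def field_simps power2_eq_square)
  ultimately show ?thesis using t by simp
qed

section \<open>The law of the flow\<close>

definition law :: "real \<Rightarrow> real measure" where
  "law t = distr U borel (X t)"

lemma real_distribution_law: "real_distribution (law t)"
  unfolding law_def by (intro U.real_distribution_distr X_measurable)

lemma law_integral: "f \<in> borel_measurable borel \<Longrightarrow> (LINT x|law t. f x) = (LINT x|U. f (X t x))"
  for f :: "real \<Rightarrow> real"
  unfolding law_def by (rule integral_distr[OF X_measurable])

lemma law_good: "measure (law t) (good t) = 1"
proof -
  have "measure (law t) (good t) = measure U (X t -` good t \<inter> space U)"
    unfolding law_def by (intro measure_distr X_measurable good_sets)
  also have "\<dots> = 1"
    using AE_good[of t] good_sets by (subst U.prob_eq_1) auto
  finally show ?thesis .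
qed

lemma law_energy:
  assumes t: "0 < t" and c: "0 \<le> c"
  shows "(\<integral>\<^sup>+x. ennreal (c * (vel x t)\<^sup>2) \<partial>law t) = ennreal (c * (nrm U (V t))\<^sup>2)"
proof -
  note [measurable] = vel_measurable1
  have "(\<integral>\<^sup>+x. ennreal (c * (vel x t)\<^sup>2) \<partial>law t) = (\<integral>\<^sup>+x. ennreal (c * (vel (X t x) t)\<^sup>2) \<partial>U)"
    unfolding law_def by (rule nn_integral_distr) measurable
  also have "\<dots> = (\<integral>\<^sup>+x. ennreal (c * (V t x)\<^sup>2) \<partial>U)"
    by (rule nn_integral_cong_AE) (use vel_X[OF t] in auto)
  also have "\<dots> = ennreal (c * (nrm U (V t))\<^sup>2)"
    by (rule nn_integral_eq_nrm[OF V_L2 c])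
  finally show ?thesis .
qed

text \<open>
  Convergence of \<open>X s\<close> to \<open>X t\<close> in mean gives almost everywhere convergence along subsequences, and
  bounded continuous functions preserve it.
\<close>

lemma law_narrowly_continuous: "narrowly_continuous_on {0..} law"
  unfolding narrowly_continuous_on_def narrow_tendsto_def
proof (intro ballI allI impI)
  fix t :: real and g :: "real \<Rightarrow> real"
  assume g: "continuous_on UNIV g" and b: "bounded (range g)"
  have gm[measurable]: "g \<in> borel_measurable borel" using g by (rule borel_measurable_continuous_onI)
  obtain B where B: "\<And>x. \<bar>g x\<bar> \<le> B" using b unfolding bounded_iff by auto
  have "((\<lambda>s. LINT x|U. g (X s x)) \<longlongrightarrow> (LINT x|U. g (X t x))) (at t within {0..})"
    unfolding tendsto_at_iff_sequentially
  proof (intro allI impI)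
    fix u assume u: "u \<longlonglongrightarrow> t"
    show "((\<lambda>s. LINT x|U. g (X s x)) \<circ> u) \<longlonglongrightarrow> (LINT x|U. g (X t x))"
      unfolding comp_def
    proof (rule tendstoI, rule ccontr)
      fix e :: real assume e: "0 < e"
        "\<not> (\<forall>\<^sub>F n in sequentially. dist (LINT x|U. g (X (u n) x)) (LINT x|U. g (X t x)) < e)"
      obtain r :: "nat \<Rightarrow> nat" where r: "strict_mono r"
        "\<And>n. \<not> dist (LINT x|U. g (X (u (r n)) x)) (LINT x|U. g (X t x)) < e"
        using not_eventually_sequentiallyD[OF e(2)] by blast
      have ur: "(\<lambda>n. u (r n)) \<longlonglongrightarrow> t" using LIMSEQ_subseq_LIMSEQ[OF u r(1)] by (simp add: o_def)
      have dL: "(\<lambda>x. X s x - X t x) \<in> L2 U" for s by (intro L2_diff X_L2)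
      have "(\<lambda>n. LINT x|U. norm (X (u (r n)) x - X t x)) \<longlonglongrightarrow> 0"
      proof (rule Lim_null_comparison)
        show "\<forall>\<^sub>F n in sequentially. norm (LINT x|U. norm (X (u (r n)) x - X t x)) \<le> \<bar>u (r n) - t\<bar> * nrm U W"
          using U.integral_le_nrm[OF dL] X_Lipschitz by (intro always_eventually allI) (auto intro: order_trans)
        have "(\<lambda>n. \<bar>u (r n) - t\<bar> * nrm U W) \<longlonglongrightarrow> \<bar>t - t\<bar> * nrm U W" by (intro tendsto_intros ur)
        then show "(\<lambda>n. \<bar>u (r n) - t\<bar> * nrm U W) \<longlonglongrightarrow> 0" by simp
      qed
      then obtain q :: "nat \<Rightarrow> nat" where q: "strict_mono q" "AE x in U. (\<lambda>n. X (u (r (q n))) x - X t x) \<longlonglongrightarrow> 0"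
        using tendsto_L1_AE_subseq[of U "\<lambda>n x. X (u (r n)) x - X t x"] U.L2_integrable[OF dL] by auto
      have "(\<lambda>n. LINT x|U. g (X (u (r (q n))) x)) \<longlonglongrightarrow> (LINT x|U. g (X t x))"
      proof (rule integral_dominated_convergence[where w = "\<lambda>x. B"])
        show "AE x in U. (\<lambda>n. g (X (u (r (q n))) x)) \<longlonglongrightarrow> g (X t x)"
          using q(2)
        proof eventually_elim
          case (elim x)
          have "isCont g (X t x)" using g by (simp add: continuous_on_eq_continuous_at)
          then show ?case using LIM_zero_cancel[OF elim] by (rule isCont_tendsto_compose)
        qed
      qed (use B in auto)
      then have "\<forall>\<^sub>F n in sequentially. dist (LINT x|U. g (X (u (r (q n))) x)) (LINT x|U. g (X t x)) < e"
        using e(1) by (rule tendstoD)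
      then show False using r(2) by (auto simp: eventually_sequentially)
    qed
  qed
  then show "((\<lambda>s. LINT x|law s. g x) \<longlongrightarrow> (LINT x|law t. g x)) (at t within {0..})"
    by (simp add: law_integral)
qed

end

section \<open>Existence\<close>

text \<open>
  Absolute continuity is used through uniform continuity, the case of a single interval.
\<close>

lemma absolutely_continuous_fun_uniform:
  assumes "absolutely_continuous_fun f" "0 < e"
  shows "\<exists>d>0. \<forall>x y. \<bar>x - y\<bar> < d \<longrightarrow> \<bar>f x - f y\<bar> < e"
proof -
  obtain d where d: "d > 0" and D: "\<forall>(n::nat) a b. (\<forall>i<n. a i < b i) \<longrightarrow>
        disjoint_family_on (\<lambda>i. {a i<..<b i}) {..<n} \<longrightarrow>
        (\<Sum>i<n. b i - a i) < d \<longrightarrow> (\<Sum>i<n. \<bar>f (b i) - f (a i)\<bar>) < e"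
    using assms unfolding absolutely_continuous_fun_def by blast
  have less: "\<bar>f y - f x\<bar> < e" if "x < y" "y - x < d" for x y
    using D[THEN spec, of "Suc 0", THEN spec, of "\<lambda>i. x", THEN spec, of "\<lambda>i. y"] that
    by (simp add: disjoint_family_on_def lessThan_Suc)
  show ?thesis
  proof (intro exI[of _ d] conjI allI impI)
    fix x y :: real assume "\<bar>x - y\<bar> < d"
    then show "\<bar>f x - f y\<bar> < e"
      using less[of x y] less[of y x] assms(2) by (cases x y rule: linorder_cases) (auto simp: abs_minus_commute)
  qed (rule d)
qed

lemma absolutely_continuous_fun_continuous:
  assumes "absolutely_continuous_fun f"
  shows "continuous_on UNIV f"
  unfolding continuous_on_iff dist_real_def
  using absolutely_continuous_fun_uniform[OF assms] by (metis UNIV_I abs_minus_commute)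

text \<open>
  By uniform continuity, \<open>f\<close> changes by less than \<open>1\<close> on steps of length \<open>d / 2\<close>, and \<open>x\<close> is reached
  from \<open>0\<close> by about \<open>2 \<bar>x\<bar> / d\<close> of them. With a finite second moment this makes the initial
  velocity square integrable.
\<close>

lemma absolutely_continuous_fun_linear_growth:
  assumes "absolutely_continuous_fun f"
  shows "\<exists>a\<ge>0. \<exists>b\<ge>0. \<forall>x. \<bar>f x\<bar> \<le> a + b * \<bar>x\<bar>"
proof -
  obtain d where d: "d > 0" "\<And>x y. \<bar>x - y\<bar> < d \<Longrightarrow> \<bar>f x - f y\<bar> < 1"
    using absolutely_continuous_fun_uniform[OF assms, of 1] by auto
  have step: "\<bar>f x - f 0\<bar> \<le> real n" if "\<bar>x\<bar> \<le> real n * (d / 2)" for n x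
    using that
  proof (induction n arbitrary: x)
    case 0
    then show ?case by simp
  next
    case (Suc n)
    define y where "y = x - sgn x * min \<bar>x\<bar> (d / 2)"
    have y: "\<bar>y\<bar> \<le> real n * (d / 2)" "\<bar>x - y\<bar> < d"
      using Suc.prems d(1) by (auto simp: y_def sgn_if min_def abs_if algebra_simps split: if_splits)
    show ?case using Suc.IH[OF y(1)] d(2)[OF y(2)] by simp
  qed
  have "\<bar>f x\<bar> \<le> (\<bar>f 0\<bar> + 1) + 2 / d * \<bar>x\<bar>" for x
  proof -
    define n where "n = nat \<lceil>2 / d * \<bar>x\<bar>\<rceil>"
    have n: "2 / d * \<bar>x\<bar> \<le> real n" "real n \<le> 2 / d * \<bar>x\<bar> + 1"
      using d(1) unfolding n_def by (auto simp: of_nat_nat intro!: ceiling_mono)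
    have "\<bar>x\<bar> \<le> real n * (d / 2)" using n(1) d(1) by (simp add: field_simps)
    from step[OF this] n(2) show ?thesis by linarith
  qed
  then show ?thesis using d(1) by (intro exI[of _ "\<bar>f 0\<bar> + 1"] conjI exI[of _ "2 / d"]) auto
qed

theorem corollary1p4:
  fixes \<rho>\<^sub>0 :: "real measure" and v\<^sub>0 :: "real \<Rightarrow> real"
  assumes "real_distribution \<rho>\<^sub>0"
    and "integrable \<rho>\<^sub>0 (\<lambda>x. x\<^sup>2)"
    and "absolutely_continuous_fun v\<^sub>0"
  shows "\<exists>(\<rho> :: real \<Rightarrow> real measure) (v :: real \<Rightarrow> real \<Rightarrow> real).
    weak_solution_pair \<rho>\<^sub>0 v\<^sub>0 \<rho> v \<and>
    (\<exists>N\<in>null_sets lborel. \<forall>s t. 0 \<le> s \<longrightarrow> s \<le> t \<longrightarrow> s \<notin> N \<longrightarrow> t \<notin> N \<longrightarrow>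
       (\<integral>\<^sup>+x. ennreal (1 / 2 * (v x t)\<^sup>2) \<partial>\<rho> t) \<le> (\<integral>\<^sup>+x. ennreal (1 / 2 * (v x s)\<^sup>2) \<partial>\<rho> s) \<and>
       (\<integral>\<^sup>+x. ennreal (1 / 2 * (v x s)\<^sup>2) \<partial>\<rho> s) \<le> (\<integral>\<^sup>+x. ennreal (1 / 2 * (v\<^sub>0 x)\<^sup>2) \<partial>\<rho>\<^sub>0)) \<and>
    (AE t in lborel. 0 < t \<longrightarrow>
       (\<exists>A\<in>sets borel. measure (\<rho> t) A = 1 \<and>
          (\<forall>x\<in>A. \<forall>y\<in>A. (v x t - v y t) * (x - y) \<le> 1 / t * (x - y)\<^sup>2)))"
proof -
  interpret \<rho>0: cdf_distribution \<rho>\<^sub>0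
    using assms(1) by (simp add: cdf_distribution_def)
  define Q where "Q = \<rho>0.I"
  have \<rho>Q: "\<rho>\<^sub>0 = distr U borel Q" using \<rho>0.distr_I_eq_M by (simp add: Q_def U_def)
  have Qmono: "mono_on {0<..<1} Q" unfolding Q_def by (rule \<rho>0.mono_I)
  have Qm[measurable]: "Q \<in> borel_measurable U" by (rule mono_on_measurable_U[OF Qmono])
  have cont: "continuous_on UNIV v\<^sub>0" by (rule absolutely_continuous_fun_continuous[OF assms(3)])
  have vm[measurable]: "v\<^sub>0 \<in> borel_measurable borel" by (rule borel_measurable_continuous_onI[OF cont])
  have "integrable U (\<lambda>x. (Q x)\<^sup>2)" using assms(2) unfolding \<rho>Q by (subst (asm) integrable_distr_eq) auto
  then have QL: "Q \<in> L2 U" by (simp add: L2_def)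
  obtain a b where ab: "a \<ge> 0" "b \<ge> 0" "\<And>x. \<bar>v\<^sub>0 x\<bar> \<le> a + b * \<bar>x\<bar>"
    using absolutely_continuous_fun_linear_growth[OF assms(3)] by blast
  define W where "W x = v\<^sub>0 (Q x)" for x
  have WL: "W \<in> L2 U"
  proof (rule nrm_mono(1))
    show "(\<lambda>x. a + b * \<bar>Q x\<bar>) \<in> L2 U" by (intro L2_add U.L2_const L2_cmult L2_abs QL)
    show "W \<in> borel_measurable U" unfolding W_def[abs_def] by measurable
    show "\<bar>W x\<bar> \<le> \<bar>a + b * \<bar>Q x\<bar>\<bar>" for x using ab(3)[of "Q x"] by (simp add: W_def)
  qed
  interpret sticky_flow Q W
    by standard (use Qmono QL WL in \<open>auto simp: K_def\<close>)
  have energy0: "(\<integral>\<^sup>+x. ennreal (1 / 2 * (v\<^sub>0 x)\<^sup>2) \<partial>\<rho>\<^sub>0) = ennreal (1 / 2 * (nrm U W)\<^sup>2)"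
  proof -
    have "(\<integral>\<^sup>+x. ennreal (1 / 2 * (v\<^sub>0 x)\<^sup>2) \<partial>\<rho>\<^sub>0) = (\<integral>\<^sup>+x. ennreal (1 / 2 * (W x)\<^sup>2) \<partial>U)"
      unfolding \<rho>Q W_def by (rule nn_integral_distr) measurable
    then show ?thesis by (subst (asm) nn_integral_eq_nrm[OF WL]) auto
  qed
  have init: "(LINT x|U. f (X 0 x) * k x) = (LINT x|U. f (Q x) * k x)"
    if [measurable]: "f \<in> borel_measurable borel" "k \<in> borel_measurable U" for f k :: "real \<Rightarrow> real"
    by (rule integral_cong_AE) (use X_0 in auto)
  have weak: "weak_solution_pair \<rho>\<^sub>0 v\<^sub>0 law vel"
    unfolding weak_solution_pair_def
  proof (intro conjI allI impI)
    show "integrable \<rho>\<^sub>0 v\<^sub>0"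
      unfolding \<rho>Q using U.L2_integrable[OF WL] by (subst integrable_distr_eq) (auto simp: W_def[abs_def])
    show "(\<lambda>(x, t). vel x t) \<in> borel_measurable (restrict_space borel half_plane)"
      by (rule measurable_restrict_space1[OF vel_measurable])
  next
    fix T :: real assume T: "0 < T"
    have "(\<integral>\<^sup>+t\<in>{0..T}. (\<integral>\<^sup>+x. ennreal ((vel x t)\<^sup>2) \<partial>law t) \<partial>lborel)
        \<le> (\<integral>\<^sup>+t. ennreal ((nrm U W)\<^sup>2) * indicator {0..T} t \<partial>lborel)"
    proof (rule nn_integral_mono, rule mult_right_mono)
      fix t
      show "(\<integral>\<^sup>+x. ennreal ((vel x t)\<^sup>2) \<partial>law t) \<le> ennreal ((nrm U W)\<^sup>2)"
      proof (cases "0 < t")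
        case True
        then show ?thesis using law_energy[OF True, of 1] V_norm_le[OF True] nrm_nonneg
          by (auto intro!: ennreal_leI power_mono)
      qed (simp add: vel_def)
    qed simp
    also have "\<dots> = ennreal ((nrm U W)\<^sup>2) * ennreal T"
      using T by (subst nn_integral_cmult_indicator) auto
    also have "\<dots> < \<infinity>" by (simp add: ennreal_mult_less_top)
    finally show "(\<integral>\<^sup>+t\<in>{0..T}. (\<integral>\<^sup>+x. ennreal ((vel x t)\<^sup>2) \<partial>law t) \<partial>lborel) < \<infinity>" .
  next
    fix \<phi> assume \<phi>: "test_function \<phi>"
    obtain C T where b: "bounded_test_function \<phi> C T" using test_function_bounds[OF \<phi>] by blast
    note m = bounded_test_function.\<phi>_measurable[OF b] bounded_test_function.px_measurable[OF b]
      bounded_test_function.pt_measurable[OF b]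
    have m0[measurable]: "(\<lambda>x. \<phi> (x, 0)) \<in> borel_measurable borel" by (rule m(1)) simp
    note [measurable] = vel_measurable1
    have "(LINT t:{0..}|lborel. (LINT x|law t. partial_t \<phi> x t + vel x t * partial_x \<phi> x t))
        + (LINT x|U. \<phi> (X 0 x, 0)) = 0"
    proof (rule continuity_equation[OF \<phi>])
      fix t :: real assume t: "0 < t"
      note [measurable] = m(2,3)[OF less_imp_le[OF t]]
      have "(LINT x|law t. partial_t \<phi> x t + vel x t * partial_x \<phi> x t)
          = (LINT x|U. partial_t \<phi> (X t x) t + vel (X t x) t * partial_x \<phi> (X t x) t)"
        by (rule law_integral) measurable
      also have "\<dots> = (LINT x|U. partial_t \<phi> (X t x) t + V t x * partial_x \<phi> (X t x) t)"
        by (rule integral_cong_AE) (use vel_X[OF t] in auto)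
      finally show "(LINT x|law t. partial_t \<phi> x t + vel x t * partial_x \<phi> x t)
          = (LINT x|U. partial_t \<phi> (X t x) t + V t x * partial_x \<phi> (X t x) t)" .
    qed
    moreover have "(LINT x|U. \<phi> (X 0 x, 0)) = (LINT x|\<rho>\<^sub>0. \<phi> (x, 0))"
      unfolding \<rho>Q using init[OF m0, of "\<lambda>x. 1"] by (subst integral_distr) auto
    ultimately show "(LINT t:{0..}|lborel. (LINT x|law t. partial_t \<phi> x t + vel x t * partial_x \<phi> x t))
        + (LINT x|\<rho>\<^sub>0. \<phi> (x, 0)) = 0" by simp
    have "(LINT t:{0..}|lborel. (LINT x|law t. vel x t * partial_t \<phi> x t + (vel x t)\<^sup>2 * partial_x \<phi> x t))
        + (LINT x|U. W x * \<phi> (X 0 x, 0)) = 0"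
    proof (rule momentum_equation[OF \<phi>])
      fix t :: real assume t: "0 < t"
      note [measurable] = m(2,3)[OF less_imp_le[OF t]]
      have "(LINT x|law t. vel x t * partial_t \<phi> x t + (vel x t)\<^sup>2 * partial_x \<phi> x t)
          = (LINT x|U. vel (X t x) t * partial_t \<phi> (X t x) t + (vel (X t x) t)\<^sup>2 * partial_x \<phi> (X t x) t)"
        by (rule law_integral) measurable
      also have "\<dots> = (LINT x|U. V t x * partial_t \<phi> (X t x) t + (V t x)\<^sup>2 * partial_x \<phi> (X t x) t)"
        by (rule integral_cong_AE) (use vel_X[OF t] in auto)
      finally show "(LINT x|law t. vel x t * partial_t \<phi> x t + (vel x t)\<^sup>2 * partial_x \<phi> x t)
          = (LINT x|U. V t x * partial_t \<phi> (X t x) t + (V t x)\<^sup>2 * partial_x \<phi> (X t x) t)" .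
    qed
    moreover have "(LINT x|U. W x * \<phi> (X 0 x, 0)) = (LINT x|\<rho>\<^sub>0. \<phi> (x, 0) * v\<^sub>0 x)"
      unfolding \<rho>Q using init[OF m0 L2_measurable[OF WL]]
      by (subst integral_distr) (auto simp: W_def mult.commute)
    ultimately show "(LINT t:{0..}|lborel. (LINT x|law t. vel x t * partial_t \<phi> x t + (vel x t)\<^sup>2 * partial_x \<phi> x t))
        + (LINT x|\<rho>\<^sub>0. \<phi> (x, 0) * v\<^sub>0 x) = 0" by simp
  qed (use assms(1) cont real_distribution_law law_narrowly_continuous in auto)
  have energy: "(\<integral>\<^sup>+x. ennreal (1 / 2 * (vel x t)\<^sup>2) \<partial>law t) \<le> (\<integral>\<^sup>+x. ennreal (1 / 2 * (vel x s)\<^sup>2) \<partial>law s) \<and>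
       (\<integral>\<^sup>+x. ennreal (1 / 2 * (vel x s)\<^sup>2) \<partial>law s) \<le> (\<integral>\<^sup>+x. ennreal (1 / 2 * (v\<^sub>0 x)\<^sup>2) \<partial>\<rho>\<^sub>0)"
    if st: "0 < s" "s \<le> t" for s t
  proof -
    have t: "0 < t" using st by simp
    have e: "(\<integral>\<^sup>+x. ennreal (1 / 2 * (vel x r)\<^sup>2) \<partial>law r) = ennreal (1 / 2 * (nrm U (V r))\<^sup>2)" if "0 < r" for r
      by (rule law_energy[OF that]) simp
    show ?thesis
      unfolding e[OF t] e[OF st(1)] energy0
      using V_norm_antimono[OF st] V_norm_le[OF st(1)]
      by (intro conjI ennreal_leI mult_left_mono power_mono nrm_nonneg) auto
  qed
  show ?thesis
  proof (rule exI[of _ law], rule exI[of _ vel], intro conjI weak)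
    show "\<exists>N\<in>null_sets lborel. \<forall>s t. 0 \<le> s \<longrightarrow> s \<le> t \<longrightarrow> s \<notin> N \<longrightarrow> t \<notin> N \<longrightarrow>
       (\<integral>\<^sup>+x. ennreal (1 / 2 * (vel x t)\<^sup>2) \<partial>law t) \<le> (\<integral>\<^sup>+x. ennreal (1 / 2 * (vel x s)\<^sup>2) \<partial>law s) \<and>
       (\<integral>\<^sup>+x. ennreal (1 / 2 * (vel x s)\<^sup>2) \<partial>law s) \<le> (\<integral>\<^sup>+x. ennreal (1 / 2 * (v\<^sub>0 x)\<^sup>2) \<partial>\<rho>\<^sub>0)"
    proof (rule bexI[of _ "{0}"], intro allI impI)
      fix s t :: real assume "0 \<le> s" "s \<le> t" "s \<notin> {0}"
      then show "(\<integral>\<^sup>+x. ennreal (1 / 2 * (vel x t)\<^sup>2) \<partial>law t) \<le> (\<integral>\<^sup>+x. ennreal (1 / 2 * (vel x s)\<^sup>2) \<partial>law s) \<and>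
       (\<integral>\<^sup>+x. ennreal (1 / 2 * (vel x s)\<^sup>2) \<partial>law s) \<le> (\<integral>\<^sup>+x. ennreal (1 / 2 * (v\<^sub>0 x)\<^sup>2) \<partial>\<rho>\<^sub>0)"
        by (intro energy) auto
    qed (rule countable_imp_null_set_lborel, simp)
    show "AE t in lborel. 0 < t \<longrightarrow> (\<exists>A\<in>sets borel. measure (law t) A = 1 \<and>
          (\<forall>x\<in>A. \<forall>y\<in>A. (vel x t - vel y t) * (x - y) \<le> 1 / t * (x - y)\<^sup>2))"
    proof (rule AE_I2, rule impI)
      fix t :: real assume "0 < t"
      then show "\<exists>A\<in>sets borel. measure (law t) A = 1 \<and>
          (\<forall>x\<in>A. \<forall>y\<in>A. (vel x t - vel y t) * (x - y) \<le> 1 / t * (x - y)\<^sup>2)"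
        by (intro bexI[of _ "good t"] conjI law_good ballI vel_one_sided_Lipschitz good_sets)
    qed
  qed
qed

end
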